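(* Let $k$ be a field, $1\le t\le n$, $d=n-t+1$, and $b=2$. With the indeterminates of $R=k[x_{ij}:1\le i\le n,\ 1\le j\le 2]$ re-indexed as $z_1,\dots,z_{2n}$ as in the context, the monomial ideal $J_t$ is a stable monomial ideal. In particular, the associated Eliahou–Kervaire complex provides a linear minimal free resolution for $J_t$ equipped with a structure of graded differential algebra.
   Context: The ideal $J_t$: let $T_j$ ($j=1,2$) be the $t\times n$ matrix whose entry in row $r$ and column $c$ is $x_{c-r+1,j}$ if $c\ge r$ and $0$ if $c<r$, and let $\mathbf T=[T_1\ T_2]$, a $t\times 2n$ matrix. $J_t$ is the monomial ideal of $R$ generated by the products of the entries of the main diagonals of the $t\times t$ submatrices of $\mathbf T$, i.e. by all nonzero products $\mathbf T_{1,c_1}\mathbf T_{2,c_2}\cdots\mathbf T_{t,c_t}$ with $1\le c_1<c_2<\cdots<c_t\le 2n$. Re-indexing: $z_i=x_{i1}$ for $1\le i\le d$; $z_{d+i}=x_{i2}$ for $1\le i\le d$; $z_{2d+i}=x_{d+i,1}$ for $1\le i\le t-1$. The remaining $t-1$ indeterminates $x_{d+1,2},\dots,x_{n,2}$ do not occur in the minimal generators of $J_t$ and are given the last indices $2d+t,\dots,2n$. Stable: for a monomial $w\ne 1$ let $\max(w)$ be the largest index of a variable dividing $w$. A monomial ideal $I\subset k[z_1,\dots,z_N]$ is stable if for every monomial $w\in I$ and every $i<m=\max(w)$, the monomial $z_iw/z_m$ belongs to $I$. Eliahou–Kervaire complex of a stable ideal $I$ with minimal monomial generating set $G(I)$: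 in homological degree $q\ge0$ it is the free module on symbols $e(\sigma;u)$ with $u\in G(I)$, $\sigma=(i_1<\cdots<i_q)$ and $i_q<\max(u)$ (such symbols are called admissible; $\sigma$ is empty if $q=0$). Each monomial $w\in I$ can be written uniquely as $w=g(w)y$ with $g(w)\in G(I)$ and $\max(g(w))\le\min(y)$, where $\min(y)$ is the smallest index of a variable dividing $y$ (no condition if $y=1$). With $\sigma_r$ denoting $\sigma$ with $i_r$ removed, $u_r=g(z_{i_r}u)$ and $y_r=z_{i_r}u/u_r$, the differential is $$d\,e(\sigma;u)=\sum_{r=1}^q(-1)^r z_{i_r}e(\sigma_r;u)-\sum_{r}(-1)^r y_r\,e(\sigma_r;u_r),$$ the second sum being over those $r$ for which $e(\sigma_r;u_r)$ is admissible; the augmentation to $I$ is $e(\emptyset;u)\mapsto u$. "Linear" means that, $J_t$ being generated in degree $t$, the entries of the matrices of the differentials are linear forms or zero. A graded differential algebra structure is, as usual, understood on the resolution of $R/J_t$ obtained by splicing the resolution of $J_t$ with $J_t\subset R$ (so that $R$ sits in degree $0$): a graded-algebra multiplication for which the differential satisfies the graded Leibniz rule. *)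

theory Defs
  imports "HOL-Library.Poly_Mapping" "HOL-Library.Disjoint_Sets" "HOL-Algebra.Ideal"
    "HOL-Algebra.Module"
begin

section \<open>The polynomial ring\<close>

text \<open>A monomial is its exponent vector, written additively: the monomial 1 is \<open>0\<close>, products are
  sums, and \<open>w - v\<close> is the quotient of \<open>w\<close> by a divisor \<open>v\<close>.  The polynomials of the type
  \<open>'k zpoly\<close> have indeterminates \<open>z\<^sub>0, z\<^sub>1, \<dots>\<close>; \<open>k[z\<^sub>1,\<dots>,z\<^sub>N]\<close> is the subring \<open>poly_ring N\<close>.\<close>

type_synonym monom = "nat \<Rightarrow>\<^sub>0 nat"
type_synonym 'k zpoly = "monom \<Rightarrow>\<^sub>0 'k"

definition mon :: "monom \<Rightarrow> 'k::field zpoly" where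
  "mon u = Poly_Mapping.single u 1"

definition zexp :: "nat \<Rightarrow> monom" where
  "zexp i = Poly_Mapping.single i 1"

definition zvar :: "nat \<Rightarrow> 'k::field zpoly" where
  "zvar i = mon (zexp i)"

definition mdeg :: "monom \<Rightarrow> nat" where
  "mdeg u = (\<Sum>i\<in>Poly_Mapping.keys u. Poly_Mapping.lookup u i)"

definition mmax :: "monom \<Rightarrow> nat" where
  "mmax u = Max (Poly_Mapping.keys u)"

definition mmin :: "monom \<Rightarrow> nat" where
  "mmin u = Min (Poly_Mapping.keys u)"

text \<open>Being a module record, this is the ring together with its regular module.\<close>

definition poly_ring :: "nat \<Rightarrow> ('k::field zpoly, 'k zpoly) module" where
  "poly_ring N =
    \<lparr>carrier = {p. \<forall>u\<in>Poly_Mapping.keys p. Poly_Mapping.keys u \<subseteq> {1..N}},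
     mult = (*), one = 1, zero = 0, add = (+), smult = (*)\<rparr>"


section \<open>Stable monomial ideals\<close>

definition monomial_ideal :: "nat \<Rightarrow> 'k::field zpoly set \<Rightarrow> bool" where
  "monomial_ideal N I \<longleftrightarrow>
    (\<exists>M. mon ` M \<subseteq> carrier (poly_ring N :: ('k zpoly, 'k zpoly) module) \<and>
         I = Idl\<^bsub>poly_ring N\<^esub> (mon ` M))"

definition stable_monomial_ideal :: "nat \<Rightarrow> 'k::field zpoly set \<Rightarrow> bool" where
  "stable_monomial_ideal N I \<longleftrightarrow> monomial_ideal N I \<and>
    (\<forall>w. mon w \<in> I \<longrightarrow> w \<noteq> 0 \<longrightarrow>
      (\<forall>i. 1 \<le> i \<longrightarrow> i < mmax w \<longrightarrow> mon (zexp i + w - zexp (mmax w)) \<in> I))"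

definition min_gens :: "'k::field zpoly set \<Rightarrow> monom set" where
  "min_gens I = {u. mon u \<in> I \<and> (\<forall>v y. mon v \<in> I \<longrightarrow> u = v + y \<longrightarrow> v = u)}"


section \<open>The ideal $J_t$\<close>

text \<open>\<open>z_index n t i j\<close> is the index of the indeterminate \<open>x\<^sub>i\<^sub>j\<close> in the list \<open>z\<^sub>1,\<dots>,z\<^sub>2\<^sub>n\<close>.\<close>

definition z_index :: "nat \<Rightarrow> nat \<Rightarrow> nat \<Rightarrow> nat \<Rightarrow> nat" where
  "z_index n t i j =
    (let d = n - t + 1 in
      if j = 1 then (if i \<le> d then i else 2 * d + (i - d))
      else (if i \<le> d then d + i else 2 * d + (t - 1) + (i - d)))"

lemma z_index_bij:
  assumes "1 \<le> t" "t \<le> n"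
  shows "bij_betw (\<lambda>(i, j). z_index n t i j) ({1..n} \<times> {1, 2}) {1..2 * n}"
proof (rule bij_betw_imageI)
  show inj: "inj_on (\<lambda>(i, j). z_index n t i j) ({1..n} \<times> {1, 2})"
    using assms by (auto simp: inj_on_def z_index_def Let_def split: if_splits)
  have "(\<lambda>(i, j). z_index n t i j) ` ({1..n} \<times> {1, 2}) \<subseteq> {1..2 * n}"
    using assms by (auto simp: z_index_def Let_def)
  moreover have "card ((\<lambda>(i, j). z_index n t i j) ` ({1..n} \<times> {1, 2})) = card {1..2 * n}"
    using card_image[OF inj] by (simp add: card_cartesian_product)
  ultimately show "(\<lambda>(i, j). z_index n t i j) ` ({1..n} \<times> {1, 2}) = {1..2 * n}"
    by (simp add: card_subset_eq)
qed

definition xvar :: "nat \<Rightarrow> nat \<Rightarrow> nat \<Rightarrow> nat \<Rightarrow> 'k::field zpoly" where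
  "xvar n t i j = zvar (z_index n t i j)"

definition Tblock :: "nat \<Rightarrow> nat \<Rightarrow> nat \<Rightarrow> nat \<Rightarrow> nat \<Rightarrow> 'k::field zpoly" where
  "Tblock n t j r c = (if r \<le> c then xvar n t (c - r + 1) j else 0)"

definition Tmat :: "nat \<Rightarrow> nat \<Rightarrow> nat \<Rightarrow> nat \<Rightarrow> 'k::field zpoly" where
  "Tmat n t r c = (if c \<le> n then Tblock n t 1 r c else Tblock n t 2 r (c - n))"

definition J_gens :: "nat \<Rightarrow> nat \<Rightarrow> 'k::field zpoly set" where
  "J_gens n t =
    {(\<Prod>r=1..t. Tmat n t r (c r)) | c.
      c ` {1..t} \<subseteq> {1..2 * n} \<and> strict_mono_on {1..t} c \<and> (\<Prod>r=1..t. Tmat n t r (c r)) \<noteq> (0 :: 'k zpoly)}"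

definition J_ideal :: "nat \<Rightarrow> nat \<Rightarrow> 'k::field zpoly set" where
  "J_ideal n t = Idl\<^bsub>poly_ring (2 * n)\<^esub> (J_gens n t)"


section \<open>Free modules, resolutions, differential graded algebras\<close>

definition scale :: "'k::field zpoly \<Rightarrow> ('b \<Rightarrow>\<^sub>0 'k zpoly) \<Rightarrow> ('b \<Rightarrow>\<^sub>0 'k zpoly)" where
  "scale p f = Poly_Mapping.map (\<lambda>c. p * c) f"

text \<open>The free \<open>k[z\<^sub>1,\<dots>,z\<^sub>N]\<close>-module on a set \<open>B\<close>, with basis vectors \<open>single s 1\<close>.  The record
  fields \<open>mult\<close> and \<open>one\<close> play no role in the module structure.\<close>

definition free_module :: "nat \<Rightarrow> 'b set \<Rightarrow> ('k::field zpoly, 'b \<Rightarrow>\<^sub>0 'k zpoly) module" where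
  "free_module N B =
    \<lparr>carrier = {f. Poly_Mapping.keys f \<subseteq> B \<and>
                  (\<forall>s. Poly_Mapping.lookup f s \<in> carrier (poly_ring N :: ('k zpoly, 'k zpoly) module))},
     mult = undefined, one = undefined, zero = 0, add = (+), smult = scale\<rparr>"

definition lin_ext :: "('b \<Rightarrow> ('c \<Rightarrow>\<^sub>0 'k::field zpoly)) \<Rightarrow> ('b \<Rightarrow>\<^sub>0 'k zpoly) \<Rightarrow> ('c \<Rightarrow>\<^sub>0 'k zpoly)" where
  "lin_ext \<phi> f = (\<Sum>s\<in>Poly_Mapping.keys f. scale (Poly_Mapping.lookup f s) (\<phi> s))"

definition linear_maps ::
  "('a, 'p) ring_scheme \<Rightarrow> ('a, 'm, 'q) module_scheme \<Rightarrow> ('a, 'n, 's) module_scheme \<Rightarrow> ('m \<Rightarrow> 'n) set" where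
  "linear_maps R M M' =
    {f \<in> carrier M \<rightarrow> carrier M'.
      (\<forall>x\<in>carrier M. \<forall>y\<in>carrier M. f (x \<oplus>\<^bsub>M\<^esub> y) = f x \<oplus>\<^bsub>M'\<^esub> f y) \<and>
      (\<forall>a\<in>carrier R. \<forall>x\<in>carrier M. f (a \<odot>\<^bsub>M\<^esub> x) = a \<odot>\<^bsub>M'\<^esub> f x)}"

text \<open>Complexes of free modules \<open>F\<^sub>q\<close> are given by bases \<open>B q\<close>; \<open>d q\<close> is the map from \<open>F\<^sub>q\<^sub>+\<^sub>1\<close> to
  \<open>F\<^sub>q\<close>, and \<open>aug\<close> the augmentation from \<open>F\<^sub>0\<close> onto \<open>I\<close>.\<close>

definition free_resolution ::
  "nat \<Rightarrow> (nat \<Rightarrow> 'b set) \<Rightarrow> (nat \<Rightarrow> ('b \<Rightarrow>\<^sub>0 'k::field zpoly) \<Rightarrow> ('b \<Rightarrow>\<^sub>0 'k zpoly)) \<Rightarrow>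
    (('b \<Rightarrow>\<^sub>0 'k zpoly) \<Rightarrow> 'k zpoly) \<Rightarrow> 'k zpoly set \<Rightarrow> bool" where
  "free_resolution N B d aug I \<longleftrightarrow>
    (let R = poly_ring N :: ('k zpoly, 'k zpoly) module; F = (\<lambda>q. free_module N (B q)) in
      (\<forall>q. d q \<in> linear_maps R (F (Suc q)) (F q)) \<and>
      aug \<in> linear_maps R (F 0) R \<and>
      aug ` carrier (F 0) = I \<and>
      {x \<in> carrier (F 0). aug x = 0} = d 0 ` carrier (F 1) \<and>
      (\<forall>q. {x \<in> carrier (F (Suc q)). d q x = 0} = d (Suc q) ` carrier (F (Suc (Suc q)))))"

text \<open>\<open>d\<close> maps \<open>F\<^sub>q\<^sub>+\<^sub>1\<close> into \<open>\<mm> F\<^sub>q\<close>, where \<open>\<mm> = (z\<^sub>1,\<dots>,z\<^sub>N)\<close>.\<close>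

definition minimal_complex ::
  "nat \<Rightarrow> (nat \<Rightarrow> 'b set) \<Rightarrow> (nat \<Rightarrow> ('b \<Rightarrow>\<^sub>0 'k::field zpoly) \<Rightarrow> ('b \<Rightarrow>\<^sub>0 'k zpoly)) \<Rightarrow> bool" where
  "minimal_complex N B d \<longleftrightarrow>
    (\<forall>q. \<forall>x\<in>carrier (free_module N (B (Suc q))). \<forall>s.
      Poly_Mapping.lookup (d q x) s \<in> Idl\<^bsub>poly_ring N\<^esub> (zvar ` {1..N}))"

text \<open>The condition on \<open>p\<close> includes \<open>p = 0\<close>.\<close>

definition linear_form :: "'k::field zpoly \<Rightarrow> bool" where
  "linear_form p \<longleftrightarrow> (\<forall>u\<in>Poly_Mapping.keys p. mdeg u = 1)"

definition linear_complex ::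
  "(nat \<Rightarrow> 'b set) \<Rightarrow> (nat \<Rightarrow> ('b \<Rightarrow>\<^sub>0 'k::field zpoly) \<Rightarrow> ('b \<Rightarrow>\<^sub>0 'k zpoly)) \<Rightarrow> bool" where
  "linear_complex B d \<longleftrightarrow>
    (\<forall>q. \<forall>s\<in>B (Suc q). \<forall>s'\<in>B q. linear_form (Poly_Mapping.lookup (d q (Poly_Mapping.single s 1)) s'))"

text \<open>The graded module \<open>A\<close> is free on the disjoint union of the \<open>B p\<close>, its component \<open>A\<^sub>p\<close> of
  degree \<open>p\<close> being free on \<open>B p\<close>; it becomes a differential graded \<open>k[z\<^sub>1,\<dots>,z\<^sub>N]\<close>-algebra with
  multiplication \<open>mul\<close> and unit \<open>e\<close>.\<close>

definition dg_algebra ::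
  "nat \<Rightarrow> (nat \<Rightarrow> 'b set) \<Rightarrow> (('b \<Rightarrow>\<^sub>0 'k::field zpoly) \<Rightarrow> ('b \<Rightarrow>\<^sub>0 'k zpoly)) \<Rightarrow> ('b \<Rightarrow>\<^sub>0 'k zpoly) \<Rightarrow>
    (('b \<Rightarrow>\<^sub>0 'k zpoly) \<Rightarrow> ('b \<Rightarrow>\<^sub>0 'k zpoly) \<Rightarrow> ('b \<Rightarrow>\<^sub>0 'k zpoly)) \<Rightarrow> bool" where
  "dg_algebra N B d e mul \<longleftrightarrow>
    (let R = poly_ring N :: ('k zpoly, 'k zpoly) module;
         A = (free_module N (\<Union>p. B p))\<lparr>mult := mul, one := e\<rparr>;
         comp = (\<lambda>p. carrier (free_module N (B p)) :: ('b \<Rightarrow>\<^sub>0 'k zpoly) set) in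
      disjoint_family B \<and> ring A \<and> module R A \<and>
      (\<forall>a\<in>carrier R. \<forall>x\<in>carrier A. \<forall>y\<in>carrier A.
        (a \<odot>\<^bsub>A\<^esub> x) \<otimes>\<^bsub>A\<^esub> y = a \<odot>\<^bsub>A\<^esub> (x \<otimes>\<^bsub>A\<^esub> y) \<and> x \<otimes>\<^bsub>A\<^esub> (a \<odot>\<^bsub>A\<^esub> y) = a \<odot>\<^bsub>A\<^esub> (x \<otimes>\<^bsub>A\<^esub> y)) \<and>
      \<one>\<^bsub>A\<^esub> \<in> comp 0 \<and>
      (\<forall>p q. \<forall>x\<in>comp p. \<forall>y\<in>comp q. x \<otimes>\<^bsub>A\<^esub> y \<in> comp (p + q)) \<and>
      d \<in> linear_maps R A A \<and>
      (\<forall>x\<in>comp 0. d x = 0) \<and> (\<forall>p. d ` comp (Suc p) \<subseteq> comp p) \<and>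
      (\<forall>x\<in>carrier A. d (d x) = 0) \<and>
      (\<forall>p. \<forall>x\<in>comp p. \<forall>y\<in>carrier A. d (x \<otimes>\<^bsub>A\<^esub> y) = d x \<otimes>\<^bsub>A\<^esub> y \<oplus>\<^bsub>A\<^esub> ((- 1) ^ p) \<odot>\<^bsub>A\<^esub> (x \<otimes>\<^bsub>A\<^esub> d y)))"


section \<open>The Eliahou--Kervaire complex\<close>

text \<open>The symbol \<open>e(\<sigma>;u)\<close> is the pair \<open>(\<sigma>, u)\<close>, with \<open>\<sigma>\<close> as an increasing list.\<close>

type_synonym symb = "nat list \<times> monom"

definition ek_basis :: "'k::field zpoly set \<Rightarrow> nat \<Rightarrow> symb set" where
  "ek_basis I q =
    {(\<sigma>, u). length \<sigma> = q \<and> sorted_wrt (<) \<sigma> \<and> u \<in> min_gens I \<and> (\<forall>i\<in>set \<sigma>. 1 \<le> i \<and> i < mmax u)}"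

definition ek_g :: "'k::field zpoly set \<Rightarrow> monom \<Rightarrow> monom" where
  "ek_g I w = (THE u. u \<in> min_gens I \<and> (\<exists>y. w = u + y \<and> (y = 0 \<or> mmax u \<le> mmin y)))"

text \<open>\<open>del r \<sigma>\<close> removes the \<open>r\<close>-th entry, counted from 1.\<close>

definition del :: "nat \<Rightarrow> 'a list \<Rightarrow> 'a list" where
  "del r \<sigma> = take (r - 1) \<sigma> @ drop r \<sigma>"

fun ek_diff_symb :: "'k::field zpoly set \<Rightarrow> symb \<Rightarrow> (symb \<Rightarrow>\<^sub>0 'k zpoly)" where
  "ek_diff_symb I (\<sigma>, u) =
    (let q = length \<sigma>;
         i = (\<lambda>r. \<sigma> ! (r - 1));
         u' = (\<lambda>r. ek_g I (zexp (i r) + u));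
         y = (\<lambda>r. zexp (i r) + u - u' r) in
      (\<Sum>r=1..q. Poly_Mapping.single (del r \<sigma>, u) ((- 1) ^ r * zvar (i r))) -
      (\<Sum>r | r \<in> {1..q} \<and> (del r \<sigma>, u' r) \<in> ek_basis I (q - 1).
        Poly_Mapping.single (del r \<sigma>, u' r) ((- 1) ^ r * mon (y r))))"

definition ek_diff :: "'k::field zpoly set \<Rightarrow> (symb \<Rightarrow>\<^sub>0 'k zpoly) \<Rightarrow> (symb \<Rightarrow>\<^sub>0 'k zpoly)" where
  "ek_diff I = lin_ext (ek_diff_symb I)"

definition ek_aug :: "(symb \<Rightarrow>\<^sub>0 'k::field zpoly) \<Rightarrow> 'k zpoly" where
  "ek_aug f = (\<Sum>s\<in>Poly_Mapping.keys f. Poly_Mapping.lookup f s * mon (snd s))"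

text \<open>Splicing with \<open>I \<subset> R\<close>: the basis vector \<open>None\<close> spans \<open>R\<close> in degree 0, and the
  symbols of degree \<open>q\<close> of the Eliahou--Kervaire complex are put in degree \<open>q + 1\<close>.\<close>

definition spliced_basis :: "'k::field zpoly set \<Rightarrow> nat \<Rightarrow> symb option set" where
  "spliced_basis I p = (case p of 0 \<Rightarrow> {None} | Suc q \<Rightarrow> Some ` ek_basis I q)"

fun spliced_diff_symb :: "'k::field zpoly set \<Rightarrow> symb option \<Rightarrow> (symb option \<Rightarrow>\<^sub>0 'k zpoly)" where
  "spliced_diff_symb I None = 0"
| "spliced_diff_symb I (Some (\<sigma>, u)) =
    (if \<sigma> = [] then Poly_Mapping.single None (mon u)
     else lin_ext (\<lambda>s. Poly_Mapping.single (Some s) 1) (ek_diff_symb I (\<sigma>, u)))"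

definition spliced_diff ::
  "'k::field zpoly set \<Rightarrow> (symb option \<Rightarrow>\<^sub>0 'k zpoly) \<Rightarrow> (symb option \<Rightarrow>\<^sub>0 'k zpoly)" where
  "spliced_diff I = lin_ext (spliced_diff_symb I)"

end

theory Submission
  imports Defs "HOL-Library.Multiset"
begin

text \<open>\<open>J\<^sub>t\<close> is generated in the single degree \<open>t\<close>, and replacing the last variable of a generator by an
  earlier one gives a generator again; so \<open>J\<^sub>t\<close> is stable, and \<open>g(z\<^sub>i u) = z\<^sub>i u / z\<^sub>m\<close> for
  \<open>i < m = max(u)\<close>, which makes the Eliahou--Kervaire differential linear.

  Let \<open>C\<close> be the exterior algebra on \<open>e\<^sub>1,\<dots>,e\<^sub>N\<close> over \<open>k[z,y]/(y)\<^sup>t\<close>, a differential graded algebra with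
  \<open>d e\<^sub>i = z\<^sub>i - y\<^sub>i\<close>.  Sending \<open>e(\<sigma>;u)\<close> to the sum of the \<open>q\<^sub>m(u) e\<^sub>m e\<^sub>\<sigma>\<close> over all \<open>m\<close> beyond \<open>\<sigma>\<close>, where
  \<open>(z\<^sub>m - y\<^sub>m) q\<^sub>m(u)\<close> are the differences that telescope to \<open>u(z) - u(y)\<close>, embeds the spliced complex
  into \<open>C\<close>.  The multiples of the \<open>y\<^sup>a e\<^sub>S\<close> with \<open>max(a) \<le> max(S)\<close> span a subalgebra \<open>K\<close>, and for the ideal
  generated by all monomials of degree \<open>t\<close> the image of the embedding is the set of all \<open>c\<close> with \<open>c\<close> and
  \<open>d c\<close> in \<open>K\<close>; by the Leibniz rule it is a differential graded subalgebra.  For other stable ideals a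
  condition on \<open>a\<close> and \<open>max(S)\<close> cuts out a smaller subalgebra in place of \<open>K\<close>.

  In particular the Eliahou--Kervaire differential squares to zero; exactness follows by comparing
  leading terms.\<close>

text \<open>The obstacle is associativity, which is laborious to verify for a product defined on
  symbols. Here a product is instead the unique preimage of the product of the images in C, so that
  associativity and the Leibniz rule are inherited; the work lies in showing that the image is
  closed under multiplication, hence its description by a support condition on c and d c. For a
  stable ideal generated in degree t the condition on y^a e_S asks that y^a z_max(S), completed to
  degree t by any variables of index at most max(S), be a generator. It is multiplicative: the
  factor with the larger maximum takes the other exponent into its completion. Degree t - 1 in y
  controls everything: there e(\<sigma>;u) has coefficient 1 or -1 at a position of its own, with
  exponent u / z_max(u) at the set \<sigma> enlarged by max(u). This gives injectivity, and the
  coefficients at these positions are those of the preimage. The quotient by (y)^t is never formed: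
  elements keep coefficients in k[z][y] and are compared modulo y-degree at least t.\<close>

abbreviation lookup :: "('a \<Rightarrow>\<^sub>0 'b::zero) \<Rightarrow> 'a \<Rightarrow> 'b" where "lookup \<equiv> Poly_Mapping.lookup"
abbreviation keys :: "('a \<Rightarrow>\<^sub>0 'b::zero) \<Rightarrow> 'a set" where "keys \<equiv> Poly_Mapping.keys"
abbreviation single :: "'a \<Rightarrow> 'b \<Rightarrow> 'a \<Rightarrow>\<^sub>0 'b::zero" where "single \<equiv> Poly_Mapping.single"

section \<open>Exponent vectors: degree, largest and smallest index, exchange of variables\<close>

lemma lookup_zexp: "lookup (zexp i) j = (if i = j then 1 else 0)"
  by (simp add: zexp_def lookup_single)

lemma keys_zexp [simp]: "keys (zexp i) = {i}"
  by (simp add: zexp_def)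

lemma keys_add_monom: "keys (u + v :: monom) = keys u \<union> keys v"
  by (auto simp: in_keys_iff lookup_add)

lemma keys_diff_monom: "keys (u - v :: monom) \<subseteq> keys u"
  by (auto simp: in_keys_iff lookup_minus)

lemma zexp_add_diff: "i \<in> keys u \<Longrightarrow> zexp i + (u - zexp i) = u"
  by (intro poly_mapping_eqI) (auto simp: lookup_add lookup_minus lookup_zexp in_keys_iff)

lemma mdeg_superset: "finite S \<Longrightarrow> keys u \<subseteq> S \<Longrightarrow> mdeg u = (\<Sum>i\<in>S. lookup u i)"
  unfolding mdeg_def by (rule sum.mono_neutral_left) (auto simp: in_keys_iff)

lemma mdeg_add: "mdeg (u + v) = mdeg u + mdeg v"
  using mdeg_superset[of "keys u \<union> keys v" "u + v"] mdeg_superset[of "keys u \<union> keys v" u]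
    mdeg_superset[of "keys u \<union> keys v" v]
  by (simp add: keys_add_monom lookup_add sum.distrib)

lemma mdeg_zexp [simp]: "mdeg (zexp i) = 1"
  by (simp add: mdeg_def lookup_zexp)

lemma mdeg_0 [simp]: "mdeg 0 = 0"
  by (simp add: mdeg_def)

lemma mdeg_eq_0_iff [simp]: "mdeg u = 0 \<longleftrightarrow> u = 0"
proof
  assume "mdeg u = 0"
  hence "\<forall>i\<in>keys u. lookup u i = 0" unfolding mdeg_def by simp
  thus "u = 0" by (intro poly_mapping_eqI) (auto simp: in_keys_iff)
qed simp

lemma mmax_in_keys: "u \<noteq> 0 \<Longrightarrow> mmax u \<in> keys u"
  unfolding mmax_def by (rule Max_in) auto

lemma mmax_ge: "i \<in> keys u \<Longrightarrow> i \<le> mmax u"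
  unfolding mmax_def by simp

lemma mmax_eqI: "m \<in> keys u \<Longrightarrow> (\<And>i. i \<in> keys u \<Longrightarrow> i \<le> m) \<Longrightarrow> mmax u = m"
  unfolding mmax_def by (intro Max_eqI) auto

lemma mmin_zexp [simp]: "mmin (zexp i) = i"
  by (simp add: mmin_def)

lemma mmin_le: "i \<in> keys u \<Longrightarrow> mmin u \<le> i"
  unfolding mmin_def by simp

text \<open>Subtraction of exponent vectors is truncated at 0 in each place, so undoing it requires
  that z_m divides \<open>u\<close>.\<close>

lemma exchange_add:
  assumes "m \<in> keys u"
  shows "zexp i + u - zexp m + zexp m = zexp i + u"
  using assms by (intro poly_mapping_eqI) (auto simp: lookup_add lookup_minus lookup_zexp in_keys_iff)

lemma mon_mult: "mon (u + v) = mon u * mon v"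
  by (simp add: mon_def mult_single)

lemma mon_0 [simp]: "mon 0 = 1"
  by (simp add: mon_def)

lemma keys_mon [simp]: "keys (mon u :: 'k::field zpoly) = {u}"
  by (simp add: mon_def)

lemma poly_mapping_sum_single: "p = (\<Sum>w\<in>keys p. single w (lookup p w))"
proof (rule poly_mapping_eqI)
  fix w
  have "(\<Sum>v\<in>keys p. lookup (single v (lookup p v)) w) = (\<Sum>v\<in>keys p. if v = w then lookup p v else 0)"
    by (intro sum.cong) (auto simp: lookup_single)
  thus "lookup p w = lookup (\<Sum>v\<in>keys p. single v (lookup p v)) w"
    by (auto simp: lookup_sum in_keys_iff)
qed

section \<open>The polynomial ring and its monomial ideals\<close>

definition polys :: "nat \<Rightarrow> 'k::field zpoly set" where
  "polys N = {p. \<forall>u\<in>keys p. keys u \<subseteq> {1..N}}"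

lemma poly_ring_simps [simp]:
  "carrier (poly_ring N) = polys N" "x \<oplus>\<^bsub>poly_ring N\<^esub> y = x + y" "x \<otimes>\<^bsub>poly_ring N\<^esub> y = x * y"
  "\<zero>\<^bsub>poly_ring N\<^esub> = 0" "\<one>\<^bsub>poly_ring N\<^esub> = 1" "x \<odot>\<^bsub>poly_ring N\<^esub> y = x * y"
  by (simp_all add: poly_ring_def polys_def)

lemma polys_0 [simp]: "0 \<in> polys N"
  by (simp add: polys_def)

lemma polys_add: "p \<in> polys N \<Longrightarrow> q \<in> polys N \<Longrightarrow> p + q \<in> polys N"
  unfolding polys_def using Poly_Mapping.keys_add[of p q] by blast

lemma polys_uminus [simp]: "- p \<in> polys N \<longleftrightarrow> p \<in> polys N"
  by (simp add: polys_def in_keys_iff)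

lemma polys_mult: "p \<in> polys N \<Longrightarrow> q \<in> polys N \<Longrightarrow> p * q \<in> polys N"
  unfolding polys_def using keys_mult[of p q] by (fastforce simp: keys_add_monom)

lemma polys_single: "keys u \<subseteq> {1..N} \<Longrightarrow> single u c \<in> polys N"
  by (simp add: polys_def)

lemma polys_mon [simp]: "mon u \<in> (polys N :: 'k::field zpoly set) \<longleftrightarrow> keys u \<subseteq> {1..N}"
  by (simp add: polys_def)

lemma polys_1 [simp]: "1 \<in> polys N"
  by (simp add: polys_def)

lemma polys_sum: "(\<And>x. x \<in> A \<Longrightarrow> f x \<in> polys N) \<Longrightarrow> sum f A \<in> polys N"
  by (induction A rule: infinite_finite_induct) (auto intro: polys_add)

lemma polys_neg_one_power [simp]: "(- 1) ^ n \<in> polys N"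
  by (induction n) (auto intro: polys_mult)

lemma cring_poly_ring: "cring (poly_ring N :: ('k::field zpoly, 'k zpoly) module)"
proof (rule cringI)
  show "abelian_group (poly_ring N :: ('k zpoly, 'k zpoly) module)"
    by (rule abelian_groupI) (auto simp: polys_add add_ac intro!: bexI[of _ "- x" for x])
  show "Group.comm_monoid (poly_ring N :: ('k zpoly, 'k zpoly) module)"
    by (rule comm_monoidI) (auto simp: polys_mult mult_ac)
qed (simp add: distrib_right)

lemma ring_poly_ring: "ring (poly_ring N :: ('k::field zpoly, 'k zpoly) module)"
  using cring_poly_ring cring.axioms(1) by blast

text \<open>Terms of a sum come from the summands, and terms of a product are multiples of terms of
  each factor, so the right-hand side is an ideal. Membership in a monomial ideal becomes
  divisibility of each single term by a generator.\<close>

lemma Idl_mon: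
  assumes M: "\<And>u. u \<in> M \<Longrightarrow> keys u \<subseteq> {1..N}"
  shows "Idl\<^bsub>poly_ring N\<^esub> (mon ` M) =
    ({p \<in> polys N. \<forall>w\<in>keys p. \<exists>u\<in>M. \<exists>y. w = u + y} :: 'k::field zpoly set)" (is "_ = ?J")
proof
  interpret R: ring "poly_ring N :: ('k zpoly, 'k zpoly) module" by (rule ring_poly_ring)
  have sub: "mon ` M \<subseteq> carrier (poly_ring N :: ('k zpoly, 'k zpoly) module)" using M by auto
  have mult: "p * q \<in> ?J" if "p \<in> ?J" "q \<in> polys N" for p q
  proof -
    have "\<exists>u\<in>M. \<exists>y. w = u + y" if w: "w \<in> keys (p * q)" for w
    proof -
      obtain a b where "w = a + b" "a \<in> keys p" using keys_mult[of p q] w by auto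
      moreover obtain u y where "u \<in> M" "a = u + y" using calculation \<open>p \<in> ?J\<close> by auto
      ultimately show ?thesis by (intro bexI[of _ u] exI[of _ "y + b"]) (auto simp: add_ac)
    qed
    thus ?thesis using that by (auto intro: polys_mult)
  qed
  have "ideal ?J (poly_ring N)"
  proof (rule idealI)
    show "subgroup ?J (add_monoid (poly_ring N))"
    proof (rule group.subgroupI)
      show "Group.group (add_monoid (poly_ring N :: ('k zpoly, 'k zpoly) module))" using R.a_group .
      show "?J \<noteq> {}" by (auto intro!: exI[of _ 0])
      fix p q assume p: "p \<in> ?J" and q: "q \<in> ?J"
      have "inv\<^bsub>add_monoid (poly_ring N)\<^esub> p = - p"
        using p R.minus_equality[of "- p" p] by (auto simp: a_inv_def)
      moreover have "- p \<in> ?J" using p by (auto simp: in_keys_iff)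
      ultimately show "inv\<^bsub>add_monoid (poly_ring N)\<^esub> p \<in> ?J" by simp
      show "p \<otimes>\<^bsub>add_monoid (poly_ring N)\<^esub> q \<in> ?J"
        using p q Poly_Mapping.keys_add[of p q] by (auto intro: polys_add)
    qed auto
  qed (use mult in \<open>auto simp: mult.commute ring_poly_ring\<close>)
  moreover have "mon ` M \<subseteq> ?J"
  proof
    fix p :: "'k zpoly" assume "p \<in> mon ` M"
    then obtain u where "u \<in> M" "p = mon u" by auto
    thus "p \<in> ?J" using M[of u] by (auto intro!: bexI[of _ u] exI[of _ 0])
  qed
  ultimately show "Idl\<^bsub>poly_ring N\<^esub> (mon ` M) \<subseteq> ?J"
    by (rule R.genideal_minimal)
  interpret I: ideal "Idl\<^bsub>poly_ring N\<^esub> (mon ` M :: 'k zpoly set)" "poly_ring N"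
    by (rule R.genideal_ideal[OF sub])
  show "?J \<subseteq> Idl\<^bsub>poly_ring N\<^esub> (mon ` M)"
  proof
    fix p assume p: "p \<in> ?J"
    have "(\<Sum>w\<in>W. single w (lookup p w)) \<in> Idl\<^bsub>poly_ring N\<^esub> (mon ` M)" if "W \<subseteq> keys p" for W
      using finite_subset[OF that finite_keys] that
    proof (induction W rule: finite_induct)
      case empty
      thus ?case using I.zero_closed by simp
    next
      case (insert w W)
      then obtain u y where u: "u \<in> M" "w = u + y" using p by auto
      have "keys w \<subseteq> {1..N}" using insert.prems p by (auto simp: polys_def)
      hence "single y (lookup p w) \<in> polys N" using u by (intro polys_single) (auto simp: keys_add_monom)
      moreover have "single w (lookup p w) = single y (lookup p w) * mon u"
        by (simp add: u mon_def mult_single add.commute)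
      ultimately have "single w (lookup p w) \<in> Idl\<^bsub>poly_ring N\<^esub> (mon ` M)"
        using I.I_l_closed[of "mon u" "single y (lookup p w)"] R.genideal_self[OF sub] u by auto
      thus ?case using I.a_closed[of "single w (lookup p w)" "\<Sum>w\<in>W. single w (lookup p w)"] insert by simp
    qed
    from this[of "keys p"] show "p \<in> Idl\<^bsub>poly_ring N\<^esub> (mon ` M)"
      using poly_mapping_sum_single[of p] by simp
  qed
qed

section \<open>Stable ideals generated in one degree\<close>

text \<open>All that the resolution and the algebra structure need to know about J_t. In a single
  degree, stability can be stated for the generators alone. Positivity of \<open>t\<close> keeps the
  monomial 1, which has no last variable, out of \<open>G\<close>.\<close>

locale equigenerated_stable =
  fixes N t :: nat and G :: "monom set" and I :: "'k::field zpoly set"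
  assumes G_keys: "u \<in> G \<Longrightarrow> keys u \<subseteq> {1..N}"
    and G_deg: "u \<in> G \<Longrightarrow> mdeg u = t"
    and t_pos: "1 \<le> t"
    and G_exchange: "u \<in> G \<Longrightarrow> 1 \<le> i \<Longrightarrow> i < mmax u \<Longrightarrow> zexp i + u - zexp (mmax u) \<in> G"
    and I_eq: "I = Idl\<^bsub>poly_ring N\<^esub> (mon ` G)"
begin

lemma I_iff: "p \<in> I \<longleftrightarrow> p \<in> polys N \<and> (\<forall>w\<in>keys p. \<exists>u\<in>G. \<exists>y. w = u + y)"
  unfolding I_eq by (subst Idl_mon) (use G_keys in auto)

lemma mon_in_I_iff: "mon w \<in> I \<longleftrightarrow> keys w \<subseteq> {1..N} \<and> (\<exists>u\<in>G. \<exists>y. w = u + y)"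
  by (simp add: I_iff)

lemma G_nonzero: "u \<in> G \<Longrightarrow> u \<noteq> 0"
  using G_deg[of u] t_pos by auto

lemma G_mmax: "u \<in> G \<Longrightarrow> mmax u \<in> keys u" "u \<in> G \<Longrightarrow> mmax u \<in> {1..N}"
  using mmax_in_keys[OF G_nonzero] G_keys by blast+

text \<open>A proper divisor has smaller degree, so no member of \<open>G\<close> divides
  another.\<close>

lemma min_gens_I: "min_gens I = G"
proof (intro equalityI subsetI)
  fix u assume u: "u \<in> min_gens I"
  then obtain v y where v: "v \<in> G" "u = v + y" by (auto simp: min_gens_def mon_in_I_iff)
  hence "mon v \<in> I" using G_keys by (auto simp: mon_in_I_iff intro!: bexI[of _ v] exI[of _ 0])
  hence "v = u" using u v by (auto simp: min_gens_def)
  thus "u \<in> G" using v by simp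
next
  fix u assume u: "u \<in> G"
  have "v = u" if "mon v \<in> I" "u = v + y" for v y
  proof -
    obtain g z where g: "g \<in> G" "v = g + z" using \<open>mon v \<in> I\<close> by (auto simp: mon_in_I_iff)
    have "mdeg u = mdeg g + (mdeg z + mdeg y)" using that g by (simp add: mdeg_add)
    hence "y = 0" using G_deg[OF u] G_deg[OF g(1)] by simp
    thus ?thesis using that by simp
  qed
  moreover have "mon u \<in> I" using u G_keys by (auto simp: mon_in_I_iff intro!: bexI[of _ u] exI[of _ 0])
  ultimately show "u \<in> min_gens I" by (auto simp: min_gens_def)
qed

lemma stable: "stable_monomial_ideal N I"
  unfolding stable_monomial_ideal_def
proof (intro conjI allI impI)
  have "mon ` G \<subseteq> carrier (poly_ring N :: ('k zpoly, 'k zpoly) module)" using G_keys by auto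
  thus "monomial_ideal N I" unfolding monomial_ideal_def using I_eq by blast
next
  fix w i
  assume w: "mon w \<in> I" "w \<noteq> 0" and i: "1 \<le> i" "i < mmax w"
  then obtain u y where u: "u \<in> G" "w = u + y" and kw: "keys w \<subseteq> {1..N}"
    by (auto simp: mon_in_I_iff)
  let ?m = "mmax w"
  have m: "?m \<in> keys w" using w by (intro mmax_in_keys)
  have k: "keys (zexp i + w - zexp ?m) \<subseteq> {1..N}"
  proof -
    have "?m \<in> {1..N}" using m kw by blast
    hence "insert i (keys w) \<subseteq> {1..N}" using i kw by auto
    thus ?thesis using keys_diff_monom[of "zexp i + w" "zexp ?m"] by (auto simp: keys_add_monom)
  qed
  \<comment> \<open>If the last variable of \<open>w\<close> divides the cofactor \<open>y\<close>,
    the exchange takes place in \<open>y\<close> and the generator is left alone; otherwise it is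
    also the last variable of \<open>u\<close>, and \<open>G_exchange\<close> applies.\<close>
  show "mon (zexp i + w - zexp ?m) \<in> I"
  proof (cases "?m \<in> keys y")
    case True
    have "zexp i + w - zexp ?m = u + (zexp i + y - zexp ?m)"
      using True u by (intro poly_mapping_eqI) (auto simp: lookup_add lookup_minus lookup_zexp in_keys_iff)
    thus ?thesis using k u mon_in_I_iff by blast
  next
    case False
    hence m': "?m \<in> keys u" using m u by (simp add: keys_add_monom)
    moreover have "mmax u = ?m" using m' u by (intro mmax_eqI) (auto intro: mmax_ge simp: keys_add_monom)
    ultimately have "zexp i + u - zexp ?m \<in> G" using G_exchange[of u i] u i by simp
    moreover have "zexp i + w - zexp ?m = (zexp i + u - zexp ?m) + y"
      using m' u by (intro poly_mapping_eqI) (auto simp: lookup_add lookup_minus lookup_zexp in_keys_iff)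
    ultimately show ?thesis using k mon_in_I_iff by blast
  qed
qed

text \<open>Distinct generators of the same degree each exceed the other in some exponent: v at i,
  and u at j. Then z_i divides \<open>y\<close> and z_j divides \<open>z\<close>, so max(u) \<le> i
  \<le> max(v) \<le> j \<le> max(u), which forces i = j.\<close>

lemma decomposition_unique:
  assumes u: "u \<in> G" "y = 0 \<or> mmax u \<le> mmin y" and v: "v \<in> G" "z = 0 \<or> mmax v \<le> mmin z"
    and eq: "u + y = v + z"
  shows "u = v"
proof (rule ccontr)
  assume ne: "u \<noteq> v"
  have lk: "lookup u i + lookup y i = lookup v i + lookup z i" for i
    using arg_cong[OF eq, of "\<lambda>w. lookup w i"] by (simp add: lookup_add)
  have *: "\<exists>i. lookup a i < lookup b i" if "a \<in> G" "b \<in> G" "a \<noteq> b" for a b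
  proof (rule ccontr)
    assume "\<not> (\<exists>i. lookup a i < lookup b i)"
    hence "a = b + (a - b)" by (intro poly_mapping_eqI) (simp add: lookup_add lookup_minus not_less)
    moreover from this have "mdeg a = mdeg b + mdeg (a - b)" by (metis mdeg_add)
    ultimately show False using that G_deg[of a] G_deg[of b] by simp
  qed
  obtain i where i: "lookup u i < lookup v i" using * u v ne by blast
  obtain j where j: "lookup v j < lookup u j" using *[of v u] u v ne by auto
  have "i \<in> keys y" "j \<in> keys z" "i \<in> keys v" "j \<in> keys u"
    using i j lk[of i] lk[of j] by (auto simp: in_keys_iff)
  moreover from this have "mmax u \<le> i" "mmax v \<le> j"
    using u v mmin_le[of i y] mmin_le[of j z] by auto
  moreover have "i \<le> mmax v" "j \<le> mmax u" using calculation by (auto intro: mmax_ge)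
  ultimately have "i = j" by simp
  thus False using i j by simp
qed

text \<open>The factorization is z_i u = (z_i u / z_m) z_m with m = max(u): the first factor lies in
  \<open>G\<close> by exchange, and its largest index does not exceed m.\<close>

lemma ek_g_eq:
  assumes "u \<in> G" "1 \<le> i" "i < mmax u"
  shows "ek_g I (zexp i + u) = zexp i + u - zexp (mmax u)"
proof -
  let ?v = "zexp i + u - zexp (mmax u)"
  have v: "?v \<in> G" using G_exchange assms by blast
  have eq: "zexp i + u = ?v + zexp (mmax u)" using exchange_add[OF G_mmax(1)[OF assms(1)], of i] by simp
  have "keys ?v \<subseteq> insert i (keys u)"
    using keys_diff_monom[of "zexp i + u" "zexp (mmax u)"] by (auto simp: keys_add_monom)
  hence le: "mmax ?v \<le> mmax u" using mmax_in_keys[OF G_nonzero[OF v]] assms mmax_ge[of "mmax ?v" u] by auto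
  show ?thesis unfolding ek_g_def min_gens_I
  proof (rule the_equality)
    show "?v \<in> G \<and> (\<exists>y. zexp i + u = ?v + y \<and> (y = 0 \<or> mmax ?v \<le> mmin y))"
      using v eq le by (metis mmin_zexp)
  next
    fix w assume "w \<in> G \<and> (\<exists>y. zexp i + u = w + y \<and> (y = 0 \<or> mmax w \<le> mmin y))"
    then obtain y where "w \<in> G" "?v + zexp (mmax u) = w + y" "y = 0 \<or> mmax w \<le> mmin y"
      using eq by auto
    thus "w = ?v" using decomposition_unique[OF v, of "zexp (mmax u)" w y] le by simp
  qed
qed

end

section \<open>The exterior algebra\<close>

text \<open>An element is given by its coefficients at the basis vectors \<open>e\<^sub>S\<close>, where \<open>S\<close> runs through the
  finite sets of natural numbers.\<close>

typedef (overloaded) 'a ext = "{f :: nat set \<Rightarrow> 'a::comm_ring_1. \<forall>S. infinite S \<longrightarrow> f S = 0}"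
  morphisms ecoeff Abs_ext
  by (rule exI[of _ "\<lambda>_. 0"]) simp

setup_lifting type_definition_ext

lemma ext_eqI: "(\<And>S. finite S \<Longrightarrow> ecoeff f S = ecoeff g S) \<Longrightarrow> f = g"
  by transfer (metis ext)

text \<open>The number of transpositions that sort the concatenation e_S e_T; for disjoint
  \<open>S\<close> and \<open>T\<close> the product is \<open>esign S T\<close> times the basis
  vector of the union.\<close>

definition inv_count :: "nat set \<Rightarrow> nat set \<Rightarrow> nat" where
  "inv_count S T = card {(i, j). i \<in> S \<and> j \<in> T \<and> j < i}"

definition esign :: "nat set \<Rightarrow> nat set \<Rightarrow> 'a::comm_ring_1" where
  "esign S T = (- 1) ^ inv_count S T"

lemma finite_inv_count: "finite S \<Longrightarrow> finite T \<Longrightarrow> finite {(i, j). i \<in> S \<and> j \<in> T \<and> (j::nat) < i}"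
  by (rule finite_subset[of _ "S \<times> T"]) auto

lemma inv_count_Un_left:
  assumes "finite S" "finite S'" "finite T" "S \<inter> S' = {}"
  shows "inv_count (S \<union> S') T = inv_count S T + inv_count S' T"
proof -
  have "{(i, j). i \<in> S \<union> S' \<and> j \<in> T \<and> j < i} =
      {(i, j). i \<in> S \<and> j \<in> T \<and> j < i} \<union> {(i, j). i \<in> S' \<and> j \<in> T \<and> j < i}" by auto
  moreover have "card \<dots> = inv_count S T + inv_count S' T"
    unfolding inv_count_def using assms
    by (intro card_Un_disjoint finite_inv_count) auto
  ultimately show ?thesis by (simp add: inv_count_def)
qed

lemma inv_count_Un_right:
  assumes "finite S" "finite T" "finite T'" "T \<inter> T' = {}"
  shows "inv_count S (T \<union> T') = inv_count S T + inv_count S T'"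
proof -
  have "{(i, j). i \<in> S \<and> j \<in> T \<union> T' \<and> j < i} =
      {(i, j). i \<in> S \<and> j \<in> T \<and> j < i} \<union> {(i, j). i \<in> S \<and> j \<in> T' \<and> j < i}" by auto
  moreover have "card \<dots> = inv_count S T + inv_count S T'"
    unfolding inv_count_def using assms
    by (intro card_Un_disjoint finite_inv_count) auto
  ultimately show ?thesis by (simp add: inv_count_def)
qed

lemma inv_count_empty [simp]: "inv_count {} T = 0" "inv_count S {} = 0"
  by (simp_all add: inv_count_def)

lemma inv_count_singleton_left: "inv_count {i} T = card {j \<in> T. j < i}"
proof -
  have "{(a, j). a \<in> {i} \<and> j \<in> T \<and> j < a} = Pair i ` {j \<in> T. j < i}" by auto
  thus ?thesis by (simp add: inv_count_def card_image inj_on_def)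
qed

lemma inv_count_singleton_right: "inv_count S {i} = card {j \<in> S. i < j}"
proof -
  have "{(a, j). a \<in> S \<and> j \<in> {i} \<and> j < a} = (\<lambda>a. (a, i)) ` {j \<in> S. i < j}" by auto
  thus ?thesis by (simp add: inv_count_def card_image inj_on_def)
qed

instantiation ext :: (comm_ring_1) ring_1
begin

lift_definition zero_ext :: "'a ext" is "\<lambda>_. 0" by simp

lift_definition one_ext :: "'a ext" is "\<lambda>S. if S = {} then 1 else 0" by auto

lift_definition plus_ext :: "'a ext \<Rightarrow> 'a ext \<Rightarrow> 'a ext" is "\<lambda>f g S. f S + g S" by simp

lift_definition uminus_ext :: "'a ext \<Rightarrow> 'a ext" is "\<lambda>f S. - f S" by simp

lift_definition minus_ext :: "'a ext \<Rightarrow> 'a ext \<Rightarrow> 'a ext" is "\<lambda>f g S. f S - g S" by simp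

lift_definition times_ext :: "'a ext \<Rightarrow> 'a ext \<Rightarrow> 'a ext" is
  "\<lambda>f g U. if finite U then \<Sum>S\<in>Pow U. esign S (U - S) * f S * g (U - S) else 0" by simp

instance
proof
  fix a b c :: "'a ext"
  show "a + b + c = a + (b + c)" by transfer (simp add: add.assoc)
  show "a + b = b + a" by transfer (simp add: add.commute)
  show "0 + a = a" by transfer simp
  show "- a + a = 0" by transfer simp
  show "a - b = a + - b" by transfer simp
  show "(0::'a ext) \<noteq> 1" by transfer (metis zero_neq_one)
  show "(a + b) * c = a * c + b * c"
    by transfer (auto simp: fun_eq_iff algebra_simps sum.distrib)
  show "a * (b + c) = a * b + a * c"
    by transfer (auto simp: fun_eq_iff algebra_simps sum.distrib)
  show "1 * a = a"
  proof transfer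
    fix f :: "nat set \<Rightarrow> 'a"
    assume f: "\<forall>S. infinite S \<longrightarrow> f S = 0"
    have "(\<Sum>S\<in>Pow U. esign S (U - S) * (if S = {} then 1 else 0) * f (U - S)) = f U"
      if "finite U" for U
    proof -
      have "(\<Sum>S\<in>Pow U. esign S (U - S) * (if S = {} then 1 else 0) * f (U - S)) =
          (\<Sum>S\<in>{{}}. esign S (U - S) * (if S = {} then 1 else 0) * f (U - S))"
        using that by (intro sum.mono_neutral_right) auto
      thus ?thesis by (simp add: esign_def)
    qed
    with f show "(\<lambda>U. if finite U then \<Sum>S\<in>Pow U. esign S (U - S) * (if S = {} then 1 else 0) * f (U - S) else 0) = f"
      by auto
  qed
  show "a * 1 = a"
  proof transfer
    fix f :: "nat set \<Rightarrow> 'a"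
    assume f: "\<forall>S. infinite S \<longrightarrow> f S = 0"
    have "(\<Sum>S\<in>Pow U. esign S (U - S) * f S * (if U - S = {} then 1 else 0)) = f U"
      if "finite U" for U
    proof -
      have "(\<Sum>S\<in>Pow U. esign S (U - S) * f S * (if U - S = {} then 1 else 0)) =
          (\<Sum>S\<in>{U}. esign S (U - S) * f S * (if U - S = {} then 1 else 0))"
        using that by (intro sum.mono_neutral_right) auto
      thus ?thesis by (simp add: esign_def)
    qed
    with f show "(\<lambda>U. if finite U then \<Sum>S\<in>Pow U. esign S (U - S) * f S * (if U - S = {} then 1 else 0) else 0) = f"
      by auto
  qed
  show "a * b * c = a * (b * c)"
  proof transfer
    fix f g h :: "nat set \<Rightarrow> 'a"
    have "(\<Sum>V\<in>Pow U. esign V (U - V) *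
          (if finite V then \<Sum>S\<in>Pow V. esign S (V - S) * f S * g (V - S) else 0) * h (U - V)) =
        (\<Sum>S\<in>Pow U. esign S (U - S) * f S *
          (if finite (U - S) then \<Sum>T\<in>Pow (U - S). esign T (U - S - T) * g T * h (U - S - T) else 0))"
      (is "?L = ?R") if U: "finite U" for U
    proof -
      have "?L = (\<Sum>V\<in>Pow U. \<Sum>S\<in>Pow V. esign V (U - V) * esign S (V - S) * f S * g (V - S) * h (U - V))"
        using U by (intro sum.cong)
          (auto simp: sum_distrib_left sum_distrib_right mult.assoc rev_finite_subset intro!: sum.cong)
      also have "\<dots> = (\<Sum>(V, S)\<in>Sigma (Pow U) Pow.
          esign V (U - V) * esign S (V - S) * f S * g (V - S) * h (U - V))"
        using U by (intro sum.Sigma) (auto simp: rev_finite_subset)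
      \<comment> \<open>Both sides run over the ordered partitions of \<open>U\<close> into three
        parts S, V - S, U - V; the signs agree because inversions are additive over disjoint
        unions.\<close>
      also have "\<dots> = (\<Sum>(S, T)\<in>Sigma (Pow U) (\<lambda>S. Pow (U - S)).
          esign S (U - S) * f S * (esign T (U - S - T) * g T * h (U - S - T)))"
      proof (rule sum.reindex_bij_witness[of _ "\<lambda>(S, T). (S \<union> T, S)" "\<lambda>(V, S). (S, V - S)"])
        fix p assume "p \<in> Sigma (Pow U) Pow"
        then obtain V S where p: "p = (V, S)" "V \<subseteq> U" "S \<subseteq> V" by auto
        have fin: "finite S" "finite V" "finite (V - S)" "finite (U - V)"
          using p U by (auto intro: rev_finite_subset)
        have 1: "S \<union> (V - S) = V" "V - S \<union> (U - V) = U - S" using p by auto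
        have "inv_count V (U - V) = inv_count S (U - V) + inv_count (V - S) (U - V)"
          using inv_count_Un_left[of S "V - S" "U - V"] fin unfolding 1 by auto
        moreover have "inv_count S (U - S) = inv_count S (V - S) + inv_count S (U - V)"
          using inv_count_Un_right[of S "V - S" "U - V"] fin p unfolding 1 by auto
        ultimately have *: "esign V (U - V) * esign S (V - S) = (esign S (U - S) * esign (V - S) (U - V) :: 'a)"
          by (simp add: esign_def power_add)
        have 2: "U - S - (V - S) = U - V" using p by auto
        show "(case case p of (V, S) \<Rightarrow> (S, V - S) of (S, T) \<Rightarrow>
            esign S (U - S) * f S * (esign T (U - S - T) * g T * h (U - S - T))) =
          (case p of (V, S) \<Rightarrow> esign V (U - V) * esign S (V - S) * f S * g (V - S) * h (U - V))"
          unfolding p prod.case 2 * by (simp add: algebra_simps)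
      qed auto
      also have "\<dots> = (\<Sum>S\<in>Pow U. \<Sum>T\<in>Pow (U - S).
          esign S (U - S) * f S * (esign T (U - S - T) * g T * h (U - S - T)))"
        using U by (intro sum.Sigma[symmetric]) auto
      also have "\<dots> = ?R" using U by (intro sum.cong) (auto simp: sum_distrib_left)
      finally show ?thesis .
    qed
    thus "(\<lambda>U. if finite U then \<Sum>V\<in>Pow U. esign V (U - V) *
          (if finite V then \<Sum>S\<in>Pow V. esign S (V - S) * f S * g (V - S) else 0) * h (U - V) else 0) =
        (\<lambda>U. if finite U then \<Sum>S\<in>Pow U. esign S (U - S) * f S *
          (if finite (U - S) then \<Sum>T\<in>Pow (U - S). esign T (U - S - T) * g T * h (U - S - T) else 0) else 0)"
      by (simp only: fun_eq_iff) simp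
  qed
qed

end

lemmas ecoeff_simps [simp] = zero_ext.rep_eq plus_ext.rep_eq uminus_ext.rep_eq minus_ext.rep_eq

lemma ecoeff_one: "ecoeff 1 S = (if S = {} then 1 else 0)"
  by (rule one_ext.rep_eq[THEN fun_cong])

lemma ecoeff_mult: "finite U \<Longrightarrow> ecoeff (f * g) U = (\<Sum>S\<in>Pow U. esign S (U - S) * ecoeff f S * ecoeff g (U - S))"
  by (simp add: times_ext.rep_eq)

lemma ecoeff_infinite: "infinite S \<Longrightarrow> ecoeff f S = 0"
  by transfer simp

lemma ecoeff_sum: "ecoeff (sum f A) S = (\<Sum>x\<in>A. ecoeff (f x) S)"
  by (induction A rule: infinite_finite_induct) auto

section \<open>Scalars and the Koszul differential of the exterior algebra\<close>

lift_definition esc :: "'a::comm_ring_1 \<Rightarrow> 'a ext" is "\<lambda>p S. if S = {} then p else 0" by auto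

lemma ecoeff_esc_mult [simp]: "ecoeff (esc p * f) U = p * ecoeff f U"
proof (cases "finite U")
  case True
  have "ecoeff (esc p * f) U = (\<Sum>S\<in>{{}}. esign S (U - S) * ecoeff (esc p) S * ecoeff f (U - S))"
    unfolding ecoeff_mult[OF True] using True by (intro sum.mono_neutral_right) (auto simp: esc.rep_eq)
  thus ?thesis by (simp add: esc.rep_eq esign_def)
qed (simp add: ecoeff_infinite)

lemma esc_commute: "f * esc p = esc p * f"
proof (rule ext_eqI)
  fix U :: "nat set" assume U: "finite U"
  have "ecoeff (f * esc p) U = (\<Sum>S\<in>{U}. esign S (U - S) * ecoeff f S * ecoeff (esc p) (U - S))"
    unfolding ecoeff_mult[OF U] using U by (intro sum.mono_neutral_right) (auto simp: esc.rep_eq)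
  thus "ecoeff (f * esc p) U = ecoeff (esc p * f) U" by (simp add: esc.rep_eq esign_def mult.commute)
qed

lemma esc_add: "esc (p + q) = esc p + esc q" by transfer auto
lemma esc_diff: "esc (p - q) = esc p - esc q" by transfer auto
lemma esc_uminus: "esc (- p) = - esc p" by transfer auto
lemma esc_0 [simp]: "esc 0 = 0" by transfer auto
lemma esc_1 [simp]: "esc 1 = 1" by transfer auto
lemma esc_mult: "esc (p * q) = esc p * esc q"
  by (rule ext_eqI) (simp add: esc.rep_eq)
lemma esc_sum: "esc (sum f A) = (\<Sum>x\<in>A. esc (f x))"
  by (induction A rule: infinite_finite_induct) (auto simp: esc_add)

lift_definition ebasis :: "nat set \<Rightarrow> 'a::comm_ring_1 ext" is
  "\<lambda>S T. if T = S \<and> finite S then 1 else 0" by auto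

lemma ecoeff_ebasis: "ecoeff (ebasis S) T = (if T = S \<and> finite S then 1 else 0)"
  by (simp add: ebasis.rep_eq)

definition pos_sign :: "nat set \<Rightarrow> nat \<Rightarrow> 'a::comm_ring_1" where
  "pos_sign S i = (- 1) ^ card {j \<in> S. j < i}"

text \<open>The Koszul differential with d e_i = c_i for i in \<open>X\<close>, read off
  coefficientwise: e_U is reached only from basis vectors with one additional factor e_i, and
  \<open>pos_sign\<close> counts the factors standing before that e_i.\<close>

lift_definition eder :: "nat set \<Rightarrow> (nat \<Rightarrow> 'a) \<Rightarrow> 'a::comm_ring_1 ext \<Rightarrow> 'a ext" is
  "\<lambda>X c f U. if finite U then \<Sum>i\<in>X - U. pos_sign U i * c i * f (insert i U) else 0" by simp

text \<open>The grading involution; it carries the sign of the Leibniz rule for elements that need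
  not be homogeneous.\<close>

lift_definition ealt :: "'a::comm_ring_1 ext \<Rightarrow> 'a ext" is "\<lambda>f U. (- 1) ^ card U * f U" by simp

lemma ecoeff_eder: "finite U \<Longrightarrow> ecoeff (eder X c f) U = (\<Sum>i\<in>X - U. pos_sign U i * c i * ecoeff f (insert i U))"
  by (simp add: eder.rep_eq)

lemma ecoeff_ealt [simp]: "ecoeff (ealt f) U = (- 1) ^ card U * ecoeff f U"
  by (simp add: ealt.rep_eq)

lemma eder_add: "eder X c (f + g) = eder X c f + eder X c g"
  by (rule ext_eqI) (simp add: ecoeff_eder distrib_left sum.distrib)

lemma eder_0 [simp]: "eder X c 0 = 0"
  by (rule ext_eqI) (simp add: ecoeff_eder)

lemma eder_diff: "eder X c (f - g) = eder X c f - eder X c g"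
  by (rule ext_eqI) (simp add: ecoeff_eder right_diff_distrib sum_subtractf)

lemma eder_sum: "eder X c (sum f A) = (\<Sum>x\<in>A. eder X c (f x))"
  by (induction A rule: infinite_finite_induct) (auto simp: eder_add)

lemma eder_esc_mult: "eder X c (esc p * f) = esc p * eder X c f"
  by (rule ext_eqI) (simp add: ecoeff_eder sum_distrib_left mult_ac)

lemma eder_1 [simp]: "eder X c 1 = 0"
  by (rule ext_eqI) (simp add: ecoeff_eder ecoeff_one)

lemma card_less_greater:
  assumes "finite S" "i \<notin> S"
  shows "card {j \<in> S. j < i} + card {j \<in> S. i < j} = card (S :: nat set)"
proof -
  have "S = {j \<in> S. j < i} \<union> {j \<in> S. i < j}" using assms(2) by (auto simp: not_less) (metis le_neq_implies_less)
  moreover have "card \<dots> = card {j \<in> S. j < i} + card {j \<in> S. i < j}"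
    using assms(1) by (intro card_Un_disjoint) auto
  ultimately show ?thesis by simp
qed

lemma esign_insert_right:
  assumes "finite S" "finite T" "i \<notin> T"
  shows "esign S (insert i T) = esign S T * (- 1) ^ card {j \<in> S. i < j}"
  using inv_count_Un_right[of S "{i}" T] assms
  by (simp add: esign_def power_add inv_count_singleton_right mult.commute)

lemma esign_insert_left:
  assumes "finite S" "finite T" "i \<notin> S"
  shows "esign (insert i S) T = esign S T * pos_sign T i"
  using inv_count_Un_left[of "{i}" S T] assms
  by (simp add: esign_def pos_sign_def power_add inv_count_singleton_left mult.commute)

lemma pos_sign_Un:
  assumes "finite S" "finite T" "S \<inter> T = {}"
  shows "pos_sign (S \<union> T) i = pos_sign S i * pos_sign T i"
proof -
  have "{j \<in> S \<union> T. j < i} = {j \<in> S. j < i} \<union> {j \<in> T. j < i}" by auto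
  moreover have "card \<dots> = card {j \<in> S. j < i} + card {j \<in> T. j < i}"
    using assms by (intro card_Un_disjoint) auto
  ultimately show ?thesis by (simp add: pos_sign_def power_add)
qed

lemma pos_sign_square [simp]: "pos_sign S i * pos_sign S i = 1" "pos_sign S i * (pos_sign S i * x) = x"
  by (simp_all add: pos_sign_def flip: mult.assoc power_mult_distrib)

lemma pos_sign_greater:
  assumes "finite S" "i \<notin> S"
  shows "(- 1) ^ card {j \<in> S. i < j} = (- 1) ^ card S * (pos_sign S i :: 'a::comm_ring_1)"
  by (simp add: card_less_greater[OF assms, symmetric] pos_sign_def minus_one_power_iff)

text \<open>The first two identities are the signs when e_i is removed from the second and from the
  first factor. The third compares the two terms in which e_i occurs in both factors; its minus sign
  makes them cancel.\<close>

lemma Leibniz_signs: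
  assumes U: "finite U" and S: "S \<subseteq> U"
  shows "i \<notin> U \<Longrightarrow> pos_sign U i * esign S (insert i (U - S)) =
      esign S (U - S) * (- 1) ^ card S * (pos_sign (U - S) i :: 'a::comm_ring_1)"
    and "i \<notin> U \<Longrightarrow> pos_sign U i * esign (insert i S) (U - S) = esign S (U - S) * (pos_sign S i :: 'a)"
    and "i \<in> U - S \<Longrightarrow> esign (insert i S) (U - insert i S) * (- 1) ^ card (insert i S) *
      pos_sign (U - insert i S) i = - (esign S (U - S) * (pos_sign S i :: 'a))"
proof -
  have fin: "finite S" "finite (U - S)" using assms by (auto intro: rev_finite_subset)
  have *: "pos_sign U i = pos_sign S i * (pos_sign (U - S) i :: 'a)" for i
    using pos_sign_Un[of S "U - S" i] fin S by (simp add: Un_absorb1)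
  show "pos_sign U i * esign S (insert i (U - S)) =
      esign S (U - S) * (- 1) ^ card S * (pos_sign (U - S) i :: 'a)" if "i \<notin> U"
  proof -
    have i: "i \<notin> S" "i \<notin> U - S" using that S by auto
    show ?thesis
      unfolding * esign_insert_right[OF fin i(2)] pos_sign_greater[OF fin(1) i(1)] by (simp add: mult_ac)
  qed
  show "pos_sign U i * esign (insert i S) (U - S) = esign S (U - S) * (pos_sign S i :: 'a)" if "i \<notin> U"
  proof -
    have i: "i \<notin> S" using that S by auto
    show ?thesis unfolding * esign_insert_left[OF fin i] by (simp add: mult_ac)
  qed
  assume i: "i \<in> U - S"
  define V where "V = U - insert i S"
  have V: "U - S = insert i V" "i \<notin> V" "finite V" "i \<notin> S" using i fin by (auto simp: V_def)
  show "esign (insert i S) (U - insert i S) * (- 1) ^ card (insert i S) *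
      pos_sign (U - insert i S) i = - (esign S (U - S) * (pos_sign S i :: 'a))"
    using fin V(2-4) unfolding V(1) V_def[symmetric]
    by (simp add: esign_insert_left esign_insert_right pos_sign_greater mult_ac)
qed

theorem eder_mult:
  assumes X: "finite X"
  shows "eder X c (f * g) = eder X c f * g + ealt f * eder X c g"
proof (rule ext_eqI)
  fix U :: "nat set" assume U: "finite U"
  let ?f = "ecoeff f" and ?g = "ecoeff g"
  have fin: "finite (U - S)" "finite S" "finite (insert i U)" if "S \<in> Pow U" for S i
    using that U by (auto intro: rev_finite_subset)
  \<comment> \<open>\<open>t1\<close> describes the terms in which e_i is removed from the second
    factor, \<open>t2\<close> those in which it is removed from the first.\<close>
  define t1 where "t1 S i = esign S (U - S) * (- 1) ^ card S * pos_sign (U - S) i * c i * ?f S * ?g (insert i (U - S))" for S i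
  define t2 where "t2 S i = esign S (U - S) * pos_sign S i * c i * ?f (insert i S) * ?g (U - S)" for S i
  have "ecoeff (eder X c (f * g)) U = (\<Sum>i\<in>X - U. pos_sign U i * c i *
      (\<Sum>S\<in>Pow (insert i U). esign S (insert i U - S) * ?f S * ?g (insert i U - S)))"
    using U by (simp add: ecoeff_eder ecoeff_mult)
  also have "\<dots> = (\<Sum>i\<in>X - U. \<Sum>S\<in>Pow U. t1 S i + t2 S i)"
  proof (rule sum.cong[OF refl])
    fix i assume i: "i \<in> X - U"
    hence iU: "i \<notin> U" by simp
    have "(\<Sum>S\<in>Pow (insert i U). esign S (insert i U - S) * ?f S * ?g (insert i U - S)) =
        (\<Sum>S\<in>Pow U. esign S (insert i U - S) * ?f S * ?g (insert i U - S)) +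
        (\<Sum>S\<in>insert i ` Pow U. esign S (insert i U - S) * ?f S * ?g (insert i U - S))"
      unfolding Pow_insert using i U by (intro sum.union_disjoint) auto
    also have "(\<Sum>S\<in>insert i ` Pow U. esign S (insert i U - S) * ?f S * ?g (insert i U - S)) =
        (\<Sum>S\<in>Pow U. esign (insert i S) (U - S) * ?f (insert i S) * ?g (U - S))"
    proof (subst sum.reindex)
      show "inj_on (insert i) (Pow U)" using i by (auto simp: inj_on_def)
      have "insert i U - insert i S = U - S" if "S \<in> Pow U" for S using i that by auto
      thus "sum ((\<lambda>S. esign S (insert i U - S) * ?f S * ?g (insert i U - S)) \<circ> insert i) (Pow U) =
        (\<Sum>S\<in>Pow U. esign (insert i S) (U - S) * ?f (insert i S) * ?g (U - S))"
        by (intro sum.cong) simp_all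
    qed
    also have "(\<Sum>S\<in>Pow U. esign S (insert i U - S) * ?f S * ?g (insert i U - S)) =
        (\<Sum>S\<in>Pow U. esign S (insert i (U - S)) * ?f S * ?g (insert i (U - S)))"
    proof (rule sum.cong[OF refl])
      fix S assume "S \<in> Pow U"
      hence "insert i U - S = insert i (U - S)" using i by auto
      thus "esign S (insert i U - S) * ?f S * ?g (insert i U - S) =
        esign S (insert i (U - S)) * ?f S * ?g (insert i (U - S))" by simp
    qed
    finally show "pos_sign U i * c i *
        (\<Sum>S\<in>Pow (insert i U). esign S (insert i U - S) * ?f S * ?g (insert i U - S)) =
        (\<Sum>S\<in>Pow U. t1 S i + t2 S i)"
    proof (simp add: sum_distrib_left distrib_left sum.distrib[symmetric], intro sum.cong refl arg_cong2[where f = "(+)"])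
      fix S assume S: "S \<in> Pow U"
      show "pos_sign U i * c i * (esign S (insert i (U - S)) * ?f S * ?g (insert i (U - S))) = t1 S i"
        using arg_cong[OF Leibniz_signs(1)[OF U PowD[OF S] iU],
            of "\<lambda>x. x * (c i * ?f S * ?g (insert i (U - S)))"]
        by (simp add: t1_def mult_ac)
      show "pos_sign U i * c i * (esign (insert i S) (U - S) * ?f (insert i S) * ?g (U - S)) = t2 S i"
        using arg_cong[OF Leibniz_signs(2)[OF U PowD[OF S] iU],
            of "\<lambda>x. x * (c i * ?f (insert i S) * ?g (U - S))"]
        by (simp add: t2_def mult_ac)
    qed
  qed
  also have "\<dots> = (\<Sum>S\<in>Pow U. \<Sum>i\<in>X - U. t1 S i) + (\<Sum>S\<in>Pow U. \<Sum>i\<in>X - U. t2 S i)"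
    by (subst sum.swap) (simp add: sum.distrib)
  finally have L: "ecoeff (eder X c (f * g)) U = \<dots>" .
  have "ecoeff (eder X c f * g) U = (\<Sum>S\<in>Pow U. \<Sum>i\<in>X - S. t2 S i)"
    using U fin by (simp add: ecoeff_mult ecoeff_eder sum_distrib_left sum_distrib_right t2_def mult_ac)
  also have "\<dots> = (\<Sum>S\<in>Pow U. (\<Sum>i\<in>X - U. t2 S i) + (\<Sum>i\<in>X \<inter> (U - S). t2 S i))"
  proof (rule sum.cong[OF refl])
    fix S assume "S \<in> Pow U"
    hence "X - S = (X - U) \<union> (X \<inter> (U - S))" by auto
    thus "(\<Sum>i\<in>X - S. t2 S i) = (\<Sum>i\<in>X - U. t2 S i) + (\<Sum>i\<in>X \<inter> (U - S). t2 S i)"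
      using X by (simp only:) (rule sum.union_disjoint, auto)
  qed
  finally have R1: "ecoeff (eder X c f * g) U = \<dots>" .
  have "ecoeff (ealt f * eder X c g) U = (\<Sum>S\<in>Pow U. \<Sum>i\<in>X - (U - S). t1 S i)"
    using U fin by (simp add: ecoeff_mult ecoeff_eder sum_distrib_left sum_distrib_right t1_def mult_ac)
  also have "\<dots> = (\<Sum>S\<in>Pow U. (\<Sum>i\<in>X - U. t1 S i) + (\<Sum>i\<in>X \<inter> S. t1 S i))"
  proof (rule sum.cong[OF refl])
    fix S assume "S \<in> Pow U"
    hence "X - (U - S) = (X - U) \<union> (X \<inter> S)" by auto
    moreover have "(X - U) \<inter> (X \<inter> S) = {}" using \<open>S \<in> Pow U\<close> by auto
    ultimately show "(\<Sum>i\<in>X - (U - S). t1 S i) = (\<Sum>i\<in>X - U. t1 S i) + (\<Sum>i\<in>X \<inter> S. t1 S i)"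
      using X by (simp only:) (rule sum.union_disjoint, auto)
  qed
  finally have R2: "ecoeff (ealt f * eder X c g) U = \<dots>" .
  \<comment> \<open>The surplus terms of the right-hand side are those with i in \<open>U\<close>,
    where e_i occurs in both factors; shifting i from one part of \<open>U\<close> to the other
    pairs them with opposite signs.\<close>
  have "(\<Sum>S\<in>Pow U. \<Sum>i\<in>X \<inter> S. t1 S i) = (\<Sum>(S, i)\<in>Sigma (Pow U) (\<lambda>S. X \<inter> S). t1 S i)"
    using U X by (intro sum.Sigma) auto
  also have "\<dots> = (\<Sum>(S, i)\<in>Sigma (Pow U) (\<lambda>S. X \<inter> (U - S)). - t2 S i)"
  proof (rule sum.reindex_bij_witness[of _ "\<lambda>(S, i). (insert i S, i)" "\<lambda>(S, i). (S - {i}, i)"])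
    fix p assume "p \<in> Sigma (Pow U) (\<lambda>S. X \<inter> S)"
    then obtain T i where p: "p = (T, i)" "T \<subseteq> U" "i \<in> T" "i \<in> X" by auto
    define S where "S = T - {i}"
    have T: "T = insert i S" and S: "S \<subseteq> U" "i \<in> U - S" using p by (auto simp: S_def)
    have 1: "insert i (U - insert i S) = U - S" using S by auto
    have "- t2 S i = t1 T i"
      unfolding t1_def T Leibniz_signs(3)[OF U S, where 'a = 'a] t2_def 1 by simp
    thus "(case case p of (S, i) \<Rightarrow> (S - {i}, i) of (S, i) \<Rightarrow> - t2 S i) = (case p of (S, i) \<Rightarrow> t1 S i)"
      by (simp add: p S_def)
  qed auto
  also have "\<dots> = (\<Sum>S\<in>Pow U. \<Sum>i\<in>X \<inter> (U - S). - t2 S i)"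
    using U X by (intro sum.Sigma[symmetric]) auto
  finally have "(\<Sum>S\<in>Pow U. \<Sum>i\<in>X \<inter> S. t1 S i) = - (\<Sum>S\<in>Pow U. \<Sum>i\<in>X \<inter> (U - S). t2 S i)"
    by (simp add: sum_negf)
  thus "ecoeff (eder X c (f * g)) U = ecoeff (eder X c f * g + ealt f * eder X c g) U"
    by (simp add: L R1 R2 sum.distrib)
qed

lemma pos_sign_insert:
  assumes "i \<notin> S" "finite S"
  shows "pos_sign (insert i S) j = (if i < j then - pos_sign S j else pos_sign S j :: 'a::comm_ring_1)"
proof -
  have "pos_sign (insert i S) j = pos_sign {i} j * (pos_sign S j :: 'a)"
    using pos_sign_Un[of "{i}" S j, where 'a = 'a] assms by simp
  moreover have "pos_sign {i} j = (if i < j then - 1 else 1 :: 'a)"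
  proof -
    have "{k \<in> {i}. k < j} = (if i < j then {i} else {})" by auto
    thus ?thesis unfolding pos_sign_def by simp
  qed
  ultimately show ?thesis by simp
qed

text \<open>Removing e_i and e_j in the two possible orders gives opposite signs, so the pairs with
  i < j cancel those with j < i.\<close>

lemma eder_eder:
  assumes X: "finite X"
  shows "eder X c (eder X c f) = 0"
proof (rule ext_eqI)
  fix U :: "nat set" assume U: "finite U"
  define h where "h i j = pos_sign U i * c i * (pos_sign (insert i U) j * c j * ecoeff f (insert j (insert i U)))" for i j
  have h: "h i j = - h j i" if "i \<in> X - U" "j \<in> X - U" "i < j" for i j
  proof -
    have "pos_sign (insert i U) j = - (pos_sign U j :: 'a)" "pos_sign (insert j U) i = (pos_sign U i :: 'a)"
      using that U by (simp_all add: pos_sign_insert)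
    thus ?thesis unfolding h_def insert_commute[of j i] by (simp add: mult_ac)
  qed
  let ?P = "{(i, j). i \<in> X - U \<and> j \<in> X - U \<and> i < j}" and ?Q = "{(i, j). i \<in> X - U \<and> j \<in> X - U \<and> j < i}"
  have fin: "finite ?P" "finite ?Q"
    using X by (auto intro: finite_subset[OF _ finite_cartesian_product[OF X X]])
  have "ecoeff (eder X c (eder X c f)) U = (\<Sum>i\<in>X - U. \<Sum>j\<in>X - insert i U. h i j)"
    using U by (simp add: ecoeff_eder sum_distrib_left h_def)
  also have "\<dots> = (\<Sum>(i, j)\<in>Sigma (X - U) (\<lambda>i. X - insert i U). h i j)"
    using X by (intro sum.Sigma) auto
  also have "Sigma (X - U) (\<lambda>i. X - insert i U) = ?P \<union> ?Q"
    by auto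
  also have "(\<Sum>(i, j)\<in>?P \<union> ?Q. h i j) = (\<Sum>(i, j)\<in>?P. h i j) + (\<Sum>(i, j)\<in>?Q. h i j)"
    using fin by (intro sum.union_disjoint) auto
  also have "(\<Sum>(i, j)\<in>?P. h i j) = (\<Sum>(i, j)\<in>?Q. - h i j)"
    by (rule sum.reindex_bij_witness[of _ prod.swap prod.swap]) (auto simp: h)
  finally show "ecoeff (eder X c (eder X c f)) U = ecoeff 0 U"
    by (simp add: split_def sum_negf)
qed

lemma eder_ebasis:
  assumes X: "finite X" "S \<subseteq> X"
  shows "eder X c (ebasis S) = (\<Sum>i\<in>S. esc (pos_sign S i * c i) * ebasis (S - {i}))"
proof (rule ext_eqI)
  fix U :: "nat set" assume U: "finite U"
  have S: "finite S" using X finite_subset by blast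
  have "ecoeff (eder X c (ebasis S)) U = (\<Sum>i\<in>X - U. if insert i U = S then pos_sign U i * c i else 0)"
    unfolding ecoeff_eder[OF U] using S by (intro sum.cong) (auto simp: ecoeff_ebasis)
  also have "\<dots> = (\<Sum>i\<in>S. if U = S - {i} then pos_sign S i * c i else 0)"
  proof (rule sum.mono_neutral_cong)
    fix i assume i: "i \<in> (X - U) \<inter> S"
    hence "insert i U = S \<longleftrightarrow> U = S - {i}" by auto
    moreover have "pos_sign U i = (pos_sign S i :: 'a)" if "insert i U = S"
      using i U pos_sign_insert[of i U i, where 'a = 'a] unfolding that by simp
    ultimately show "(if insert i U = S then pos_sign U i * c i else 0) = (if U = S - {i} then pos_sign S i * c i else 0)"
      by auto
  qed (use X S in auto)
  also have "\<dots> = ecoeff (\<Sum>i\<in>S. esc (pos_sign S i * c i) * ebasis (S - {i})) U"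
    using S by (simp add: ecoeff_sum ecoeff_ebasis if_distrib cong: if_cong)
  finally show "ecoeff (eder X c (ebasis S)) U = \<dots>" .
qed

section \<open>The generators of $J_t$\<close>

lemma prod_zvar: "(\<Prod>r\<in>A. zvar (f r)) = (mon (\<Sum>r\<in>A. zexp (f r)) :: 'k::field zpoly)"
  by (induction A rule: infinite_finite_induct) (auto simp: zvar_def mon_mult)

lemma lookup_sum_zexp: "finite A \<Longrightarrow> lookup (\<Sum>r\<in>A. zexp (f r)) j = card {r \<in> A. f r = j}"
  by (simp add: lookup_sum lookup_zexp flip: sum.inter_filter)

lemma sum_lookup_sum_zexp:
  assumes "finite A" "finite B"
  shows "(\<Sum>j\<in>B. lookup (\<Sum>r\<in>A. zexp (f r)) j) = card {r \<in> A. f r \<in> B}"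
proof -
  have "(\<Sum>j\<in>B. lookup (\<Sum>r\<in>A. zexp (f r)) j) = (\<Sum>r\<in>A. \<Sum>j\<in>B. if f r = j then 1 else 0)"
    by (subst sum.swap) (simp add: lookup_sum lookup_zexp)
  also have "\<dots> = (\<Sum>r\<in>A. if f r \<in> B then 1 else 0)"
    using assms by (intro sum.cong) auto
  finally show ?thesis using assms by (simp flip: sum.inter_filter)
qed

lemma keys_sum_zexp: "finite A \<Longrightarrow> keys (\<Sum>r\<in>A. zexp (f r)) = f ` A"
  by (auto simp: in_keys_iff lookup_sum_zexp card_gt_0_iff)

lemma mdeg_sum_zexp: "finite A \<Longrightarrow> mdeg (\<Sum>r\<in>A. zexp (f r)) = card A"
  by (induction A rule: finite_induct) (auto simp: mdeg_add)

lemma monom_eq_sum_list: "\<exists>xs. u = sum_list (map zexp xs)"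
proof (induction "mdeg u" arbitrary: u)
  case 0
  thus ?case by (intro exI[of _ "[]"]) simp
next
  case (Suc n)
  hence "u \<noteq> 0" by auto
  then obtain i where i: "i \<in> keys u" using mmax_in_keys by blast
  note u = zexp_add_diff[OF i, symmetric]
  hence "mdeg u = 1 + mdeg (u - zexp i)" by (metis mdeg_add mdeg_zexp)
  with Suc obtain xs where "u - zexp i = sum_list (map zexp xs)" by fastforce
  thus ?case using u by (intro exI[of _ "i # xs"]) simp
qed

text \<open>The exponents of the generators of J_t. If s factors come from the second block, t - s
  rows remain for the first block, whose last column is n; so the indices of its indeterminates
  reach at most n - (t - s) + 1 = d + s, which is 2d + s in the new numbering. The sum over
  \<open>{d<..2 * d}\<close> is s.\<close>

definition J_monoms :: "nat \<Rightarrow> nat \<Rightarrow> monom set" where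
  "J_monoms d t = {u. keys u \<subseteq> {1..<2 * d + t} \<and> mdeg u = t \<and>
    (\<forall>i\<in>keys u. 2 * d < i \<longrightarrow> i \<le> 2 * d + (\<Sum>j\<in>{d<..2 * d}. lookup u j))}"

text \<open>If the result contains a variable beyond 2d, the removed one was beyond 2d as well. So
  the number of factors from the second block does not drop, and no index exceeds the old
  maximum.\<close>

lemma J_monoms_exchange:
  assumes u: "u \<in> J_monoms d t" "u \<noteq> 0" and i: "1 \<le> i" "i < mmax u"
  shows "zexp i + u - zexp (mmax u) \<in> J_monoms d t"
proof -
  let ?v = "zexp i + u - zexp (mmax u)"
  have m: "mmax u \<in> keys u" using u(2) by (rule mmax_in_keys)
  have k: "keys ?v \<subseteq> insert i (keys u)"
    using keys_diff_monom[of "zexp i + u" "zexp (mmax u)"] by (simp add: keys_add_monom)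
  moreover have "insert i (keys u) \<subseteq> {1..<2 * d + t}"
    using u i m by (fastforce simp: J_monoms_def)
  moreover have "mdeg ?v = t"
    using arg_cong[OF exchange_add[OF m, of i], of mdeg] u by (simp add: mdeg_add J_monoms_def)
  moreover have "j \<le> 2 * d + (\<Sum>j\<in>{d<..2 * d}. lookup ?v j)" if "j \<in> keys ?v" "2 * d < j" for j
  proof -
    have "j \<le> mmax u" using that(1) k i mmax_ge[of j u] by auto
    moreover have "mmax u \<le> 2 * d + (\<Sum>j\<in>{d<..2 * d}. lookup u j)"
      using u m that(2) \<open>j \<le> mmax u\<close> by (auto simp: J_monoms_def)
    moreover have "(\<Sum>j\<in>{d<..2 * d}. lookup u j) \<le> (\<Sum>j\<in>{d<..2 * d}. lookup ?v j)"
      using that(2) \<open>j \<le> mmax u\<close> by (intro sum_mono) (auto simp: lookup_minus lookup_add lookup_zexp)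
    ultimately show ?thesis by linarith
  qed
  ultimately show ?thesis unfolding J_monoms_def by blast
qed

text \<open>Below the diagonal of a block the truncated subtraction gives a meaningless value, which
  \<open>Tmat_eq\<close> masks by 0.\<close>

definition T_index :: "nat \<Rightarrow> nat \<Rightarrow> nat \<Rightarrow> nat \<Rightarrow> nat" where
  "T_index n t r c = (if c \<le> n then z_index n t (c - r + 1) 1 else z_index n t (c - n - r + 1) 2)"

lemma Tmat_eq: "Tmat n t r c =
    (if (if c \<le> n then r \<le> c else r \<le> c - n) then zvar (T_index n t r c) else (0 :: 'k::field zpoly))"
  by (simp add: Tmat_def Tblock_def xvar_def T_index_def)

lemma strict_mono_on_gap:
  assumes "strict_mono_on {1..t} c" "1 \<le> r" "r \<le> r'" "r' \<le> t"
  shows "c r + (r' - r) \<le> (c r' :: nat)"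
  using assms(3,4)
proof (induction r' rule: dec_induct)
  case (step k)
  have "c k < c (Suc k)" using assms step by (intro strict_mono_onD[OF assms(1)]) auto
  thus ?case using step by simp
qed simp

lemma J_gens_subset:
  assumes t: "1 \<le> t" "t \<le> n" and c: "c ` {1..t} \<subseteq> {1..2 * n}" "strict_mono_on {1..t} c"
    and nz: "(\<Prod>r=1..t. Tmat n t r (c r)) \<noteq> (0 :: 'k::field zpoly)"
  shows "(\<Prod>r=1..t. Tmat n t r (c r)) \<in> (mon ` J_monoms (n - t + 1) t :: 'k zpoly set)"
proof -
  define d where "d = n - t + 1"
  define f where "f r = T_index n t r (c r)" for r
  define u where "u = (\<Sum>r\<in>{1..t}. zexp (f r))"
  have n: "n + 1 = d + t" using t by (simp add: d_def)
  have zi: "z_index n t i j =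
      (if j = 1 then if i \<le> d then i else d + i else if i \<le> d then d + i else d + (t - 1) + i)" for i j
    by (simp add: z_index_def Let_def d_def)
  have ok: "if c r \<le> n then r \<le> c r else r \<le> c r - n" if "r \<in> {1..t}" for r
  proof (rule ccontr)
    assume "\<not> ?thesis"
    hence "Tmat n t r (c r) = (0 :: 'k zpoly)" unfolding Tmat_eq by argo
    hence "(\<Prod>r=1..t. Tmat n t r (c r)) = (0 :: 'k zpoly)" using that by (intro prod_zero) auto
    thus False using nz by simp
  qed
  have "(\<Prod>r=1..t. Tmat n t r (c r)) = (\<Prod>r\<in>{1..t}. zvar (f r) :: 'k zpoly)"
  proof (rule prod.cong[OF refl])
    fix r assume "r \<in> {1..t}"
    from ok[OF this] show "Tmat n t r (c r) = (zvar (f r) :: 'k zpoly)"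
      unfolding Tmat_eq f_def by (rule if_P)
  qed
  hence prod: "(\<Prod>r=1..t. Tmat n t r (c r)) = (mon u :: 'k zpoly)" by (simp only: prod_zvar u_def)
  have gap: "c r + (t - r) \<le> c t" if "r \<in> {1..t}" for r
    using strict_mono_on_gap[OF c(2), of r t] that by auto
  have "c t \<in> {1..2 * n}" using t by (intro subsetD[OF c(1)] imageI) simp
  hence ct: "c t \<le> 2 * n" by simp
  \<comment> \<open>The t - r rows below row r need further columns to the right; in the second
    block this bounds the index of the indeterminate by d.\<close>
  have bound: "c r + t \<le> 2 * n + r" if "r \<in> {1..t}" for r using gap[OF that] ct that by auto
  have f1: "f r = (if c r + 1 \<le> r + d then c r - r + 1 else c r - r + 1 + d)"
    if "r \<in> {1..t}" "c r \<le> n" for r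
    using that ok[OF that(1)] n by (auto simp: f_def T_index_def zi)
  have f2: "f r = d + (c r - n - r + 1)" "c r - n - r + 1 \<le> d" if "r \<in> {1..t}" "n < c r" for r
  proof -
    show "c r - n - r + 1 \<le> d" using that ok[OF that(1)] bound[OF that(1)] n by auto
    thus "f r = d + (c r - n - r + 1)"
      using that by (simp add: f_def T_index_def zi)
  qed
  have "f r \<in> {1..<2 * d + t}" if "r \<in> {1..t}" for r
  proof (cases "c r \<le> n")
    case True
    thus ?thesis using f1[OF that True] ok[OF that] n that by (auto split: if_splits)
  next
    case False
    thus ?thesis using f2[OF that] t by auto
  qed
  hence "keys u \<subseteq> {1..<2 * d + t}" unfolding u_def by (subst keys_sum_zexp) auto
  moreover have "mdeg u = t" by (simp add: u_def mdeg_sum_zexp)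
  moreover have "i \<le> 2 * d + (\<Sum>j\<in>{d<..2 * d}. lookup u j)" if i: "i \<in> keys u" "2 * d < i" for i
  proof -
    let ?S = "{s \<in> {1..t}. n < c s}"
    have "i \<in> f ` {1..t}" using i keys_sum_zexp[of "{1..t}" f] by (simp only: u_def finite_atLeastAtMost)
    then obtain r where r: "r \<in> {1..t}" "f r = i" by blast
    have cr: "c r \<le> n"
    proof (rule ccontr)
      assume "\<not> c r \<le> n"
      thus False using f2[OF r(1)] r(2) i(2) by simp
    qed
    have i_eq: "i = c r - r + 1 + d" using f1[OF r(1) cr] r(2) i(2) by (auto split: if_splits)
    have fB: "f s \<in> {d<..2 * d}" if "s \<in> ?S" for s using f2[of s] that by auto
    have "card ?S \<le> card {s \<in> {1..t}. f s \<in> {d<..2 * d}}"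
      using fB by (intro card_mono) auto
    also have "\<dots> = (\<Sum>j\<in>{d<..2 * d}. lookup u j)"
      unfolding u_def by (rule sum_lookup_sum_zexp[symmetric]) auto
    finally have S: "card ?S \<le> (\<Sum>j\<in>{d<..2 * d}. lookup u j)" .
    \<comment> \<open>The rows after \<open>r\<close> that stay in the first block occupy distinct
      columns between \<open>c r\<close> and \<open>n\<close>, so at least t - r - (n - c r) rows
      lie in the second block. With i = c r - r + 1 + d and n + 1 = d + t this is the bound on
      i.\<close>
    let ?T = "{s \<in> {r<..t}. c s \<le> n}"
    have inj: "inj_on c {1..t}" using c(2) by (rule strict_mono_on_imp_inj_on)
    have "c ` ?T \<subseteq> {c r<..n}" using strict_mono_onD[OF c(2), of r] r(1) by auto
    hence "card (c ` ?T) \<le> card {c r<..n}" by (intro card_mono) auto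
    moreover have "card (c ` ?T) = card ?T"
      using r(1) by (intro card_image inj_on_subset[OF inj]) auto
    ultimately have T: "card ?T \<le> n - c r" by simp
    have "{1..t} \<subseteq> {1..r} \<union> ?T \<union> ?S" by auto
    hence "card {1..t} \<le> card ({1..r} \<union> ?T \<union> ?S)" by (intro card_mono) auto
    also have "\<dots> \<le> card {1..r} + card ?T + card ?S"
      by (metis (no_types, lifting) add_le_mono1 card_Un_le le_trans)
    finally have "t \<le> r + card ?T + card ?S" by simp
    thus ?thesis using S T i_eq n ok[OF r(1)] cr by simp
  qed
  ultimately have "u \<in> J_monoms d t" unfolding J_monoms_def by blast
  thus ?thesis unfolding prod d_def by blast
qed

text \<open>The column of the first row of \<open>\<^bold>T\<close> in which \<open>z\<^sub>i\<close> stands.\<close>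

definition row1_column :: "nat \<Rightarrow> nat \<Rightarrow> nat \<Rightarrow> nat" where
  "row1_column n d i = (if i \<le> d then i else if i \<le> 2 * d then n + (i - d) else i - d)"

text \<open>Each block is constant along its diagonals, so a factor standing in row 1 and column
  \<kappa> also stands in row r and column \<kappa> + r - 1 as long as that column stays inside the
  block. Sorting the factors by \<kappa> makes these columns strictly increasing.\<close>

lemma J_gens_superset:
  assumes t: "1 \<le> t" "t \<le> n" and u: "u \<in> J_monoms (n - t + 1) t"
  shows "mon u \<in> (J_gens n t :: 'k::field zpoly set)"
proof -
  define d where "d = n - t + 1"
  have n: "n + 1 = d + t" using t by (simp add: d_def)
  have zi: "z_index n t i j =
      (if j = 1 then if i \<le> d then i else d + i else if i \<le> d then d + i else d + (t - 1) + i)" for i j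
    by (simp add: z_index_def Let_def d_def)
  let ?\<kappa> = "row1_column n d"
  obtain xs where xs: "u = sum_list (map zexp xs)" using monom_eq_sum_list by blast
  define L where "L = sort_key ?\<kappa> xs"
  have "mset (map zexp L) = mset (map zexp xs)" by (simp add: L_def)
  hence uL: "u = sum_list (map zexp L)" unfolding xs by (metis sum_mset_sum_list)
  define f where "f r = L ! (r - 1)" for r
  have "u = (\<Sum>i\<in>{0..<length L}. zexp (L ! i))" using uL by (simp add: sum_list_sum_nth)
  also have "\<dots> = (\<Sum>r\<in>{1..length L}. zexp (f r))"
    by (rule sum.reindex_bij_witness[of _ "\<lambda>r. r - 1" Suc]) (auto simp: f_def)
  finally have u_eq: "u = (\<Sum>r\<in>{1..length L}. zexp (f r))" .
  have "mdeg u = length L" unfolding u_eq by (subst mdeg_sum_zexp) auto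
  hence len: "length L = t" using u by (simp add: J_monoms_def)
  note u_eq = u_eq[unfolded len]
  have ku: "keys u = f ` {1..t}" unfolding u_eq by (rule keys_sum_zexp) simp
  have mono: "?\<kappa> (f r) \<le> ?\<kappa> (f s)" if "1 \<le> r" "r \<le> s" "s \<le> t" for r s
    using sorted_nth_mono[OF sorted_sort_key[of ?\<kappa> xs, folded L_def], of "r - 1" "s - 1"] that len
    by (simp add: f_def)
  define c where "c r = ?\<kappa> (f r) + r - 1" for r
  have f_range: "1 \<le> f r" "f r < 2 * d + t" if "r \<in> {1..t}" for r
  proof -
    have "f r \<in> {1..<2 * d + t}" using u ku that unfolding J_monoms_def d_def by blast
    thus "1 \<le> f r" "f r < 2 * d + t" by auto
  qed
  have \<kappa>_pos: "1 \<le> ?\<kappa> (f r)" if "r \<in> {1..t}" for r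
    using f_range[OF that] by (auto simp: row1_column_def)
  have smono: "strict_mono_on {1..t} c"
  proof (rule strict_mono_onI)
    fix r s assume rs: "r \<in> {1..t}" "s \<in> {1..t}" "r < s"
    have "?\<kappa> (f r) \<le> ?\<kappa> (f s)" using mono[of r s] rs by simp
    thus "c r < c s" using rs \<kappa>_pos[OF rs(1)] by (simp add: c_def)
  qed
  have \<kappa>_le: "?\<kappa> (f r) \<le> n + d" if "r \<in> {1..t}" for r
    using f_range[OF that] n t by (auto simp: row1_column_def)
  have range: "c ` {1..t} \<subseteq> {1..2 * n}"
  proof
    fix x assume "x \<in> c ` {1..t}"
    then obtain r where r: "r \<in> {1..t}" "x = c r" by blast
    thus "x \<in> {1..2 * n}" using \<kappa>_pos[OF r(1)] \<kappa>_le[OF r(1)] n by (auto simp: c_def)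
  qed
  have T: "Tmat n t r (c r) = (zvar (f r) :: 'k zpoly)" if r: "r \<in> {1..t}" for r
  proof -
    consider "f r \<le> d" | "d < f r" "f r \<le> 2 * d" | "2 * d < f r" by linarith
    thus ?thesis
    proof cases
      case 1
      hence "c r = f r + r - 1" "c r \<le> n" using n r by (auto simp: c_def row1_column_def)
      moreover have "f r + r - 1 - r + 1 = f r" "r \<le> f r + r - 1" using f_range[OF r] by simp_all
      ultimately show ?thesis
        using 1 f_range[OF r] by (simp add: Tmat_eq T_index_def zi)
    next
      case 2
      hence c: "c r = n + (f r - d) + r - 1" "\<not> c r \<le> n" using r by (auto simp: c_def row1_column_def)
      moreover have "c r - n - r + 1 = f r - d" "r \<le> c r - n" "f r - d \<le> d" using 2 r by (auto simp: c(1))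
      ultimately show ?thesis
        using 2 by (simp add: Tmat_eq T_index_def zi)
    next
      case 3
      let ?S = "{s \<in> {1..t}. f s \<in> {d<..2 * d}}"
      \<comment> \<open>Factors of the second block have \<kappa> > n and are sorted behind
        \<open>f r\<close>, so their number s is at most t - r. Together with the bound 2d + s this
        keeps the column \<open>c r\<close> inside the first block.\<close>
      have "?S \<subseteq> {r<..t}"
      proof
        fix s assume s: "s \<in> ?S"
        have "?\<kappa> (f r) \<le> n" using 3 f_range[OF r] n by (auto simp: row1_column_def)
        moreover have "n < ?\<kappa> (f s)" using s by (auto simp: row1_column_def)
        ultimately have "\<not> s \<le> r" using mono[of s r] s r by auto
        thus "s \<in> {r<..t}" using s by auto
      qed
      hence "card ?S \<le> t - r" using card_mono[of "{r<..t}" ?S] by simp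
      moreover have "(\<Sum>j\<in>{d<..2 * d}. lookup u j) = card ?S"
        unfolding u_eq by (rule sum_lookup_sum_zexp) auto
      moreover have "f r \<le> 2 * d + (\<Sum>j\<in>{d<..2 * d}. lookup u j)"
      proof -
        have "f r \<in> keys u" using ku r by blast
        thus ?thesis using u 3 unfolding J_monoms_def d_def[symmetric] by blast
      qed
      ultimately have "f r \<le> 2 * d + (t - r)" by simp
      moreover have c: "c r = f r - d + r - 1" using 3 by (auto simp: c_def row1_column_def)
      ultimately have "c r \<le> n" using n r 3 by auto
      moreover have "c r - r + 1 = f r - d" "r \<le> c r" "\<not> f r - d \<le> d" using 3 r by (auto simp: c)
      ultimately show ?thesis
        using 3 by (simp add: Tmat_eq T_index_def zi)
    qed
  qed
  have "(\<Prod>r=1..t. Tmat n t r (c r)) = (\<Prod>r\<in>{1..t}. zvar (f r) :: 'k zpoly)"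
    by (intro prod.cong refl T)
  also have "\<dots> = mon u" by (simp only: prod_zvar u_eq)
  finally have "(\<Prod>r=1..t. Tmat n t r (c r)) = (mon u :: 'k zpoly)" .
  moreover have "mon u \<noteq> (0 :: 'k zpoly)" by (metis keys_mon keys_zero insert_not_empty)
  ultimately show ?thesis
    unfolding J_gens_def using range smono by (intro CollectI exI[of _ c]) simp
qed

lemma J_gens_eq:
  assumes "1 \<le> t" "t \<le> n"
  shows "J_gens n t = (mon ` J_monoms (n - t + 1) t :: 'k::field zpoly set)"
proof (intro equalityI subsetI)
  fix p :: "'k zpoly"
  assume "p \<in> J_gens n t"
  thus "p \<in> mon ` J_monoms (n - t + 1) t"
    using J_gens_subset[OF assms, where 'k = 'k] unfolding J_gens_def by blast
qed (use J_gens_superset[OF assms] in blast)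

lemma J_ideal_equigenerated_stable:
  assumes "1 \<le> t" "t \<le> n"
  shows "equigenerated_stable (2 * n) t (J_monoms (n - t + 1) t) (J_ideal n t :: 'k::field zpoly set)"
proof
  fix u assume u: "u \<in> J_monoms (n - t + 1) t"
  have "keys u \<subseteq> {1..<2 * (n - t + 1) + t}" using u by (simp add: J_monoms_def)
  also have "\<dots> \<subseteq> {1..2 * n}" using assms by auto
  finally show "keys u \<subseteq> {1..2 * n}" .
  show "mdeg u = t" using u by (simp add: J_monoms_def)
  fix i assume "1 \<le> i" "i < mmax u"
  moreover have "u \<noteq> 0" using u assms by (auto simp: J_monoms_def)
  ultimately show "zexp i + u - zexp (mmax u) \<in> J_monoms (n - t + 1) t"
    using J_monoms_exchange u by blast
qed (use assms in \<open>auto simp: J_ideal_def J_gens_eq\<close>)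

section \<open>Free modules\<close>

lemma lookup_scale [simp]: "lookup (scale p f) s = p * lookup f s"
  unfolding scale_def by (simp add: Poly_Mapping.map.rep_eq when_def)

lemma scale_add_right: "scale p (f + g) = scale p f + scale p g"
  by (rule poly_mapping_eqI) (simp add: lookup_add distrib_left)

lemma scale_add_left: "scale (p + q) f = scale p f + scale q f"
  by (rule poly_mapping_eqI) (simp add: lookup_add distrib_right)

lemma scale_diff_right: "scale p (f - g) = scale p f - scale p g"
  by (rule poly_mapping_eqI) (simp add: lookup_minus right_diff_distrib)

lemma scale_sum_right: "scale p (sum f A) = (\<Sum>x\<in>A. scale p (f x))"
  by (rule poly_mapping_eqI) (simp add: lookup_sum sum_distrib_left)

lemma scale_scale: "scale p (scale q f) = scale (p * q) f"
  by (rule poly_mapping_eqI) (simp add: mult.assoc)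

lemma scale_0 [simp]: "scale 0 f = 0" "scale p 0 = 0"
  by (rule poly_mapping_eqI, simp)+

lemma scale_1 [simp]: "scale 1 f = f"
  by (rule poly_mapping_eqI) simp

lemma scale_single [simp]: "scale p (single s q) = single s (p * q)"
  by (rule poly_mapping_eqI) (simp add: lookup_single when_def)

lemma lin_ext_superset:
  "finite S \<Longrightarrow> keys f \<subseteq> S \<Longrightarrow> lin_ext \<phi> f = (\<Sum>s\<in>S. scale (lookup f s) (\<phi> s))"
  unfolding lin_ext_def by (rule sum.mono_neutral_left) (auto simp: in_keys_iff)

lemma lin_ext_add: "lin_ext \<phi> (f + g) = lin_ext \<phi> f + lin_ext \<phi> g"
proof -
  let ?S = "keys f \<union> keys g"
  show ?thesis
    using lin_ext_superset[of ?S "f + g" \<phi>] lin_ext_superset[of ?S f \<phi>] lin_ext_superset[of ?S g \<phi>]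
      Poly_Mapping.keys_add[of f g]
    by (simp add: lookup_add scale_add_left sum.distrib)
qed

lemma lin_ext_scale: "lin_ext \<phi> (scale p f) = scale p (lin_ext \<phi> f)"
proof -
  have "keys (scale p f) \<subseteq> keys f" by (auto simp: in_keys_iff)
  hence "lin_ext \<phi> (scale p f) = (\<Sum>s\<in>keys f. scale (lookup (scale p f) s) (\<phi> s))"
    by (intro lin_ext_superset) auto
  thus ?thesis by (simp add: lin_ext_def scale_sum_right scale_scale)
qed

lemma lin_ext_single [simp]: "lin_ext \<phi> (single s p) = scale p (\<phi> s)"
  using lin_ext_superset[of "{s}" "single s p" \<phi>] by simp

lemma lin_ext_0 [simp]: "lin_ext \<phi> 0 = 0"
  by (simp add: lin_ext_def)

lemma lin_ext_uminus: "lin_ext \<phi> (- f) = - lin_ext \<phi> f"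
  using lin_ext_add[of \<phi> f "- f"] by (simp add: eq_neg_iff_add_eq_0 add.commute)

lemma lin_ext_sum: "lin_ext \<phi> (sum f A) = (\<Sum>x\<in>A. lin_ext \<phi> (f x))"
  by (induction A rule: infinite_finite_induct) (auto simp: lin_ext_add)

lemma lin_ext_lin_ext: "lin_ext \<phi> (lin_ext \<psi> f) = lin_ext (\<lambda>s. lin_ext \<phi> (\<psi> s)) f"
  unfolding lin_ext_def[of \<psi>] lin_ext_sum lin_ext_scale by (simp add: lin_ext_def)

lemma lookup_lin_ext: "lookup (lin_ext \<phi> f) x = (\<Sum>s\<in>keys f. lookup f s * lookup (\<phi> s) x)"
  by (simp add: lin_ext_def lookup_sum)

definition fmod :: "nat \<Rightarrow> 'b set \<Rightarrow> ('b \<Rightarrow>\<^sub>0 'k::field zpoly) set" where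
  "fmod N B = {f. keys f \<subseteq> B \<and> (\<forall>s. lookup f s \<in> polys N)}"

lemma free_module_simps [simp]:
  "carrier (free_module N B) = fmod N B" "x \<oplus>\<^bsub>free_module N B\<^esub> y = x + y"
  "\<zero>\<^bsub>free_module N B\<^esub> = 0" "p \<odot>\<^bsub>free_module N B\<^esub> y = scale p y"
  by (simp_all add: free_module_def fmod_def)

lemma fmod_mono: "B \<subseteq> B' \<Longrightarrow> fmod N B \<subseteq> fmod N B'"
  by (auto simp: fmod_def)

lemma fmod_0 [simp]: "0 \<in> fmod N B"
  by (simp add: fmod_def)

lemma fmod_add: "f \<in> fmod N B \<Longrightarrow> g \<in> fmod N B \<Longrightarrow> f + g \<in> fmod N B"
  unfolding fmod_def using Poly_Mapping.keys_add[of f g] by (auto simp: lookup_add polys_add)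

lemma fmod_uminus: "f \<in> fmod N B \<Longrightarrow> - f \<in> fmod N B"
  by (auto simp: fmod_def in_keys_iff)

lemma fmod_diff: "f \<in> fmod N B \<Longrightarrow> g \<in> fmod N B \<Longrightarrow> f - g \<in> fmod N B"
  using fmod_add[of f N B "- g"] by (simp add: fmod_uminus)

lemma fmod_scale: "p \<in> polys N \<Longrightarrow> f \<in> fmod N B \<Longrightarrow> scale p f \<in> fmod N B"
  by (auto simp: fmod_def in_keys_iff polys_mult)

lemma fmod_sum: "(\<And>x. x \<in> A \<Longrightarrow> f x \<in> fmod N B) \<Longrightarrow> sum f A \<in> fmod N B"
  by (induction A rule: infinite_finite_induct) (auto intro: fmod_add)

lemma fmod_single: "s \<in> B \<Longrightarrow> p \<in> polys N \<Longrightarrow> single s p \<in> fmod N B"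
  by (auto simp: fmod_def lookup_single when_def)

lemma lin_ext_fmod:
  assumes "f \<in> fmod N B" "\<And>s. s \<in> B \<Longrightarrow> \<phi> s \<in> fmod N B'"
  shows "lin_ext \<phi> f \<in> fmod N B'"
  unfolding lin_ext_def using assms by (intro fmod_sum fmod_scale) (auto simp: fmod_def)

lemma lin_ext_linear_maps:
  assumes "\<And>s. s \<in> B \<Longrightarrow> \<phi> s \<in> fmod N B'"
  shows "lin_ext \<phi> \<in> linear_maps (poly_ring N) (free_module N B) (free_module N B')"
  using lin_ext_fmod[OF _ assms] by (auto simp: linear_maps_def lin_ext_add lin_ext_scale)

lemma fmod_eq_sum_terms:
  fixes f :: "'a \<Rightarrow>\<^sub>0 ('b \<Rightarrow>\<^sub>0 'c::comm_monoid_add)"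
  shows "f = (\<Sum>s\<in>keys f. \<Sum>y\<in>keys (lookup f s). single s (single y (lookup (lookup f s) y)))"
proof -
  have *: "single s (sum g A) = (\<Sum>x\<in>A. single s (g x))" for s :: 'a and g :: "'b \<Rightarrow> 'b \<Rightarrow>\<^sub>0 'c" and A
    by (induction A rule: infinite_finite_induct) (auto simp: single_add)
  have "f = (\<Sum>s\<in>keys f. single s (lookup f s))" by (rule poly_mapping_sum_single)
  also have "\<dots> = (\<Sum>s\<in>keys f. single s (\<Sum>y\<in>keys (lookup f s). single y (lookup (lookup f s) y)))"
    by (subst (2) poly_mapping_sum_single) simp
  finally show ?thesis unfolding * .
qed

section \<open>The differential of the Eliahou--Kervaire complex\<close>

lemma length_del: "1 \<le> r \<Longrightarrow> r \<le> length \<sigma> \<Longrightarrow> length (del r \<sigma>) = length \<sigma> - 1"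
  by (simp add: del_def)

lemma set_del_subset: "set (del r \<sigma>) \<subseteq> set \<sigma>"
  by (auto simp: del_def dest: in_set_takeD in_set_dropD)

lemma split_at:
  assumes "1 \<le> r" "r \<le> length \<sigma>"
  shows "\<sigma> = take (r - 1) \<sigma> @ \<sigma> ! (r - 1) # drop r \<sigma>"
  using id_take_nth_drop[of "r - 1" \<sigma>] assms by simp

lemma sorted_del: "sorted_wrt P \<sigma> \<Longrightarrow> 1 \<le> r \<Longrightarrow> r \<le> length \<sigma> \<Longrightarrow> sorted_wrt P (del r \<sigma>)"
  using split_at[of r \<sigma>] by (metis (no_types, lifting) del_def sorted_wrt_append sorted_wrt.simps(2) list.set_intros(2))

lemma set_del:
  assumes "distinct \<sigma>" "1 \<le> r" "r \<le> length \<sigma>"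
  shows "set (del r \<sigma>) = set \<sigma> - {\<sigma> ! (r - 1)}"
proof -
  have "set \<sigma> = set (take (r - 1) \<sigma> @ \<sigma> ! (r - 1) # drop r \<sigma>)"
    using split_at[OF assms(2,3)] by simp
  moreover have "distinct (take (r - 1) \<sigma> @ \<sigma> ! (r - 1) # drop r \<sigma>)"
    using split_at[OF assms(2,3)] assms(1) by simp
  ultimately show ?thesis by (auto simp: del_def)
qed

lemma del_last: "del (length \<sigma>) \<sigma> = butlast \<sigma>"
  by (simp add: del_def butlast_conv_take)

lemma single_mult_sign_mon:
  "single y c * ((- 1) ^ r * mon v) = (single (y + v) ((- 1) ^ r * c) :: 'k::field zpoly)"
  by (simp add: minus_one_power_iff mon_def mult_single single_uminus)

text \<open>An exchange puts a variable of smaller index in place of the last one and so lowers this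
  sum of indices; it is the basis of the measure for leading terms.\<close>

definition wt :: "monom \<Rightarrow> nat" where
  "wt u = (\<Sum>i\<in>keys u. lookup u i * i)"

lemma wt_add: "wt (u + v) = wt u + wt v"
proof -
  have *: "wt w = (\<Sum>i\<in>S. lookup w i * i)" if "finite S" "keys w \<subseteq> S" for w S
    unfolding wt_def using that by (intro sum.mono_neutral_left) (auto simp: in_keys_iff)
  show ?thesis
    using *[of "keys u \<union> keys v" "u + v"] *[of "keys u \<union> keys v" u] *[of "keys u \<union> keys v" v]
    by (simp add: keys_add_monom lookup_add sum.distrib distrib_right)
qed

lemma wt_zexp [simp]: "wt (zexp i) = i"
  by (simp add: wt_def lookup_zexp)

context equigenerated_stable
begin

abbreviation exch :: "nat \<Rightarrow> monom \<Rightarrow> monom" where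
  "exch i u \<equiv> zexp i + u - zexp (mmax u)"

abbreviation EK :: "nat \<Rightarrow> (symb \<Rightarrow>\<^sub>0 'k zpoly) set" where
  "EK q \<equiv> fmod N (ek_basis I q)"

lemma ek_basis_iff: "(\<sigma>, u) \<in> ek_basis I q \<longleftrightarrow>
    length \<sigma> = q \<and> sorted_wrt (<) \<sigma> \<and> u \<in> G \<and> (\<forall>i\<in>set \<sigma>. 1 \<le> i \<and> i < mmax u)"
  by (simp add: ek_basis_def min_gens_I)

lemma ek_basis_del:
  "(\<sigma>, u) \<in> ek_basis I q \<Longrightarrow> r \<in> {1..q} \<Longrightarrow> (del r \<sigma>, u) \<in> ek_basis I (q - 1)"
  using set_del_subset[of r \<sigma>] by (auto simp: ek_basis_iff length_del sorted_del)

lemma ek_basis_nth: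
  assumes "(\<sigma>, u) \<in> ek_basis I q" "r \<in> {1..q}"
  shows "1 \<le> \<sigma> ! (r - 1)" "\<sigma> ! (r - 1) < mmax u" "\<sigma> ! (r - 1) \<in> {1..N}"
proof -
  have "\<sigma> ! (r - 1) \<in> set \<sigma>" using assms by (auto simp: ek_basis_iff)
  thus *: "1 \<le> \<sigma> ! (r - 1)" "\<sigma> ! (r - 1) < mmax u" using assms by (auto simp: ek_basis_iff)
  show "\<sigma> ! (r - 1) \<in> {1..N}" using * G_mmax(2)[of u] assms by (auto simp: ek_basis_iff)
qed

lemma exch_props:
  assumes "u \<in> G" "1 \<le> i" "i < mmax u"
  shows "exch i u \<in> G" "exch i u + zexp (mmax u) = zexp i + u"
  using G_exchange assms exchange_add[OF G_mmax(1)] by auto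

definition adm :: "nat list \<Rightarrow> monom \<Rightarrow> nat set" where
  "adm \<sigma> u = {r \<in> {1..length \<sigma>}. (del r \<sigma>, exch (\<sigma> ! (r - 1)) u) \<in> ek_basis I (length \<sigma> - 1)}"

text \<open>For an ideal generated in one degree the monomials \<open>y\<^sub>r\<close> are all equal to the last variable
  of \<open>u\<close>.\<close>

lemma ek_diff_symb_eq:
  assumes "(\<sigma>, u) \<in> ek_basis I q"
  shows "ek_diff_symb I (\<sigma>, u) =
    (\<Sum>r\<in>{1..q}. single (del r \<sigma>, u) ((- 1) ^ r * mon (zexp (\<sigma> ! (r - 1))))) -
    (\<Sum>r\<in>adm \<sigma> u. single (del r \<sigma>, exch (\<sigma> ! (r - 1)) u) ((- 1) ^ r * mon (zexp (mmax u))))"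
proof -
  have q: "length \<sigma> = q" and u: "u \<in> G" using assms by (auto simp: ek_basis_iff)
  have g: "ek_g I (zexp (\<sigma> ! (r - 1)) + u) = exch (\<sigma> ! (r - 1)) u" if "r \<in> {1..q}" for r
    by (rule ek_g_eq[OF u ek_basis_nth(1,2)[OF assms that]])
  have y: "zexp (\<sigma> ! (r - 1)) + u - exch (\<sigma> ! (r - 1)) u = zexp (mmax u)" if "r \<in> {1..q}" for r
    using add_diff_cancel_left'[of "exch (\<sigma> ! (r - 1)) u" "zexp (mmax u)"]
    unfolding exch_props(2)[OF u ek_basis_nth(1,2)[OF assms that]] .
  have adm: "{r. r \<in> {1..q} \<and> (del r \<sigma>, ek_g I (zexp (\<sigma> ! (r - 1)) + u)) \<in> ek_basis I (q - 1)} = adm \<sigma> u"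
    using g unfolding adm_def q by (intro Collect_cong) (simp cong: conj_cong)
  have "(\<Sum>r\<in>adm \<sigma> u. single (del r \<sigma>, ek_g I (zexp (\<sigma> ! (r - 1)) + u))
        ((- 1) ^ r * mon (zexp (\<sigma> ! (r - 1)) + u - ek_g I (zexp (\<sigma> ! (r - 1)) + u)))) =
      (\<Sum>r\<in>adm \<sigma> u. single (del r \<sigma>, exch (\<sigma> ! (r - 1)) u) ((- 1) ^ r * mon (zexp (mmax u))) ::
        symb \<Rightarrow>\<^sub>0 'k zpoly)"
  proof (rule sum.cong[OF refl])
    fix r assume "r \<in> adm \<sigma> u"
    hence r: "r \<in> {1..q}" by (simp add: adm_def q)
    show "single (del r \<sigma>, ek_g I (zexp (\<sigma> ! (r - 1)) + u))
        ((- 1) ^ r * mon (zexp (\<sigma> ! (r - 1)) + u - ek_g I (zexp (\<sigma> ! (r - 1)) + u))) =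
      (single (del r \<sigma>, exch (\<sigma> ! (r - 1)) u) ((- 1) ^ r * mon (zexp (mmax u))) :: symb \<Rightarrow>\<^sub>0 'k zpoly)"
      unfolding g[OF r] y[OF r] ..
  qed
  thus ?thesis unfolding ek_diff_symb.simps Let_def q adm zvar_def by (rule arg_cong)
qed

lemma ek_diff_symb_fmod:
  assumes "s \<in> ek_basis I (Suc q)"
  shows "ek_diff_symb I s \<in> EK q"
proof -
  obtain \<sigma> u where s: "s = (\<sigma>, u)" by (cases s)
  note assms = assms[unfolded s]
  have u: "u \<in> G" "length \<sigma> = Suc q" using assms by (auto simp: ek_basis_iff)
  show ?thesis unfolding s ek_diff_symb_eq[OF assms]
    using ek_basis_del[OF assms] ek_basis_nth[OF assms] G_mmax(2)[OF u(1)] u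
    by (intro fmod_diff fmod_sum fmod_single polys_mult) (auto simp: adm_def)
qed

lemma ek_diff_fmod: "f \<in> EK (Suc q) \<Longrightarrow> ek_diff I f \<in> EK q"
  unfolding ek_diff_def by (erule lin_ext_fmod) (rule ek_diff_symb_fmod)

lemma ek_diff_linear:
  "ek_diff I \<in> linear_maps (poly_ring N) (free_module N (ek_basis I (Suc q))) (free_module N (ek_basis I q))"
  unfolding ek_diff_def by (intro lin_ext_linear_maps ek_diff_symb_fmod)

lemma linear_form_ek_diff_symb:
  assumes "s \<in> ek_basis I (Suc q)"
  shows "linear_form (lookup (ek_diff_symb I s) s')"
proof -
  have add: "linear_form (p + q)" if "linear_form p" "linear_form q" for p q :: "'k zpoly"
    using that Poly_Mapping.keys_add[of p q] by (auto simp: linear_form_def)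
  have sum: "linear_form (sum f A)" if "\<And>x. x \<in> A \<Longrightarrow> linear_form (f x)" for f :: "nat \<Rightarrow> 'k zpoly" and A
    using that
  proof (induction A rule: infinite_finite_induct)
    case (insert x A)
    thus ?case using add[of "f x" "sum f A"] by simp
  qed (auto simp: linear_form_def)
  have uminus: "linear_form (- p)" if "linear_form p" for p :: "'k zpoly"
    using that by (simp add: linear_form_def in_keys_iff)
  have diff: "linear_form (p - q)" if "linear_form p" "linear_form q" for p q :: "'k zpoly"
    using add[OF that(1) uminus[OF that(2)]] by simp
  have monomials: "linear_form ((- 1) ^ r * mon (zexp i) when b :: 'k zpoly)" for r i b
  proof -
    have "(- 1) ^ r * mon (zexp i) = (single (zexp i) ((- 1) ^ r) :: 'k zpoly)"
      using single_mult_sign_mon[of 0 1 r "zexp i"] by simp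
    thus ?thesis by (simp add: linear_form_def when_def)
  qed
  obtain \<sigma> u where s: "s = (\<sigma>, u)" by (cases s)
  show ?thesis unfolding s ek_diff_symb_eq[OF assms[unfolded s]] lookup_minus lookup_sum lookup_single
    by (intro diff sum monomials)
qed

lemma linear_complex_ek: "linear_complex (ek_basis I) (\<lambda>_. ek_diff I)"
  by (simp add: linear_complex_def ek_diff_def linear_form_ek_diff_symb)

text \<open>Linear entries have no constant term, so no coordinate of a boundary has one; and a
  polynomial in z_1, ..., z_N without constant term lies in the ideal of the variables.\<close>

lemma minimal_complex_ek: "minimal_complex N (ek_basis I) (\<lambda>_. ek_diff I)"
  unfolding minimal_complex_def
proof (intro allI ballI)
  fix q x s
  assume "x \<in> carrier (free_module N (ek_basis I (Suc q)) :: ('k zpoly, symb \<Rightarrow>\<^sub>0 'k zpoly) module)"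
  hence x: "x \<in> EK (Suc q)" by simp
  have zvars: "zvar ` {1..N} = (mon ` zexp ` {1..N} :: 'k zpoly set)" by (simp add: zvar_def image_image)
  have "lookup (ek_diff I x) s \<in> polys N" using ek_diff_fmod[OF x] unfolding fmod_def by blast
  moreover have "\<exists>u\<in>zexp ` {1..N}. \<exists>y. w = u + y" if w: "w \<in> keys (lookup (ek_diff I x) s)" for w
  proof -
    have "w \<noteq> 0"
    proof
      assume "w = 0"
      have "w \<in> (\<Union>s'\<in>keys x. keys (lookup x s' * lookup (ek_diff_symb I s') s))"
        using w[unfolded ek_diff_def lookup_lin_ext] by (rule subsetD[OF keys_sum])
      then obtain s' where s': "s' \<in> keys x" "w \<in> keys (lookup x s' * lookup (ek_diff_symb I s') s)" by blast
      then obtain a b where "w = a + b" "b \<in> keys (lookup (ek_diff_symb I s') s)"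
        using keys_mult[of "lookup x s'" "lookup (ek_diff_symb I s') s"] by blast
      moreover have "s' \<in> ek_basis I (Suc q)" using s' x by (auto simp: fmod_def)
      ultimately have "mdeg w = mdeg a + 1"
        using linear_form_ek_diff_symb[of s' q s] by (auto simp: linear_form_def mdeg_add)
      thus False using \<open>w = 0\<close> by simp
    qed
    then obtain i where i: "i \<in> keys w" using mmax_in_keys by blast
    moreover have "keys w \<subseteq> {1..N}" using w \<open>lookup (ek_diff I x) s \<in> polys N\<close> by (auto simp: polys_def)
    moreover note zexp_add_diff[OF i, symmetric]
    ultimately show ?thesis by blast
  qed
  ultimately show "lookup (ek_diff I x) s \<in> Idl\<^bsub>poly_ring N\<^esub> (zvar ` {1..N})"
    unfolding zvars by (subst Idl_mon) auto
qed

lemma scale_ek_diff_symb: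
  assumes "(\<sigma>, u) \<in> ek_basis I q"
  shows "scale (single y c) (ek_diff_symb I (\<sigma>, u)) =
    (\<Sum>r\<in>{1..q}. single (del r \<sigma>, u) (single (y + zexp (\<sigma> ! (r - 1))) ((- 1) ^ r * c))) -
    (\<Sum>r\<in>adm \<sigma> u. single (del r \<sigma>, exch (\<sigma> ! (r - 1)) u) (single (y + zexp (mmax u)) ((- 1) ^ r * c)))"
  unfolding ek_diff_symb_eq[OF assms]
  by (simp add: scale_diff_right scale_sum_right single_mult_sign_mon)

section \<open>Exactness\<close>

text \<open>The multiples \<open>y e(\<sigma>;u)\<close> fall into two classes: if some \<open>j < max(u)\<close> with \<open>z\<^sub>j\<close> dividing \<open>y\<close> lies
  beyond \<open>\<sigma>\<close>, then \<open>y e(\<sigma>;u)\<close> is the leading term of the boundary of a multiple of \<open>e(\<sigma> \<union> {j};u)\<close>;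
  the multiples of the other class have boundaries with distinct leading terms.\<close>

definition reduced :: "(symb \<Rightarrow>\<^sub>0 'k zpoly) \<Rightarrow> bool" where
  "reduced f \<longleftrightarrow> (\<forall>s\<in>keys f. \<forall>y\<in>keys (lookup f s). \<forall>j\<in>keys y. j < mmax (snd s) \<longrightarrow> (\<exists>i\<in>set (fst s). j \<le> i))"

lemma reduced_add: "reduced f \<Longrightarrow> reduced g \<Longrightarrow> reduced (f + g)"
proof -
  assume f: "reduced f" and g: "reduced g"
  have "y \<in> keys (lookup f s) \<or> y \<in> keys (lookup g s)" if "y \<in> keys (lookup (f + g) s)" for s y
    using that Poly_Mapping.keys_add[of "lookup f s" "lookup g s"] by (auto simp: lookup_add)
  moreover have "s \<in> keys h" if "y \<in> keys (lookup h s)" for h :: "symb \<Rightarrow>\<^sub>0 'k zpoly" and s y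
    using that by (auto simp: in_keys_iff)
  ultimately show ?thesis using f g unfolding reduced_def by blast
qed

text \<open>The factor \<open>N\<close> makes a drop of \<open>wt u\<close> by 1 outweigh the
  variable z_max(u), of weight at most \<open>N\<close>, that an exchange moves into the
  coefficient.\<close>

lemma exch_wt:
  assumes "u \<in> G" "1 \<le> i" "i < mmax u"
  shows "N * wt (exch i u) + mmax u \<le> N * wt u"
proof -
  have "wt (exch i u) + mmax u = i + wt u"
    using arg_cong[OF exch_props(2)[OF assms], of wt] by (simp add: wt_add)
  hence "N * Suc (wt (exch i u)) \<le> N * wt u" using assms by (intro mult_le_mono2) simp
  moreover have "mmax u \<le> N" using G_mmax(2)[OF assms(1)] by simp
  ultimately show ?thesis by simp
qed

text \<open>For a term y e(\<sigma>;u) that is not reduced, take z_j dividing y with j < max(u)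
  beyond \<sigma>. Up to sign it is one term of the boundary of (y / z_j) e(\<tau>;u), where \<tau>
  is \<sigma> followed by j; all other terms have smaller \<open>N * wt u + wt y\<close>, and
  induction applies to them.\<close>

lemma boundary_plus_reduced:
  assumes "f \<in> EK q"
  shows "\<exists>g\<in>EK (Suc q). \<exists>h\<in>EK q. reduced h \<and> f = ek_diff I g + h"
proof -
  let ?P = "\<lambda>f. \<exists>g\<in>EK (Suc q). \<exists>h\<in>EK q. reduced h \<and> f = ek_diff I g + h"
  have P0: "?P 0" by (intro bexI[of _ 0]) (auto simp: ek_diff_def reduced_def)
  have P_add: "?P (f + f')" if f: "?P f" and f': "?P f'" for f f'
  proof -
    from f obtain g h where 1: "g \<in> EK (Suc q)" "h \<in> EK q" "reduced h"
      "f = ek_diff I g + h" by blast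
    from f' obtain g' h' where 2: "g' \<in> EK (Suc q)" "h' \<in> EK q" "reduced h'"
      "f' = ek_diff I g' + h'" by blast
    have "f + f' = ek_diff I (g + g') + (h + h')"
      unfolding 1 2 ek_diff_def lin_ext_add by (simp add: add_ac)
    thus ?thesis using 1 2 fmod_add reduced_add by blast
  qed
  have P_sum: "?P (sum F A)" if "\<And>x. x \<in> A \<Longrightarrow> ?P (F x)" for F :: "'x \<Rightarrow> _" and A
    using that
  proof (induction A rule: infinite_finite_induct)
    case (insert x A)
    thus ?case using P_add[of "F x" "sum F A"] by simp
  qed (use P0 in auto)
  have P_single: "?P (single (\<sigma>, u) (single y c))"
    if "(\<sigma>, u) \<in> ek_basis I q" "keys y \<subseteq> {1..N}" for \<sigma> u y c
    using that
  proof (induction "N * wt u + wt y" arbitrary: \<sigma> u y c rule: less_induct)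
    case less
    have u: "u \<in> G" using less by (simp add: ek_basis_iff)
    show ?case
    proof (cases "reduced (single (\<sigma>, u) (single y c))")
      case True
      thus ?thesis using less(2,3)
        by (intro bexI[of _ 0] bexI[of _ "single (\<sigma>, u) (single y c)"] conjI fmod_single polys_single)
          (auto simp: ek_diff_def)
    next
      case False
      then obtain j where j: "j \<in> keys y" "j < mmax u" "\<And>i. i \<in> set \<sigma> \<Longrightarrow> i < j"
        by (auto simp: reduced_def not_le split: if_splits)
      define \<tau> where "\<tau> = \<sigma> @ [j]"
      define z where "z = y - zexp j"
      have y: "y = z + zexp j"
        using zexp_add_diff[OF j(1)] by (simp add: z_def add.commute)
      have j_pos: "j \<in> {1..N}" using j less(3) by blast
      have kz: "keys z \<subseteq> {1..N}" using less(3) y by (auto simp: keys_add_monom)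
      have \<tau>: "(\<tau>, u) \<in> ek_basis I (Suc q)"
        using less(2) j j_pos by (auto simp: ek_basis_iff \<tau>_def sorted_wrt_append)
      have len: "length \<tau> = Suc q" "length \<sigma> = q" using less(2) by (auto simp: \<tau>_def ek_basis_iff)
      let ?T1 = "\<lambda>c r. single (del r \<tau>, u) (single (z + zexp (\<tau> ! (r - 1))) ((- 1) ^ r * c)) :: symb \<Rightarrow>\<^sub>0 'k zpoly"
      let ?T2 = "\<lambda>c r. single (del r \<tau>, exch (\<tau> ! (r - 1)) u) (single (z + zexp (mmax u)) ((- 1) ^ r * c)) :: symb \<Rightarrow>\<^sub>0 'k zpoly"
      \<comment> \<open>The term that removes the last entry of \<tau> carries the sign (-1)^(q+1),
        which this factor undoes.\<close>
      define c' where "c' = (- 1) ^ Suc q * c"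
      \<comment> \<open>Here z_j is traded for a variable with index in \<sigma>, hence of smaller
        index.\<close>
      have P1: "?P (?T1 (- c') r)" if r: "r \<in> {1..q}" for r
      proof (rule less(1))
        have "\<tau> ! (r - 1) = \<sigma> ! (r - 1)" using r len by (auto simp: \<tau>_def nth_append)
        moreover have "\<sigma> ! (r - 1) \<in> set \<sigma>" using r len by auto
        ultimately show "N * wt u + wt (z + zexp (\<tau> ! (r - 1))) < N * wt u + wt y"
          using j(3) by (simp add: y wt_add)
        show "(del r \<tau>, u) \<in> ek_basis I q" using ek_basis_del[OF \<tau>, of r] r by simp
        show "keys (z + zexp (\<tau> ! (r - 1))) \<subseteq> {1..N}"
          using kz ek_basis_nth(3)[OF \<tau>, of r] r by (auto simp: keys_add_monom)
      qed
      \<comment> \<open>By \<open>exch_wt\<close> the exchange pays for the new factor z_max(u); the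
        loss of z_j makes the inequality strict.\<close>
      have P2: "?P (?T2 c' r)" if r: "r \<in> adm \<tau> u" for r
      proof (rule less(1))
        have r': "r \<in> {1..Suc q}" using r by (auto simp: adm_def len)
        show "N * wt (exch (\<tau> ! (r - 1)) u) + wt (z + zexp (mmax u)) < N * wt u + wt y"
          using exch_wt[OF u ek_basis_nth(1,2)[OF \<tau> r']] j_pos by (simp add: y wt_add)
        show "(del r \<tau>, exch (\<tau> ! (r - 1)) u) \<in> ek_basis I q" using r by (simp add: adm_def len)
        show "keys (z + zexp (mmax u)) \<subseteq> {1..N}" using kz G_mmax(2)[OF u] by (auto simp: keys_add_monom)
      qed
      have lead: "?T1 c' (Suc q) = single (\<sigma>, u) (single y c)"
      proof -
        have "del (Suc q) \<tau> = \<sigma>" using del_last[of \<tau>] len by (simp add: \<tau>_def)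
        moreover have "\<tau> ! (Suc q - 1) = j" using len by (simp add: \<tau>_def nth_append)
        moreover have "(- 1) ^ Suc q * c' = c" by (simp add: c'_def flip: mult.assoc power_mult_distrib)
        ultimately show ?thesis by (simp only: y)
      qed
      have "ek_diff I (single (\<tau>, u) (single z c')) =
          (\<Sum>r\<in>{1..Suc q}. ?T1 c' r) - (\<Sum>r\<in>adm \<tau> u. ?T2 c' r)"
        unfolding ek_diff_def lin_ext_single scale_ek_diff_symb[OF \<tau>] ..
      also have "(\<Sum>r\<in>{1..Suc q}. ?T1 c' r) = (\<Sum>r\<in>{1..q}. ?T1 c' r) + single (\<sigma>, u) (single y c)"
        unfolding lead[symmetric] by simp
      finally have "single (\<sigma>, u) (single y c) = ek_diff I (single (\<tau>, u) (single z c')) +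
          ((\<Sum>r\<in>{1..q}. ?T1 (- c') r) + (\<Sum>r\<in>adm \<tau> u. ?T2 c' r))"
        by (simp add: single_uminus sum_negf)
      moreover have "?P (ek_diff I (single (\<tau>, u) (single z c')))"
        using \<tau> kz by (intro bexI[of _ "single (\<tau>, u) (single z c')"] bexI[of _ 0] fmod_single polys_single)
          (auto simp: reduced_def)
      ultimately show ?thesis
        using P_add P_sum[of "{1..q}", OF P1] P_sum[of "adm \<tau> u", OF P2] by presburger
    qed
  qed
  have "?P (\<Sum>s\<in>keys f. \<Sum>y\<in>keys (lookup f s). single s (single y (lookup (lookup f s) y)))"
  proof (intro P_sum)
    fix s y assume s: "s \<in> keys f" "y \<in> keys (lookup f s)"
    obtain \<sigma> u where su: "s = (\<sigma>, u)" by (cases s)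
    have "(\<sigma>, u) \<in> ek_basis I q" "keys y \<subseteq> {1..N}" using s su assms by (auto simp: fmod_def polys_def)
    thus "?P (single s (single y (lookup (lookup f s) y)))" unfolding su by (rule P_single)
  qed
  thus ?thesis using fmod_eq_sum_terms[of f] by simp
qed


text \<open>For a p with the largest \<open>\<mu>\<close> the leading position z receives nothing
  from other members of \<open>S\<close>, so the sum at z cannot vanish.\<close>

lemma distinct_leading_terms:
  fixes a :: "'p \<Rightarrow> 'z \<Rightarrow> 'c::comm_monoid_add" and \<mu> :: "'p \<Rightarrow> nat"
  assumes fin: "finite S" and zero: "\<And>z. (\<Sum>p\<in>S. a p z) = 0"
    and lead: "\<And>p. p \<in> S \<Longrightarrow> \<exists>z. a p z \<noteq> 0 \<and> (\<forall>p'\<in>S. \<mu> p' \<le> \<mu> p \<longrightarrow> a p' z \<noteq> 0 \<longrightarrow> p' = p)"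
  shows "S = {}"
proof (rule ccontr)
  assume "S \<noteq> {}"
  hence "Max (\<mu> ` S) \<in> \<mu> ` S" using fin by (intro Max_in) auto
  then obtain p where "p \<in> S" "\<mu> p = Max (\<mu> ` S)" by auto
  hence p: "p \<in> S" "\<And>p'. p' \<in> S \<Longrightarrow> \<mu> p' \<le> \<mu> p" using fin by auto
  obtain z where z: "a p z \<noteq> 0" "\<And>p'. p' \<in> S \<Longrightarrow> a p' z \<noteq> 0 \<Longrightarrow> p' = p"
    using lead[OF p(1)] p(2) by blast
  have "(\<Sum>p'\<in>S. a p' z) = (\<Sum>p'\<in>{p}. a p' z)"
    using fin p(1) z(2) by (intro sum.mono_neutral_right) auto
  thus False using z(1) zero[of z] by simp
qed

lemma lookup_when: "lookup (f when b) x = (lookup f x when b)"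
  by (simp add: when_def)

lemma keys_lookup_subset_fmod:
  assumes "h \<in> EK q" "s \<in> keys h" "y \<in> keys (lookup h s)"
  shows "s \<in> ek_basis I q" "keys y \<subseteq> {1..N}"
  using assms unfolding fmod_def polys_def by blast+

text \<open>The leading term in the boundary of y e(\<sigma>;u) is the one that removes the last
  entry of \<sigma>; different reduced terms have different leading terms, and all other terms of a
  boundary are smaller.\<close>

lemma reduced_ek_diff_0:
  assumes h: "h \<in> EK (Suc q)" "reduced h" and "ek_diff I h = 0"
  shows "h = 0"
proof -
  define S where "S = Sigma (keys h) (\<lambda>s. keys (lookup h s))"
  define c where "c p = lookup (lookup h (fst p)) (snd p)" for p
  define F where "F p = scale (single (snd p) (c p)) (ek_diff_symb I (fst p))" for p
  \<comment> \<open>The value of the measure \<open>N * wt u + wt y\<close> at the leading term,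
    whose coefficient is y times the variable of the last entry of \<sigma>.\<close>
  define \<mu> where "\<mu> p = N * wt (snd (fst p)) + wt (snd p) + last (fst (fst p))" for p :: "symb \<times> monom"
  have fin: "finite S" by (simp add: S_def)
  have "ek_diff I h = lin_ext (ek_diff_symb I)
      (\<Sum>s\<in>keys h. \<Sum>y\<in>keys (lookup h s). single s (single y (lookup (lookup h s) y)))"
    unfolding ek_diff_def using fmod_eq_sum_terms[of h] by simp
  also have "\<dots> = (\<Sum>s\<in>keys h. \<Sum>y\<in>keys (lookup h s). F (s, y))"
    by (simp add: lin_ext_sum F_def c_def)
  also have "\<dots> = (\<Sum>p\<in>S. F p)"
    unfolding S_def by (subst sum.Sigma) auto
  finally have sum: "ek_diff I h = (\<Sum>p\<in>S. F p)" .
  have basis: "(\<sigma>, u) \<in> ek_basis I (Suc q)" "c ((\<sigma>, u), y) \<noteq> 0"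
    "\<And>j. j \<in> keys y \<Longrightarrow> j < mmax u \<Longrightarrow> \<exists>i\<in>set \<sigma>. j \<le> i" if "((\<sigma>, u), y) \<in> S" for \<sigma> u y
  proof -
    have 1: "(\<sigma>, u) \<in> keys h" "y \<in> keys (lookup h (\<sigma>, u))" using that by (auto simp: S_def)
    thus "(\<sigma>, u) \<in> ek_basis I (Suc q)" by (rule keys_lookup_subset_fmod(1)[OF h(1)])
    show "c ((\<sigma>, u), y) \<noteq> 0" using 1(2) by (simp add: c_def in_keys_iff)
    show "\<exists>i\<in>set \<sigma>. j \<le> i" if "j \<in> keys y" "j < mmax u" for j
      using h(2) 1 that unfolding reduced_def by force
  qed
  have last: "\<sigma> ! (Suc q - 1) = last \<sigma>" "i \<in> set \<sigma> \<Longrightarrow> i \<le> last \<sigma>" "r \<in> {1..q} \<Longrightarrow> \<sigma> ! (r - 1) < last \<sigma>"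
    "1 \<le> last \<sigma>" "last \<sigma> < mmax u" "\<sigma> = butlast \<sigma> @ [last \<sigma>]" "del (Suc q) \<sigma> = butlast \<sigma>"
    if "(\<sigma>, u) \<in> ek_basis I (Suc q)" for \<sigma> u i r
  proof -
    have l: "length \<sigma> = Suc q" "sorted_wrt (<) \<sigma>" using that by (auto simp: ek_basis_iff)
    hence "\<sigma> \<noteq> []" by auto
    thus "\<sigma> = butlast \<sigma> @ [last \<sigma>]" by (rule append_butlast_last_id[symmetric])
    show 1: "\<sigma> ! (Suc q - 1) = last \<sigma>" using \<open>\<sigma> \<noteq> []\<close> l by (simp add: last_conv_nth)
    show 2: "\<sigma> ! (r - 1) < last \<sigma>" if "r \<in> {1..q}" for r
      using sorted_wrt_nth_less[OF l(2), of "r - 1" q] l(1) that 1 by auto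
    show "i \<le> last \<sigma>" if i: "i \<in> set \<sigma>" for i
    proof -
      obtain k where k: "k < Suc q" "i = \<sigma> ! k" using i l(1) by (auto simp: in_set_conv_nth)
      thus ?thesis using 1 2[of "Suc k"] by (cases "k = q") auto
    qed
    show "1 \<le> last \<sigma>" "last \<sigma> < mmax u" using that \<open>\<sigma> \<noteq> []\<close> by (auto simp: ek_basis_iff)
    show "del (Suc q) \<sigma> = butlast \<sigma>" using del_last[of \<sigma>] l by simp
  qed
  have F_eq: "lookup (lookup (F ((\<sigma>, u), y)) s') y' =
      (\<Sum>r\<in>{1..Suc q}. ((- 1) ^ r * c ((\<sigma>, u), y) when y + zexp (\<sigma> ! (r - 1)) = y') when (del r \<sigma>, u) = s') -
      (\<Sum>r\<in>adm \<sigma> u. ((- 1) ^ r * c ((\<sigma>, u), y) when y + zexp (mmax u) = y') when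
        (del r \<sigma>, exch (\<sigma> ! (r - 1)) u) = s')"
    if "((\<sigma>, u), y) \<in> S" for \<sigma> u y s' y'
    unfolding F_def fst_conv snd_conv scale_ek_diff_symb[OF basis(1)[OF that]]
    by (simp only: lookup_minus lookup_sum lookup_single lookup_when)
  have "S = {}"
  proof (rule distinct_leading_terms[OF fin, where a = "\<lambda>p z. lookup (lookup (F p) (fst z)) (snd z)"])
    show "(\<Sum>p\<in>S. lookup (lookup (F p) (fst z)) (snd z)) = 0" for z
      using arg_cong[OF sum, of "\<lambda>h. lookup (lookup h (fst z)) (snd z)"] \<open>ek_diff I h = 0\<close>
      by (simp add: lookup_sum)
  next
    fix p0 assume p0: "p0 \<in> S"
    obtain \<sigma>0 u0 y0 where eq: "p0 = ((\<sigma>0, u0), y0)" by (metis prod.exhaust)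
    note p0 = p0[unfolded eq]
    note b0 = basis[OF p0]
    let ?s = "(butlast \<sigma>0, u0)" and ?y = "y0 + zexp (last \<sigma>0)"
    have first: "((\<sigma>, u), y) = ((\<sigma>0, u0), y0) \<and> r = Suc q"
      if p: "((\<sigma>, u), y) \<in> S" and \<mu>: "\<mu> ((\<sigma>, u), y) \<le> \<mu> ((\<sigma>0, u0), y0)" and r: "r \<in> {1..Suc q}"
        and e: "(del r \<sigma>, u) = ?s" "y + zexp (\<sigma> ! (r - 1)) = ?y" for \<sigma> u y r
    proof -
      note b = basis[OF p]
      have "wt y + \<sigma> ! (r - 1) = wt y0 + last \<sigma>0"
        using arg_cong[OF e(2), of wt] by (simp add: wt_add)
      hence "last \<sigma> \<le> \<sigma> ! (r - 1)" using \<mu> e(1) by (simp add: \<mu>_def)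
      hence r_eq: "r = Suc q" using last(3)[OF b(1), of r] r by (cases "r = Suc q") auto
      have but: "butlast \<sigma> = butlast \<sigma>0" using e(1) last(7)[OF b(1)] r_eq by simp
      have y: "y + zexp (last \<sigma>) = y0 + zexp (last \<sigma>0)" using e(2) r_eq last(1)[OF b(1)] by simp
      \<comment> \<open>If the last entries differ, the variable of the larger one divides the
        coefficient of the other term, has index below max(u) and lies beyond the list of that term,
        contrary to reducedness.\<close>
      have "last \<sigma> = last \<sigma>0"
      proof (rule linorder_cases)
        assume lt: "last \<sigma> < last \<sigma>0"
        hence "last \<sigma>0 \<in> keys y"
          using arg_cong[OF y, of "\<lambda>w. lookup w (last \<sigma>0)"] by (simp add: lookup_add lookup_zexp in_keys_iff)
        then obtain i where "i \<in> set \<sigma>" "last \<sigma>0 \<le> i" using b(3) last(5)[OF b0(1)] e(1) by auto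
        thus ?thesis using last(2)[OF b(1)] lt by fastforce
      next
        assume lt: "last \<sigma>0 < last \<sigma>"
        hence "last \<sigma> \<in> keys y0"
          using arg_cong[OF y, of "\<lambda>w. lookup w (last \<sigma>)"] by (simp add: lookup_add lookup_zexp in_keys_iff)
        then obtain i where "i \<in> set \<sigma>0" "last \<sigma> \<le> i" using b0(3) last(5)[OF b(1)] e(1) by auto
        thus ?thesis using last(2)[OF b0(1)] lt by fastforce
      qed
      thus ?thesis using but y e(1) r_eq last(6)[OF b(1)] last(6)[OF b0(1)] by (metis Pair_inject add_right_cancel)
    qed
    \<comment> \<open>Terms of the second sum have measure at most \<open>N * wt u + wt y\<close>,
      which is below \<open>\<mu>\<close> because the last entry of \<sigma> is at least 1.\<close>
    have second: False
      if p: "((\<sigma>, u), y) \<in> S" and \<mu>: "\<mu> ((\<sigma>, u), y) \<le> \<mu> ((\<sigma>0, u0), y0)" and r: "r \<in> adm \<sigma> u"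
        and e: "(del r \<sigma>, exch (\<sigma> ! (r - 1)) u) = ?s" "y + zexp (mmax u) = ?y" for \<sigma> u y r
    proof -
      note b = basis(1)[OF p]
      have u: "u \<in> G" "r \<in> {1..Suc q}" using b r by (auto simp: ek_basis_iff adm_def)
      have "wt y + mmax u = wt y0 + last \<sigma>0" using arg_cong[OF e(2), of wt] by (simp add: wt_add)
      moreover have "N * wt u0 + mmax u \<le> N * wt u"
        using exch_wt[OF u(1) ek_basis_nth(1,2)[OF b u(2)]] e(1) by simp
      ultimately show False using \<mu> last(4)[OF b] by (simp add: \<mu>_def)
    qed
    have F0: "lookup (lookup (F p') ?s) ?y =
        (\<Sum>r\<in>{1..Suc q}. if p' = ((\<sigma>0, u0), y0) \<and> r = Suc q then (- 1) ^ r * c ((\<sigma>0, u0), y0) else 0)"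
      if p': "p' \<in> S" "\<mu> p' \<le> \<mu> ((\<sigma>0, u0), y0)" for p'
    proof -
      obtain \<sigma> u y where p: "p' = ((\<sigma>, u), y)" by (metis prod.exhaust)
      note p' = p'[unfolded p]
      have "(\<Sum>r\<in>adm \<sigma> u. ((- 1) ^ r * c ((\<sigma>, u), y) when y + zexp (mmax u) = ?y) when
        (del r \<sigma>, exch (\<sigma> ! (r - 1)) u) = ?s) = 0"
        using second[OF p'] by (intro sum.neutral ballI) (auto simp: when_def)
      moreover have "(\<Sum>r\<in>{1..Suc q}. ((- 1) ^ r * c ((\<sigma>, u), y) when y + zexp (\<sigma> ! (r - 1)) = ?y) when (del r \<sigma>, u) = ?s) =
        (\<Sum>r\<in>{1..Suc q}. if ((\<sigma>, u), y) = ((\<sigma>0, u0), y0) \<and> r = Suc q then (- 1) ^ r * c ((\<sigma>0, u0), y0) else 0)"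
      proof (rule sum.cong[OF refl])
        fix r assume r: "r \<in> {1..Suc q}"
        show "(((- 1) ^ r * c ((\<sigma>, u), y) when y + zexp (\<sigma> ! (r - 1)) = ?y) when (del r \<sigma>, u) = ?s) =
          (if ((\<sigma>, u), y) = ((\<sigma>0, u0), y0) \<and> r = Suc q then (- 1) ^ r * c ((\<sigma>0, u0), y0) else 0)"
        proof (cases "(del r \<sigma>, u) = ?s \<and> y + zexp (\<sigma> ! (r - 1)) = ?y")
          case True
          hence e: "((\<sigma>, u), y) = ((\<sigma>0, u0), y0) \<and> r = Suc q" using first[OF p' r] by blast
          show ?thesis
            unfolding if_P[OF e] when_def using True e by (simp only: refl if_True)
        next
          case False
          have ne: "\<not> (((\<sigma>, u), y) = ((\<sigma>0, u0), y0) \<and> r = Suc q)"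
          proof
            assume e: "((\<sigma>, u), y) = ((\<sigma>0, u0), y0) \<and> r = Suc q"
            have "(del (Suc q) \<sigma>0, u0) = ?s \<and> y0 + zexp (\<sigma>0 ! (Suc q - 1)) = ?y"
              unfolding last(1,7)[OF b0(1)] by simp
            thus False using False e by (simp only: prod.inject refl simp_thms)
          qed
          show ?thesis unfolding if_not_P[OF ne] when_def using False by argo
        qed
      qed
      ultimately show ?thesis unfolding F_eq[OF p'(1)] p by simp
    qed
    have "lookup (lookup (F p0) ?s) ?y = (- 1) ^ Suc q * c ((\<sigma>0, u0), y0)"
      using F0[of p0] p0 eq by simp
    hence "lookup (lookup (F p0) ?s) ?y \<noteq> 0" using b0(2) by simp
    moreover have "\<forall>p'\<in>S. \<mu> p' \<le> \<mu> p0 \<longrightarrow> lookup (lookup (F p') ?s) ?y \<noteq> 0 \<longrightarrow> p' = p0"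
    proof (intro ballI impI)
      fix p' assume p': "p' \<in> S" "\<mu> p' \<le> \<mu> p0" and ne: "lookup (lookup (F p') ?s) ?y \<noteq> 0"
      show "p' = p0"
      proof (rule ccontr)
        assume "p' \<noteq> p0"
        thus False using F0[OF p'(1)] p'(2) ne eq by simp
      qed
    qed
    ultimately show "\<exists>z. lookup (lookup (F p0) (fst z)) (snd z) \<noteq> 0 \<and>
      (\<forall>p'\<in>S. \<mu> p' \<le> \<mu> p0 \<longrightarrow> lookup (lookup (F p') (fst z)) (snd z) \<noteq> 0 \<longrightarrow> p' = p0)"
      by (intro exI[of _ "(?s, ?y)"]) simp
  qed
  hence "\<forall>s\<in>keys h. lookup h s = 0" by (simp add: S_def Sigma_empty_iff)
  thus "h = 0" by (intro poly_mapping_eqI) (auto simp: in_keys_iff)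
qed

text \<open>For empty \<sigma>, reduced means y = 1 or max(u) \<le> min(y), so the monomials y u are
  distinct by uniqueness of the decomposition; the constant \<open>\<mu>\<close> says that all of
  them are leading terms.\<close>

lemma reduced_ek_aug_0:
  assumes h: "h \<in> EK 0" "reduced h" and "ek_aug h = 0"
  shows "h = 0"
proof -
  define S where "S = Sigma (keys h) (\<lambda>s. keys (lookup h s))"
  define F where "F p = single (snd p + snd (fst p)) (lookup (lookup h (fst p)) (snd p))"
    for p :: "symb \<times> monom"
  have fin: "finite S" by (simp add: S_def)
  have S: "fst (fst p) = []" "snd (fst p) \<in> G" "lookup (lookup h (fst p)) (snd p) \<noteq> 0"
    "snd p = 0 \<or> mmax (snd (fst p)) \<le> mmin (snd p)" if "p \<in> S" for p
  proof -
    obtain \<sigma> u y where p: "p = ((\<sigma>, u), y)" by (metis prod.exhaust)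
    have 1: "(\<sigma>, u) \<in> keys h" "y \<in> keys (lookup h (\<sigma>, u))" using that by (auto simp: S_def p)
    have 2: "\<sigma> = []" "u \<in> G" using keys_lookup_subset_fmod(1)[OF h(1) 1] by (auto simp: ek_basis_iff)
    hence "\<not> j < mmax u" if "j \<in> keys y" for j
      using h(2) 1 that unfolding reduced_def by force
    moreover have "mmin y \<in> keys y" if "y \<noteq> 0"
      using that unfolding mmin_def by (intro Min_in) auto
    ultimately have "y = 0 \<or> mmax u \<le> mmin y" by (auto simp: not_less)
    thus "fst (fst p) = []" "snd (fst p) \<in> G" "lookup (lookup h (fst p)) (snd p) \<noteq> 0"
      "snd p = 0 \<or> mmax (snd (fst p)) \<le> mmin (snd p)"
      using 1 2 by (auto simp: p in_keys_iff)
  qed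
  have "lookup h s * mon (snd s) = (\<Sum>y\<in>keys (lookup h s). single (y + snd s) (lookup (lookup h s) y))" for s
    by (subst poly_mapping_sum_single[of "lookup h s"])
      (simp add: sum_distrib_right mon_def mult_single)
  hence "ek_aug h = (\<Sum>s\<in>keys h. \<Sum>y\<in>keys (lookup h s). F (s, y))"
    by (simp add: ek_aug_def F_def)
  also have "\<dots> = (\<Sum>p\<in>S. F p)"
    unfolding S_def by (subst sum.Sigma) auto
  finally have sum: "(\<Sum>p\<in>S. F p) = 0" using \<open>ek_aug h = 0\<close> by simp
  have "S = {}"
  proof (rule distinct_leading_terms[OF fin, where a = "\<lambda>p. lookup (F p)" and \<mu> = "\<lambda>_. 0"])
    show "(\<Sum>p\<in>S. lookup (F p) z) = 0" for z using sum by (simp flip: lookup_sum)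
  next
    fix p assume p: "p \<in> S"
    have "p' = p" if p': "p' \<in> S" "snd p' + snd (fst p') = snd p + snd (fst p)" for p'
    proof -
      have "snd (fst p') = snd (fst p)"
        using decomposition_unique[OF S(2,4)[OF p'(1)] S(2,4)[OF p]] p'(2) by (simp add: add.commute)
      thus ?thesis using p'(2) S(1)[OF p] S(1)[OF p'(1)] by (auto intro!: prod_eqI)
    qed
    thus "\<exists>z. lookup (F p) z \<noteq> 0 \<and> (\<forall>p'\<in>S. (0::nat) \<le> 0 \<longrightarrow> lookup (F p') z \<noteq> 0 \<longrightarrow> p' = p)"
      using S(3)[OF p] by (intro exI[of _ "snd p + snd (fst p)"]) (auto simp: F_def lookup_single when_def split: if_splits)
  qed
  hence "\<forall>s\<in>keys h. lookup h s = 0" by (simp add: S_def Sigma_empty_iff)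
  thus "h = 0" by (intro poly_mapping_eqI) (auto simp: in_keys_iff)
qed

end

section \<open>Divided differences of monomials\<close>

text \<open>In the following \<open>y\<^sub>1, y\<^sub>2, \<dots>\<close> is a second family of indeterminates, and a polynomial in these
  has coefficients that are polynomials in \<open>z\<^sub>1, z\<^sub>2, \<dots>\<close>.\<close>

type_synonym 'k ypoly = "monom \<Rightarrow>\<^sub>0 'k zpoly"

definition cst :: "'k::field zpoly \<Rightarrow> 'k ypoly" where
  "cst p = single 0 p"

definition yvar :: "nat \<Rightarrow> 'k::field ypoly" where
  "yvar i = single (zexp i) 1"

lemma cst_add: "cst (p + q) = cst p + cst q"
  by (simp add: cst_def single_add)

lemma cst_mult: "cst (p * q) = cst p * cst q"
  by (simp add: cst_def mult_single)

lemma cst_0 [simp]: "cst 0 = 0"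
  by (simp add: cst_def)

lemma cst_1 [simp]: "cst 1 = 1"
  by (simp add: cst_def)

lemma cst_sign: "cst ((- 1) ^ r * p) = (- 1) ^ r * cst p"
  by (simp add: minus_one_power_iff cst_def single_uminus)

lift_definition mrestrict :: "nat set \<Rightarrow> monom \<Rightarrow> monom" is "\<lambda>A u i. if i \<in> A then u i else 0"
  by (rule finite_subset) auto

lemma lookup_mrestrict: "lookup (mrestrict A u) i = (if i \<in> A then lookup u i else 0)"
  by transfer simp

text \<open>With e the exponent of z_m in \<open>u\<close>, this is (z_m^e - y_m^e) / (z_m - y_m)
  times the part of \<open>u\<close> below m in the y and the part above m in the z. Placing the y
  below m bounds the indices of the y by m.\<close>

definition divdiff :: "nat \<Rightarrow> monom \<Rightarrow> 'k::field ypoly" where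
  "divdiff m u = (\<Sum>j<lookup u m. single (mrestrict {..<m} u + single m j)
    (mon (single m (lookup u m - 1 - j) + mrestrict {m<..} u)))"

text \<open>\<open>mixed m u\<close> arises from \<open>u(z)\<close> by substituting \<open>y\<^sub>i\<close> for \<open>z\<^sub>i\<close> for all \<open>i < m\<close>.\<close>

definition mixed :: "nat \<Rightarrow> monom \<Rightarrow> 'k::field ypoly" where
  "mixed m u = single (mrestrict {..<m} u) (mon (mrestrict {m..} u))"

lemma yvar_mult_single: "yvar i * single a p = single (a + zexp i) p"
  by (simp add: yvar_def mult_single add.commute)

lemma cst_zvar_mult_single: "cst (zvar i) * single a (mon b) = single a (mon (b + zexp i))"
  by (simp add: cst_def zvar_def mult_single mon_def add.commute)

lemma divdiff_diff: "(cst (zvar m) - yvar m) * divdiff m u = (mixed m u - mixed (Suc m) u :: 'k::field ypoly)"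
proof -
  let ?U = "lookup u m"
  define f where "f j = (single (mrestrict {..<m} u + single m j)
    (mon (single m (?U - j) + mrestrict {m<..} u)) :: 'k ypoly)" for j
  have "(cst (zvar m) - yvar m) * divdiff m u = (\<Sum>j<?U. f j - f (Suc j))"
    unfolding divdiff_def sum_distrib_left
  proof (rule sum.cong[OF refl])
    fix j assume j: "j \<in> {..<?U}"
    have *: "single m (?U - 1 - j) + mrestrict {m<..} u + zexp m = single m (?U - j) + mrestrict {m<..} u"
      "mrestrict {..<m} u + single m j + zexp m = mrestrict {..<m} u + single m (Suc j)"
      using j by (auto intro!: poly_mapping_eqI simp: lookup_add lookup_zexp lookup_single when_def)
    show "(cst (zvar m) - yvar m) * single (mrestrict {..<m} u + single m j)
      (mon (single m (?U - 1 - j) + mrestrict {m<..} u)) = f j - f (Suc j)"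
      unfolding left_diff_distrib yvar_mult_single cst_zvar_mult_single f_def * by simp
  qed
  also have "\<dots> = f 0 - f ?U" by (rule sum_lessThan_telescope')
  also have "f 0 = mixed m u"
  proof -
    have "single m ?U + mrestrict {m<..} u = mrestrict {m..} u"
      by (auto intro!: poly_mapping_eqI simp: lookup_add lookup_single lookup_mrestrict when_def)
    thus ?thesis by (simp add: f_def mixed_def)
  qed
  also have "f ?U = mixed (Suc m) u"
  proof -
    have "mrestrict {..<m} u + single m ?U = mrestrict {..<Suc m} u"
      by (auto intro!: poly_mapping_eqI simp: lookup_add lookup_single lookup_mrestrict when_def)
    thus ?thesis by (simp add: f_def mixed_def atLeast_Suc_greaterThan)
  qed
  finally show ?thesis .
qed

lemma divdiff_eq_0: "lookup u m = 0 \<Longrightarrow> divdiff m u = 0"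
  by (simp add: divdiff_def)

text \<open>Variables below m have been replaced by the y, those above m have not; this decides how
  a new factor z_i enters.\<close>

lemma divdiff_zexp_less:
  assumes "i < m"
  shows "divdiff m (zexp i + u) = yvar i * divdiff m u"
proof -
  have 1: "lookup (zexp i + u) m = lookup u m" using assms by (simp add: lookup_add lookup_zexp)
  have 2: "mrestrict {..<m} (zexp i + u) = mrestrict {..<m} u + zexp i"
    using assms by (auto intro!: poly_mapping_eqI simp: lookup_add lookup_zexp lookup_mrestrict)
  have 3: "mrestrict {m<..} (zexp i + u) = mrestrict {m<..} u"
    using assms by (auto intro!: poly_mapping_eqI simp: lookup_add lookup_zexp lookup_mrestrict)
  show ?thesis unfolding divdiff_def 1 2 3 sum_distrib_left yvar_mult_single by (simp add: add_ac)
qed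

lemma divdiff_zexp_greater:
  assumes "m < i"
  shows "divdiff m (zexp i + u) = cst (zvar i) * divdiff m u"
proof -
  have 1: "lookup (zexp i + u) m = lookup u m" using assms by (simp add: lookup_add lookup_zexp)
  have 2: "mrestrict {m<..} (zexp i + u) = mrestrict {m<..} u + zexp i"
    using assms by (auto intro!: poly_mapping_eqI simp: lookup_add lookup_zexp lookup_mrestrict)
  have 3: "mrestrict {..<m} (zexp i + u) = mrestrict {..<m} u"
    using assms by (auto intro!: poly_mapping_eqI simp: lookup_add lookup_zexp lookup_mrestrict)
  show ?thesis unfolding divdiff_def 1 2 3 sum_distrib_left cst_zvar_mult_single by (simp add: add_ac)
qed

text \<open>Raising the exponent e of z_m by one creates a single new summand, the one with y_m^e:
  it is \<open>u\<close> with the variables up to m replaced by the y.\<close>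

lemma divdiff_zexp_eq: "divdiff m (zexp m + u) = cst (zvar m) * divdiff m u + mixed (Suc m) u"
proof -
  let ?U = "lookup u m"
  have 1: "lookup (zexp m + u) m = Suc ?U" by (simp add: lookup_add lookup_zexp)
  have 2: "mrestrict {m<..} (zexp m + u) = mrestrict {m<..} u"
    "mrestrict {..<m} (zexp m + u) = mrestrict {..<m} u"
    by (auto intro!: poly_mapping_eqI simp: lookup_add lookup_zexp lookup_mrestrict)
  have 3: "mrestrict {..<m} u + single m ?U = mrestrict {..<Suc m} u"
    by (auto intro!: poly_mapping_eqI simp: lookup_add lookup_single lookup_mrestrict when_def)
  have "single m (?U - 1 - j) + mrestrict {m<..} u + zexp m = single m (?U - j) + mrestrict {m<..} u"
    if "j < ?U" for j
    using that by (auto intro!: poly_mapping_eqI simp: lookup_add lookup_zexp lookup_single when_def)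
  thus ?thesis unfolding divdiff_def 1 2 sum.lessThan_Suc sum_distrib_left cst_zvar_mult_single mixed_def 3
    by (intro arg_cong2[where f = "(+)"] sum.cong) (simp_all add: atLeast_Suc_greaterThan)
qed

lemma mixed_one: "0 \<notin> keys u \<Longrightarrow> mixed 1 u = cst (mon u)"
proof -
  assume "0 \<notin> keys u"
  hence "mrestrict {..<1} u = 0" "mrestrict {1..} u = u"
    by (auto intro!: poly_mapping_eqI simp: lookup_mrestrict in_keys_iff Suc_le_eq)
  thus ?thesis by (simp add: mixed_def cst_def)
qed

lemma mixed_above:
  assumes "\<And>i. i \<in> keys u \<Longrightarrow> i < m"
  shows "mixed m u = single u 1"
proof -
  have "mrestrict {..<m} u = u" "mrestrict {m..} u = 0"
    using assms by (force intro!: poly_mapping_eqI simp: lookup_mrestrict in_keys_iff)+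
  thus ?thesis by (simp add: mixed_def)
qed

text \<open>The terms y^a z^b of \<open>divdiff m u\<close> correspond to the ways of cutting
  \<open>u\<close> at one of its factors z_m.\<close>

lemma divdiff_splittings:
  assumes "j < lookup u m"
  defines "a \<equiv> mrestrict {..<m} u + single m j"
    and "b \<equiv> single m (lookup u m - 1 - j) + mrestrict {m<..} u"
  shows "u = a + zexp m + b" "keys a \<subseteq> {..m}" "keys b \<subseteq> {m..}" "keys a \<subseteq> keys u" "keys b \<subseteq> keys u"
  using assms(1) unfolding a_def b_def
  by (auto intro!: poly_mapping_eqI
      simp: lookup_add lookup_zexp lookup_single lookup_mrestrict when_def in_keys_iff split: if_splits)

text \<open>In y-degree deg(u) - 1 nothing is left for the z-part, so the cut is at the last
  variable. These coefficients tell the generators apart.\<close>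

lemma lookup_divdiff_top:
  assumes a: "mdeg a + 1 = mdeg u"
  shows "lookup (divdiff m u) a = (if m = mmax u \<and> u = a + zexp m then 1 else (0 :: 'k::field zpoly))"
proof (cases "m = mmax u \<and> u = a + zexp m")
  case True
  hence u: "u = a + zexp m" and m: "m = mmax u" by blast+
  have gt: "lookup u i = 0" if "m < i" for i
    using mmax_ge[of i u] that unfolding m by (force simp: in_keys_iff)
  have U: "lookup u m = Suc (lookup a m)" using arg_cong[OF u, of "\<lambda>w. lookup w m"] by (simp add: lookup_add lookup_zexp)
  have eq: "mrestrict {..<m} u + single m j = a \<longleftrightarrow> j = lookup a m" for j
  proof
    assume "mrestrict {..<m} u + single m j = a"
    from arg_cong[OF this, of "\<lambda>w. lookup w m"] show "j = lookup a m"
      by (simp add: lookup_add lookup_mrestrict)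
  next
    assume j: "j = lookup a m"
    have "lookup u i = lookup a i" if "i \<noteq> m" for i
      using arg_cong[OF u, of "\<lambda>w. lookup w i"] that by (simp add: lookup_add lookup_zexp)
    thus "mrestrict {..<m} u + single m j = a"
      using gt j by (intro poly_mapping_eqI) (auto simp: lookup_add lookup_mrestrict lookup_single when_def)
  qed
  have 0: "single m (lookup u m - 1 - lookup a m) + mrestrict {m<..} u = 0"
    using gt U by (intro poly_mapping_eqI) (auto simp: lookup_add lookup_mrestrict lookup_single when_def)
  have "lookup (divdiff m u) a = (\<Sum>j<lookup u m. if j = lookup a m then 1 else (0 :: 'k zpoly))"
    unfolding divdiff_def lookup_sum lookup_single when_def eq
  proof (rule sum.cong[OF refl])
    fix j
    show "(if j = lookup a m then mon (single m (lookup u m - 1 - j) + mrestrict {m<..} u) else 0) =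
      (if j = lookup a m then 1 else (0 :: 'k zpoly))" using 0 by auto
  qed
  thus ?thesis unfolding if_P[OF True] using U by simp
next
  case False
  have "(mon (single m (lookup u m - 1 - j) + mrestrict {m<..} u) when mrestrict {..<m} u + single m j = a) = (0 :: 'k zpoly)"
    if j: "j < lookup u m" for j
  proof -
    note s = divdiff_splittings[OF j]
    have False if e: "mrestrict {..<m} u + single m j = a"
    proof -
      define b where "b = single m (lookup u m - 1 - j) + mrestrict {m<..} u"
      have u: "u = a + zexp m + b" using s(1) unfolding e b_def .
      have "mdeg b = 0" using arg_cong[OF u, of mdeg] a by (simp add: mdeg_add)
      hence u: "u = a + zexp m" using u by simp
      have "keys a \<subseteq> {..m}" using s(2) unfolding e .
      hence "mmax u = m" using arg_cong[OF u, of keys] by (intro mmax_eqI) (auto simp: keys_add_monom)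
      thus False using False u by blast
    qed
    thus ?thesis by (auto simp: when_def)
  qed
  hence "lookup (divdiff m u) a = (\<Sum>j<lookup u m. 0 :: 'k zpoly)"
    unfolding divdiff_def lookup_sum lookup_single by (intro sum.cong) auto
  thus ?thesis unfolding if_not_P[OF False] by simp
qed

section \<open>The embedding into an exterior algebra\<close>

definition beyond :: "nat \<Rightarrow> nat set \<Rightarrow> nat set" where
  "beyond N S = {m \<in> {1..N}. \<forall>i\<in>S. i < m}"

text \<open>The sign brings e_m to its place: as m lies beyond \<open>S\<close>, moving it past the
  factors of e_S costs (-1)^|S|.\<close>

definition emb :: "nat \<Rightarrow> nat set \<Rightarrow> monom \<Rightarrow> 'k::field ypoly ext" where
  "emb N S u = (\<Sum>m\<in>beyond N S. esc ((- 1) ^ card S * divdiff m u) * ebasis (insert m S))"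

definition kder :: "nat \<Rightarrow> 'k::field ypoly ext \<Rightarrow> 'k ypoly ext" where
  "kder N = eder {1..N} (\<lambda>i. cst (zvar i) - yvar i)"

lemma eq_Max_iff_less:
  assumes "finite S" "(i::nat) \<in> S"
  shows "i = Max S \<longleftrightarrow> (\<forall>j\<in>S - {i}. j < i)"
proof
  assume "i = Max S"
  thus "\<forall>j\<in>S - {i}. j < i" using Max_ge[OF assms(1)] by (metis DiffE insertI1 le_neq_implies_less)
next
  assume less: "\<forall>j\<in>S - {i}. j < i"
  have "j \<le> i" if "j \<in> S" for j using less[rule_format, of j] that by (cases "j = i") auto
  thus "i = Max S" using assms by (intro Max_eqI[symmetric]) auto
qed

lemma finite_beyond [simp]: "finite (beyond N S)"
  by (simp add: beyond_def)

text \<open>\<open>beyond N S\<close> is the interval from Max S + 1 to N, so the sum telescopes;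
  for empty \<open>S\<close> the value 0 stands in for the maximum, since the variables start at
  1.\<close>

lemma sum_beyond_mixed:
  assumes "S \<subseteq> {1..N}"
  shows "(\<Sum>m\<in>beyond N S. mixed m u - mixed (Suc m) u :: 'k::field ypoly) =
    mixed (Suc (if S = {} then 0 else Max S)) u - mixed (Suc N) u"
proof -
  let ?M = "if S = {} then 0 else Max S"
  have S: "finite S" using assms finite_subset by blast
  have M: "?M \<le> N" using S assms Max_in[of S] by auto
  have above_eq: "beyond N S = {?M + 1..<Suc N}"
  proof (cases "S = {}")
    case False
    have "Max S < m \<longleftrightarrow> (\<forall>i\<in>S. i < m)" for m by (rule Max_less_iff[OF S False])
    thus ?thesis using False by (auto simp: beyond_def Suc_le_eq) (metis not_gr_zero not_less_zero)
  qed (auto simp: beyond_def)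
  have "(\<Sum>m\<in>{?M + 1..<Suc N}. mixed m u - mixed (Suc m) u :: 'k ypoly) = mixed (?M + 1) u - mixed (Suc N) u"
  proof -
    have "(\<Sum>m\<in>{a..<b}. mixed m u - mixed (Suc m) u) = (mixed a u - mixed b u :: 'k ypoly)" if "a \<le> b" for a b
      using that by (induction b rule: dec_induct) auto
    from this[of "?M + 1" "Suc N"] show ?thesis using M by (simp only: Suc_eq_plus1 add_le_cancel_right)
  qed
  thus ?thesis unfolding above_eq by simp
qed

lemma kder_ebasis_insert:
  assumes S: "S \<subseteq> {1..N}" and m: "m \<in> beyond N S"
  shows "kder N (ebasis (insert m S)) =
    esc ((- 1) ^ card S * (cst (zvar m) - yvar m)) * ebasis S +
    (\<Sum>i\<in>S. esc (pos_sign S i * (cst (zvar i) - yvar i)) * ebasis (insert m (S - {i})))"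
proof -
  have fin: "finite S" using S finite_subset by blast
  have m': "m \<notin> S" "insert m S \<subseteq> {1..N}" "\<And>i. i \<in> S \<Longrightarrow> i < m" using S m by (auto simp: beyond_def)
  have "{j \<in> insert m S. j < m} = S" using m'(3) by auto
  hence 1: "pos_sign (insert m S) m = (- 1) ^ card S" by (simp add: pos_sign_def)
  have 2: "pos_sign (insert m S) i = pos_sign S i" "insert m S - {i} = insert m (S - {i})" if "i \<in> S" for i
    using that m' fin by (auto simp: pos_sign_insert dest: m'(3))
  have 3: "insert m S - {m} = S" using m' by auto
  show ?thesis
    unfolding kder_def using m' fin
    by (subst eder_ebasis) (auto simp: 1 2 3 intro!: sum.cong)
qed

text \<open>For m < i both terms acquire the factor z_i and cancel; for m > i the factors z_i and
  y_i leave their difference; m = i leaves a correction, and i is beyond \<open>S - {i}\<close>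
  exactly when it is the maximum of \<open>S\<close>.\<close>

lemma emb_exchange_diff:
  assumes S: "S \<subseteq> {1..N}" and i: "i \<in> S"
  shows "esc (cst (zvar i)) * emb N (S - {i}) u - emb N (S - {i}) (zexp i + u) =
    (\<Sum>m\<in>beyond N S. esc ((- 1) ^ (card S - 1) * ((cst (zvar i) - yvar i) * divdiff m u)) * ebasis (insert m (S - {i}))) -
    (if i = Max S then esc ((- 1) ^ (card S - 1) * mixed (Suc i) u) * ebasis S else 0)"
proof -
  have fin: "finite S" using S finite_subset by blast
  define s where "s = ((- 1) ^ (card S - 1) :: 'a ypoly)"
  define X where "X m = cst (zvar i) * divdiff m u - (divdiff m (zexp i + u) :: 'a ypoly)" for m
  have X: "X m = (if i < m then (cst (zvar i) - yvar i) * divdiff m u else if m = i then - mixed (Suc i) u else 0)" for m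
    by (auto simp: X_def divdiff_zexp_less divdiff_zexp_greater divdiff_zexp_eq left_diff_distrib)
  have card: "card (S - {i}) = card S - 1" using i fin by simp
  let ?A = "beyond N (S - {i}) \<inter> {i}"
  have "esc (cst (zvar i)) * emb N (S - {i}) u - emb N (S - {i}) (zexp i + u) =
      (\<Sum>m\<in>beyond N (S - {i}). esc (s * X m) * ebasis (insert m (S - {i})))"
    unfolding emb_def card s_def[symmetric] sum_distrib_left X_def sum_subtractf[symmetric]
    by (simp only: right_diff_distrib esc_diff left_diff_distrib mult.left_commute[of s "cst (zvar i)"] esc_mult mult.assoc)
  also have "\<dots> = (\<Sum>m\<in>beyond N S \<union> ?A. esc (s * X m) * ebasis (insert m (S - {i})))"
  proof (rule sum.mono_neutral_right)
    show "\<forall>m\<in>beyond N (S - {i}) - (beyond N S \<union> ?A). esc (s * X m) * ebasis (insert m (S - {i})) = 0"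
      by (auto simp: beyond_def X)
  qed (auto simp: beyond_def)
  also have "\<dots> = (\<Sum>m\<in>beyond N S. esc (s * X m) * ebasis (insert m (S - {i}))) +
      (\<Sum>m\<in>?A. esc (s * X m) * ebasis (insert m (S - {i})))"
    using i by (intro sum.union_disjoint) (auto simp: beyond_def)
  also have "(\<Sum>m\<in>beyond N S. esc (s * X m) * ebasis (insert m (S - {i}))) =
      (\<Sum>m\<in>beyond N S. esc (s * ((cst (zvar i) - yvar i) * divdiff m u)) * ebasis (insert m (S - {i})))"
    using i by (intro sum.cong) (auto simp: beyond_def X)
  also have "(\<Sum>m\<in>?A. esc (s * X m) * ebasis (insert m (S - {i}))) =
      - (if i = Max S then esc (s * mixed (Suc i) u) * ebasis S else 0)"
  proof -
    have "i = Max S \<longleftrightarrow> (\<forall>j\<in>S - {i}. j < i)"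
      using fin i by (rule eq_Max_iff_less)
    hence A: "?A = (if i = Max S then {i} else {})" using i S by (auto simp: beyond_def)
    show ?thesis
    proof (cases "i = Max S")
      case True
      show ?thesis unfolding A if_P[OF True] by (simp add: X esc_uminus insert_absorb[OF i])
    next
      case False
      show ?thesis unfolding A if_not_P[OF False] by simp
    qed
  qed
  finally show ?thesis unfolding s_def by simp
qed

text \<open>The terms that remove e_m telescope to \<open>mixed\<close> at both ends of
  \<open>beyond N S\<close>. For nonempty \<open>S\<close> the lower end cancels against the
  correction in \<open>emb_exchange_diff\<close>; the upper end is u(y) for the generators. What
  remains is the Eliahou-Kervaire formula with z_i u not yet normalized.\<close>

lemma kder_emb:
  assumes S: "S \<subseteq> {1..N}"
  shows "kder N (emb N S u) =
    (\<Sum>i\<in>S. esc (- pos_sign S i) * (esc (cst (zvar i)) * emb N (S - {i}) u - emb N (S - {i}) (zexp i + u))) +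
    esc ((if S = {} then mixed 1 u else 0) - mixed (Suc N) u) * (ebasis S :: 'k::field ypoly ext)"
proof -
  have fin: "finite S" using S finite_subset by blast
  define s where "s = ((- 1) ^ card S :: 'k ypoly)"
  have ss: "s * s = 1" by (simp add: s_def flip: mult.assoc power_mult_distrib)
  let ?c = "\<lambda>i. cst (zvar i) - yvar i"
  have "kder N (emb N S u) = (\<Sum>m\<in>beyond N S. esc (s * divdiff m u) * kder N (ebasis (insert m S)))"
    by (simp add: emb_def kder_def eder_sum eder_esc_mult s_def)
  also have "\<dots> = (\<Sum>m\<in>beyond N S. esc (mixed m u - mixed (Suc m) u) * ebasis S +
      (\<Sum>i\<in>S. esc (s * pos_sign S i * (?c i * divdiff m u)) * ebasis (insert m (S - {i}))))"
  proof (rule sum.cong[OF refl])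
    fix m assume m: "m \<in> beyond N S"
    have "esc (s * divdiff m u) * (esc (s * ?c m) * ebasis S) = esc (mixed m u - mixed (Suc m) u) * ebasis S"
    proof -
      have "s * divdiff m u * (s * ?c m) = (s * s) * (?c m * divdiff m u)" by (simp only: mult_ac)
      hence "s * divdiff m u * (s * ?c m) = ?c m * divdiff m u" by (simp add: ss)
      thus ?thesis unfolding divdiff_diff by (simp only: mult.assoc[symmetric] esc_mult[symmetric])
    qed
    moreover have "esc (s * divdiff m u) * (esc (pos_sign S i * ?c i) * ebasis (insert m (S - {i}))) =
        esc (s * pos_sign S i * (?c i * divdiff m u)) * ebasis (insert m (S - {i}))" for i
    proof -
      have "s * divdiff m u * (pos_sign S i * ?c i) = s * pos_sign S i * (?c i * divdiff m u)" by (simp only: mult_ac)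
      thus ?thesis by (simp only: mult.assoc[symmetric] esc_mult[symmetric])
    qed
    ultimately show "esc (s * divdiff m u) * kder N (ebasis (insert m S)) =
        esc (mixed m u - mixed (Suc m) u) * ebasis S +
        (\<Sum>i\<in>S. esc (s * pos_sign S i * (?c i * divdiff m u)) * ebasis (insert m (S - {i})))"
      unfolding kder_ebasis_insert[OF S m] s_def[symmetric] distrib_left sum_distrib_left by simp
  qed
  also have "\<dots> = esc (mixed (Suc (if S = {} then 0 else Max S)) u - mixed (Suc N) u) * ebasis S +
      (\<Sum>i\<in>S. \<Sum>m\<in>beyond N S. esc (s * pos_sign S i * (?c i * divdiff m u)) * ebasis (insert m (S - {i})))"
    by (subst sum.swap) (simp add: sum.distrib sum_beyond_mixed[OF S] flip: sum_distrib_right esc_sum)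
  finally have L: "kder N (emb N S u) = \<dots>" .
  have R: "esc (- pos_sign S i) * (esc (cst (zvar i)) * emb N (S - {i}) u - emb N (S - {i}) (zexp i + u)) =
      (\<Sum>m\<in>beyond N S. esc (s * pos_sign S i * (?c i * divdiff m u)) * ebasis (insert m (S - {i}))) +
      (if i = Max S then esc (mixed (Suc i) u) * ebasis S else 0)" if i: "i \<in> S" for i
  proof -
    have card: "s = - ((- 1) ^ (card S - 1))"
      using i fin by (cases "card S") (auto simp: s_def)
    have "esc (- pos_sign S i) * (esc ((- 1) ^ (card S - 1) * (?c i * divdiff m u)) * ebasis (insert m (S - {i}))) =
        esc (s * pos_sign S i * (?c i * divdiff m u)) * ebasis (insert m (S - {i}))" for m
    proof -
      have "- pos_sign S i * ((- 1) ^ (card S - 1) * (?c i * divdiff m u)) = s * pos_sign S i * (?c i * divdiff m u)"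
        unfolding card by simp
      thus ?thesis by (simp only: mult.assoc[symmetric] esc_mult[symmetric])
    qed
    moreover have "esc (- pos_sign S i) * (esc ((- 1) ^ (card S - 1) * mixed (Suc i) u) * ebasis S) =
        - (esc (mixed (Suc i) u) * ebasis S :: 'k ypoly ext)" if "i = Max S"
    proof -
      have "{j \<in> S. j < i} = S - {i}" using that eq_Max_iff_less[OF fin i] by auto
      hence "pos_sign S i = ((- 1) ^ (card S - 1) :: 'k ypoly)" using i fin by (simp add: pos_sign_def)
      hence "- pos_sign S i * ((- 1) ^ (card S - 1) * mixed (Suc i) u) = (- mixed (Suc i) u :: 'k ypoly)"
        by (simp flip: mult.assoc power_mult_distrib)
      thus ?thesis by (simp only: mult.assoc[symmetric] esc_mult[symmetric] esc_uminus[symmetric] minus_mult_left)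
    qed
    ultimately show ?thesis
      unfolding emb_exchange_diff[OF S i] right_diff_distrib sum_distrib_left by simp
  qed
  have "(\<Sum>i\<in>S. if i = Max S then esc (mixed (Suc i) u) * ebasis S else (0 :: 'k ypoly ext)) =
      (if S = {} then 0 else esc (mixed (Suc (Max S)) u) * ebasis S)"
    using fin by auto
  thus ?thesis unfolding L using R by (simp add: sum.distrib left_diff_distrib esc_diff)
qed

section \<open>Truncation in the second family of indeterminates\<close>

lemma lookup_mult_nonzero:
  fixes p q :: "'a::monoid_add \<Rightarrow>\<^sub>0 'b::semiring_0"
  assumes "lookup (p * q) a \<noteq> 0"
  shows "\<exists>b c. a = b + c \<and> lookup p b \<noteq> 0 \<and> lookup q c \<noteq> 0"
  using subsetD[OF keys_mult, of a p q] assms by (auto simp: in_keys_iff)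

lemma lookup_mult_sum:
  fixes p q :: "'a::monoid_add \<Rightarrow>\<^sub>0 'b::semiring_0"
  shows "lookup (p * q) a = (\<Sum>b\<in>keys p. \<Sum>c\<in>keys q. lookup p b * lookup q c when b + c = a)"
proof -
  have "p * q = (\<Sum>b\<in>keys p. single b (lookup p b)) * (\<Sum>c\<in>keys q. single c (lookup q c))"
    by (rule arg_cong2[where f = "(*)", OF poly_mapping_sum_single poly_mapping_sum_single])
  also have "\<dots> = (\<Sum>b\<in>keys p. \<Sum>c\<in>keys q. single (b + c) (lookup p b * lookup q c))"
    by (simp only: sum_product mult_single)
  finally show ?thesis by (simp only: lookup_sum lookup_single)
qed

lemma lookup_cst_mult: "lookup (cst p * q) a = p * lookup q a"
proof -
  have "cst p * q = Poly_Mapping.map ((*) p) q" by (simp only: cst_def mult_map_scale_conv_mult)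
  thus ?thesis by (simp add: Poly_Mapping.map.rep_eq when_def)
qed

lemma lookup_sign_mult: "lookup ((- 1) ^ n * p) a = (- 1) ^ n * lookup (p :: 'a::monoid_add \<Rightarrow>\<^sub>0 'b::ring_1) a"
  by (cases "even n") simp_all

lemma lookup_ecoeff_mult_nonzero:
  assumes "lookup (ecoeff (f * g) U) a \<noteq> (0 :: 'k::field zpoly)"
  shows "finite U \<and> (\<exists>S b c. S \<subseteq> U \<and> a = b + c \<and> lookup (ecoeff f S) b \<noteq> 0 \<and> lookup (ecoeff g (U - S)) c \<noteq> 0)"
proof
  show U: "finite U" using assms by (cases "finite U") (simp_all add: ecoeff_infinite)
  have "(\<Sum>S\<in>Pow U. lookup (esign S (U - S) * ecoeff f S * ecoeff g (U - S)) a) \<noteq> 0"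
    using assms unfolding ecoeff_mult[OF U] lookup_sum .
  then obtain S where "S \<in> Pow U" and S': "lookup (esign S (U - S) * ecoeff f S * ecoeff g (U - S)) a \<noteq> 0"
    by (rule sum.not_neutral_contains_not_neutral)
  hence S: "S \<subseteq> U" by simp
  from S' have L: "lookup (ecoeff f S * ecoeff g (U - S)) a \<noteq> 0"
    unfolding esign_def mult.assoc lookup_sign_mult by (rule contrapos_nn) (simp only: mult_zero_right)
  obtain b c where "a = b + c" "lookup (ecoeff f S) b \<noteq> 0" "lookup (ecoeff g (U - S)) c \<noteq> 0"
    using lookup_mult_nonzero[OF L] by blast
  thus "\<exists>S b c. S \<subseteq> U \<and> a = b + c \<and> lookup (ecoeff f S) b \<noteq> 0 \<and> lookup (ecoeff g (U - S)) c \<noteq> 0"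
    using S by blast
qed

text \<open>Represents being 0 in C: all coefficients lie in the ideal (y)^t. Congruence is this
  predicate applied to a difference.\<close>

definition low_zero :: "nat \<Rightarrow> 'k::field ypoly ext \<Rightarrow> bool" where
  "low_zero t f \<longleftrightarrow> (\<forall>S a. mdeg a < t \<longrightarrow> lookup (ecoeff f S) a = 0)"

lemma low_zero_0 [simp]: "low_zero t 0"
  by (simp add: low_zero_def)

lemma low_zero_add: "low_zero t f \<Longrightarrow> low_zero t g \<Longrightarrow> low_zero t (f + g)"
  by (simp add: low_zero_def lookup_add)

lemma low_zero_uminus: "low_zero t f \<Longrightarrow> low_zero t (- f)"
  by (simp add: low_zero_def)

lemma low_zero_sum: "(\<And>x. x \<in> A \<Longrightarrow> low_zero t (f x)) \<Longrightarrow> low_zero t (sum f A)"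
  by (induction A rule: infinite_finite_induct) (auto intro: low_zero_add)

lemma low_zero_esc: "(\<And>a. mdeg a < t \<Longrightarrow> lookup p a = 0) \<Longrightarrow> low_zero t (esc p)"
  by (simp add: low_zero_def esc.rep_eq)

lemma low_zero_mult: "low_zero t f \<or> low_zero t g \<Longrightarrow> low_zero t (f * g)"
  unfolding low_zero_def
proof (intro allI impI, rule ccontr)
  fix U a
  assume z: "(\<forall>S a. mdeg a < t \<longrightarrow> lookup (ecoeff f S) a = 0) \<or> (\<forall>S a. mdeg a < t \<longrightarrow> lookup (ecoeff g S) a = 0)"
    and a: "mdeg a < t" and ne: "lookup (ecoeff (f * g) U) a \<noteq> 0"
  from lookup_ecoeff_mult_nonzero[OF ne] obtain S b c where
    "a = b + c" "lookup (ecoeff f S) b \<noteq> 0" "lookup (ecoeff g (U - S)) c \<noteq> 0" by blast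
  moreover from this have "mdeg b < t" "mdeg c < t" using a by (auto simp: mdeg_add)
  ultimately show False using z by blast
qed

lemma low_zero_kder:
  assumes "low_zero t f"
  shows "low_zero t (kder N f)"
  unfolding low_zero_def
proof (intro allI impI, rule ccontr)
  fix U a assume a: "mdeg a < t" and ne: "lookup (ecoeff (kder N f) U) a \<noteq> 0"
  have U: "finite U" using ne by (cases "finite U") (simp_all add: ecoeff_infinite)
  obtain i where "lookup (pos_sign U i * (cst (zvar i) - yvar i) * ecoeff f (insert i U)) a \<noteq> 0"
    using ne unfolding kder_def ecoeff_eder[OF U] lookup_sum by (rule sum.not_neutral_contains_not_neutral)
  from lookup_mult_nonzero[OF this] obtain b c where "a = b + c" "lookup (ecoeff f (insert i U)) c \<noteq> 0" by blast
  thus False using assms a by (auto simp: low_zero_def mdeg_add)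
qed

lemma kder_diff: "kder N (f - g) = kder N f - kder N g"
  by (simp add: kder_def eder_diff)

lemma kder_1 [simp]: "kder N 1 = 0"
  by (simp add: kder_def)

lemma kder_mult: "kder N (f * g) = kder N f * g + ealt f * kder N g"
  by (simp add: kder_def eder_mult)

lemma kder_kder: "kder N (kder N f) = 0"
  by (simp add: kder_def eder_eder)

lemma kder_esc_mult: "kder N (esc p * f) = esc p * kder N f"
  by (simp add: kder_def eder_esc_mult)

lemma kder_sum: "kder N (sum f A) = (\<Sum>x\<in>A. kder N (f x))"
  by (simp add: kder_def eder_sum)

section \<open>Linear maps from free modules into the exterior algebra\<close>

definition elin :: "('b \<Rightarrow> 'k::field ypoly ext) \<Rightarrow> ('b \<Rightarrow>\<^sub>0 'k zpoly) \<Rightarrow> 'k ypoly ext" where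
  "elin \<psi> f = (\<Sum>s\<in>keys f. esc (cst (lookup f s)) * \<psi> s)"

lemma elin_superset:
  "finite S \<Longrightarrow> keys f \<subseteq> S \<Longrightarrow> elin \<psi> f = (\<Sum>s\<in>S. esc (cst (lookup f s)) * \<psi> s)"
  unfolding elin_def by (rule sum.mono_neutral_left) (auto simp: in_keys_iff)

lemma elin_add: "elin \<psi> (f + g) = elin \<psi> f + elin \<psi> g"
proof -
  let ?S = "keys f \<union> keys g"
  show ?thesis
    using elin_superset[of ?S "f + g" \<psi>] elin_superset[of ?S f \<psi>] elin_superset[of ?S g \<psi>]
      Poly_Mapping.keys_add[of f g]
    by (simp add: lookup_add cst_add esc_add distrib_right sum.distrib)
qed

lemma elin_scale: "elin \<psi> (scale p f) = esc (cst p) * elin \<psi> f"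
proof -
  have "keys (scale p f) \<subseteq> keys f" by (auto simp: in_keys_iff)
  hence "elin \<psi> (scale p f) = (\<Sum>s\<in>keys f. esc (cst (lookup (scale p f) s)) * \<psi> s)"
    by (intro elin_superset) auto
  thus ?thesis by (simp add: elin_def sum_distrib_left cst_mult esc_mult mult.assoc)
qed

lemma elin_0 [simp]: "elin \<psi> 0 = 0"
  by (simp add: elin_def)

lemma elin_single [simp]: "elin \<psi> (single s p) = esc (cst p) * \<psi> s"
  using elin_superset[of "{s}" "single s p" \<psi>] by simp

lemma elin_diff: "elin \<psi> (f - g) = elin \<psi> f - elin \<psi> g"
  using elin_add[of \<psi> "f - g" g] by (simp add: algebra_simps)

lemma elin_sum: "elin \<psi> (sum f A) = (\<Sum>x\<in>A. elin \<psi> (f x))"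
  by (induction A rule: infinite_finite_induct) (auto simp: elin_add)

lemma elin_lin_ext: "elin \<psi> (lin_ext \<phi> f) = elin (\<lambda>s. elin \<psi> (\<phi> s)) f"
  unfolding lin_ext_def elin_sum elin_scale by (simp add: elin_def)

lemma lookup_ecoeff_elin:
  "lookup (ecoeff (elin \<psi> f) U) a = (\<Sum>s\<in>keys f. lookup f s * lookup (ecoeff (\<psi> s) U) a)"
  by (simp add: elin_def ecoeff_sum lookup_sum lookup_cst_mult)

text \<open>No index beyond \<open>S\<close> occurs in \<open>w\<close>. Inadmissible symbols are
  thus sent to 0, in agreement with their omission from the Eliahou-Kervaire differential.\<close>

lemma emb_eq_0:
  assumes "j \<in> S" "mmax w \<le> j"
  shows "emb N S w = (0 :: 'k::field ypoly ext)"
proof -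
  have "divdiff m w = (0 :: 'k ypoly)" if "m \<in> beyond N S" for m
  proof -
    have "j < m" using that assms(1) by (simp add: beyond_def)
    hence "m \<notin> keys w" using assms(2) mmax_ge[of m w] by linarith
    thus ?thesis by (intro divdiff_eq_0) (simp add: in_keys_iff)
  qed
  thus ?thesis unfolding emb_def by (intro sum.neutral ballI) simp
qed

lemma ebasis_empty: "ebasis {} = 1"
  by (rule ext_eqI) (simp add: ecoeff_ebasis ecoeff_one)

text \<open>The r-th entry has r - 1 predecessors, so the Eliahou-Kervaire sign (-1)^r is the
  negative of \<open>pos_sign\<close>.\<close>

lemma pos_sign_nth:
  assumes "sorted_wrt (<) \<sigma>" "1 \<le> r" "r \<le> length \<sigma>"
  shows "pos_sign (set \<sigma>) (\<sigma> ! (r - 1)) = (- 1) ^ (r - 1)"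
proof -
  have "sorted_wrt (<) (take (r - 1) \<sigma> @ \<sigma> ! (r - 1) # drop r \<sigma>)"
    using assms split_at[of r \<sigma>] by simp
  moreover have "set \<sigma> = set (take (r - 1) \<sigma> @ \<sigma> ! (r - 1) # drop r \<sigma>)"
    using assms split_at[of r \<sigma>] by simp
  ultimately have "{j \<in> set \<sigma>. j < \<sigma> ! (r - 1)} = set (take (r - 1) \<sigma>)"
    by (auto simp: sorted_wrt_append)
  moreover have "distinct (take (r - 1) \<sigma>)"
    using assms(1) by (simp add: strict_sorted_iff)
  ultimately show ?thesis using assms by (simp add: pos_sign_def distinct_card)
qed

section \<open>The embedding commutes with the differentials modulo y-degree t\<close>

context equigenerated_stable
begin

abbreviation eqv :: "'k ypoly ext \<Rightarrow> 'k ypoly ext \<Rightarrow> bool" (infix "\<approx>" 50) where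
  "f \<approx> g \<equiv> low_zero t (f - g)"

lemma eqv_trans: "f \<approx> g \<Longrightarrow> g \<approx> h \<Longrightarrow> f \<approx> h"
  using low_zero_add[of t "f - g" "g - h"] by simp

lemma eqv_sym: "f \<approx> g \<Longrightarrow> g \<approx> f"
  using low_zero_uminus[of t "f - g"] by simp

lemma eqv_add: "f \<approx> f' \<Longrightarrow> g \<approx> g' \<Longrightarrow> f + g \<approx> f' + g'"
  using low_zero_add[of t "f - f'" "g - g'"] by (simp add: algebra_simps)

lemma eqv_sum: "(\<And>x. x \<in> A \<Longrightarrow> f x \<approx> g x) \<Longrightarrow> sum f A \<approx> sum g A"
  unfolding sum_subtractf[symmetric] by (rule low_zero_sum)

lemma eqv_mult: "f \<approx> f' \<Longrightarrow> g \<approx> g' \<Longrightarrow> f * g \<approx> f' * g'"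
  using low_zero_add[of t "(f - f') * g" "f' * (g - g')"] low_zero_mult[of t "f - f'" g] low_zero_mult[of t f' "g - g'"]
  by (simp add: algebra_simps)

lemma eqv_kder: "f \<approx> g \<Longrightarrow> kder N f \<approx> kder N g"
  using low_zero_kder[of t "f - g" N] by (simp add: kder_diff)

fun emb_symb :: "symb option \<Rightarrow> 'k ypoly ext" where
  "emb_symb None = 1"
| "emb_symb (Some (\<sigma>, u)) = emb N (set \<sigma>) u"

text \<open>With M = max(u) one has z_i u = z_M w, and no index of w exceeds M. Below M the factor
  z_M comes out of each quotient, beyond M the quotients are 0, and at M they differ by w(y), which
  has y-degree t.\<close>

lemma emb_exch:
  assumes u: "u \<in> G" "1 \<le> i" "i < mmax u"
  shows "esc (cst (zvar (mmax u))) * emb N S (exch i u) \<approx> emb N S (zexp i + u)"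
proof -
  define w where "w = exch i u"
  let ?M = "mmax u"
  have eq: "zexp i + u = zexp ?M + w" using exch_props(2)[OF u] by (simp add: w_def add.commute)
  have w: "w \<in> G" using exch_props(1)[OF u] by (simp add: w_def)
  have keys: "j \<le> ?M" if "j \<in> keys w" for j
    using that keys_diff_monom[of "zexp i + u" "zexp ?M"] u mmax_ge[of j u]
    by (auto simp: w_def keys_add_monom)
  define X where "X m = cst (zvar ?M) * divdiff m w - (divdiff m (zexp ?M + w) :: 'k ypoly)" for m
  have X: "X m = (if m = ?M then - single w 1 else 0)" for m
  proof -
    consider "m < ?M" | "m = ?M" | "?M < m" by linarith
    thus ?thesis
    proof cases
      case 1
      thus ?thesis by (simp add: X_def divdiff_zexp_greater)
    next
      case 2
      have "mixed (Suc ?M) w = (single w 1 :: 'k ypoly)" using keys by (intro mixed_above) (simp add: le_imp_less_Suc)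
      thus ?thesis using 2 by (simp add: X_def divdiff_zexp_eq)
    next
      case 3
      have "lookup w m = 0" using keys[of m] 3 by (auto simp: in_keys_iff)
      thus ?thesis using 3 by (simp add: X_def divdiff_eq_0 lookup_add lookup_zexp)
    qed
  qed
  have diff: "esc (cst (zvar ?M)) * emb N S w - emb N S (zexp i + u) =
      (\<Sum>m\<in>beyond N S. esc ((- 1) ^ card S) * esc (X m) * ebasis (insert m S))"
    unfolding emb_def eq sum_distrib_left sum_subtractf[symmetric] X_def
  proof (rule sum.cong[OF refl])
    fix m
    let ?s = "(- 1) ^ card S :: 'k ypoly"
    have 1: "?s * (cst (zvar ?M) * divdiff m w) = cst (zvar ?M) * (?s * divdiff m w)" by (rule mult.left_commute)
    show "esc (cst (zvar ?M)) * (esc (?s * divdiff m w) * ebasis (insert m S)) -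
        esc (?s * divdiff m (zexp ?M + w)) * ebasis (insert m S) =
      esc ?s * esc (cst (zvar ?M) * divdiff m w - divdiff m (zexp ?M + w)) * ebasis (insert m S)"
      unfolding esc_mult[symmetric] mult.assoc[symmetric] right_diff_distrib 1 esc_diff left_diff_distrib by (simp only: mult_ac)
  qed
  have lz: "low_zero t (esc (X m))" for m
    using G_deg[OF w] by (intro low_zero_esc) (auto simp: X lookup_single when_def)
  show ?thesis
    unfolding w_def[symmetric] diff
    by (intro low_zero_sum low_zero_mult[OF disjI1[OF low_zero_mult[OF disjI2[OF lz]]]])
qed

lemma ek_basis_sets:
  assumes "(\<sigma>, u) \<in> ek_basis I q"
  shows "set \<sigma> \<subseteq> {1..N}" "u \<in> G" "card (set \<sigma>) = q" "distinct \<sigma>"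
  using assms G_mmax(2)[of u] by (fastforce simp: ek_basis_iff strict_sorted_iff distinct_card)+

lemma elin_ek_diff_symb:
  assumes "(\<sigma>, u) \<in> ek_basis I (Suc q)"
  shows "elin (\<lambda>s. emb_symb (Some s)) (ek_diff_symb I (\<sigma>, u)) \<approx> kder N (emb N (set \<sigma>) u)"
proof -
  let ?S = "set \<sigma>" and ?i = "\<lambda>r. \<sigma> ! (r - 1)" and ?M = "mmax u"
  have \<sigma>: "length \<sigma> = Suc q" "sorted_wrt (<) \<sigma>" and u: "u \<in> G" using assms by (auto simp: ek_basis_iff)
  note S = ek_basis_sets[OF assms]
  have set_del': "set (del r \<sigma>) = ?S - {?i r}" if "r \<in> {1..Suc q}" for r
    using that \<sigma> S(4) by (intro set_del) auto
  have sign: "esc (cst ((- 1) ^ r * p)) * f = esc ((- 1) ^ r) * (esc (cst p) * f)" for r p and f :: "'k ypoly ext"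
    by (simp add: cst_sign esc_mult mult.assoc)
  have "elin (\<lambda>s. emb_symb (Some s)) (ek_diff_symb I (\<sigma>, u)) =
      (\<Sum>r\<in>{1..Suc q}. esc ((- 1) ^ r) * (esc (cst (zvar (?i r))) * emb N (set (del r \<sigma>)) u)) -
      (\<Sum>r\<in>adm \<sigma> u. esc ((- 1) ^ r) * (esc (cst (zvar ?M)) * emb N (set (del r \<sigma>)) (exch (?i r) u)))"
    unfolding ek_diff_symb_eq[OF assms] elin_diff elin_sum elin_single emb_symb.simps sign zvar_def ..
  \<comment> \<open>The sum may be extended over all r, since the inadmissible symbols embed as
    0.\<close>
  also have "(\<Sum>r\<in>adm \<sigma> u. esc ((- 1) ^ r) * (esc (cst (zvar ?M)) * emb N (set (del r \<sigma>)) (exch (?i r) u))) =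
      (\<Sum>r\<in>{1..Suc q}. esc ((- 1) ^ r) * (esc (cst (zvar ?M)) * emb N (set (del r \<sigma>)) (exch (?i r) u)))"
  proof (rule sum.mono_neutral_left)
    show "\<forall>r\<in>{1..Suc q} - adm \<sigma> u. esc ((- 1) ^ r) * (esc (cst (zvar ?M)) * emb N (set (del r \<sigma>)) (exch (?i r) u)) = 0"
    proof
      fix r assume r: "r \<in> {1..Suc q} - adm \<sigma> u"
      hence r': "r \<in> {1..Suc q}" by blast
      have "(del r \<sigma>, exch (?i r) u) \<notin> ek_basis I q" using r \<sigma> by (auto simp: adm_def)
      moreover have "(del r \<sigma>, u) \<in> ek_basis I q" using ek_basis_del[OF assms r'] by simp
      moreover have "exch (?i r) u \<in> G" using exch_props(1)[OF u ek_basis_nth(1,2)[OF assms r']] .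
      ultimately obtain j where "j \<in> set (del r \<sigma>)" "mmax (exch (?i r) u) \<le> j"
        by (auto simp: ek_basis_iff not_less)
      thus "esc ((- 1) ^ r) * (esc (cst (zvar ?M)) * emb N (set (del r \<sigma>)) (exch (?i r) u)) = 0"
        by (simp add: emb_eq_0)
    qed
  qed (use \<sigma> in \<open>auto simp: adm_def\<close>)
  finally have L: "elin (\<lambda>s. emb_symb (Some s)) (ek_diff_symb I (\<sigma>, u)) =
      (\<Sum>r\<in>{1..Suc q}. esc ((- 1) ^ r) * (esc (cst (zvar (?i r))) * emb N (set (del r \<sigma>)) u -
        esc (cst (zvar ?M)) * emb N (set (del r \<sigma>)) (exch (?i r) u)))"
    by (simp only: sum_subtractf right_diff_distrib)
  let ?g = "\<lambda>i. esc (- pos_sign ?S i) * (esc (cst (zvar i)) * emb N (?S - {i}) u - emb N (?S - {i}) (zexp i + u))"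
  have "elin (\<lambda>s. emb_symb (Some s)) (ek_diff_symb I (\<sigma>, u)) \<approx> (\<Sum>r\<in>{1..Suc q}. ?g (?i r))"
    unfolding L
  proof (rule eqv_sum)
    fix r assume r: "r \<in> {1..Suc q}"
    have "(- 1) ^ r = (- pos_sign ?S (?i r) :: 'k ypoly)"
      using r \<sigma> pos_sign_nth[OF \<sigma>(2), of r, where 'a = "'k ypoly"] by (cases r) auto
    moreover have "esc (cst (zvar ?M)) * emb N (?S - {?i r}) (exch (?i r) u) \<approx> emb N (?S - {?i r}) (zexp (?i r) + u)"
      using emb_exch[OF u ek_basis_nth(1,2)[OF assms r]] .
    hence "esc (cst (zvar (?i r))) * emb N (?S - {?i r}) u - esc (cst (zvar ?M)) * emb N (?S - {?i r}) (exch (?i r) u) \<approx>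
        esc (cst (zvar (?i r))) * emb N (?S - {?i r}) u - emb N (?S - {?i r}) (zexp (?i r) + u)"
      using low_zero_uminus by fastforce
    ultimately show "esc ((- 1) ^ r) * (esc (cst (zvar (?i r))) * emb N (set (del r \<sigma>)) u -
        esc (cst (zvar ?M)) * emb N (set (del r \<sigma>)) (exch (?i r) u)) \<approx> ?g (?i r)"
      unfolding set_del'[OF r] by (intro eqv_mult) simp_all
  qed
  also have "(\<Sum>r\<in>{1..Suc q}. ?g (?i r)) = (\<Sum>i\<in>?S. ?g i)"
  proof (rule sum.reindex_bij_betw)
    have "bij_betw (\<lambda>r. r - 1) {1..Suc q} {..<Suc q}"
      by (rule bij_betw_byWitness[of _ Suc]) auto
    moreover have "bij_betw ((!) \<sigma>) {..<Suc q} ?S"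
      using \<sigma>(1) S(4) by (intro bij_betw_nth) auto
    ultimately show "bij_betw ?i {1..Suc q} ?S"
      using bij_betw_trans[of "\<lambda>r. r - 1" "{1..Suc q}" "{..<Suc q}" "(!) \<sigma>" ?S] by (simp add: o_def)
  qed
  finally have 1: "elin (\<lambda>s. emb_symb (Some s)) (ek_diff_symb I (\<sigma>, u)) \<approx> (\<Sum>i\<in>?S. ?g i)" .
  have "keys u \<subseteq> {1..N}" using G_keys u by blast
  hence "mixed (Suc N) u = (single u 1 :: 'k ypoly)" by (intro mixed_above) auto
  hence lz: "low_zero t (esc (mixed (Suc N) u) * ebasis ?S :: 'k ypoly ext)"
    using G_deg[OF u] by (intro low_zero_mult disjI1 low_zero_esc) (auto simp: lookup_single when_def)
  have "?S \<noteq> {}" using \<sigma> by auto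
  hence kd: "kder N (emb N ?S u) = (\<Sum>i\<in>?S. ?g i) - esc (mixed (Suc N) u) * ebasis ?S"
    using kder_emb[OF S(1), of u] by (simp add: esc_uminus)
  show ?thesis
    using low_zero_add[OF 1 lz] unfolding kd diff_diff_eq2 diff_add_eq .
qed

abbreviation "A \<equiv> fmod N (\<Union>p. spliced_basis I p)"

abbreviation A_comp :: "nat \<Rightarrow> (symb option \<Rightarrow>\<^sub>0 'k zpoly) set" where
  "A_comp p \<equiv> fmod N (spliced_basis I p)"

lemma spliced_basis_cases:
  assumes "s \<in> spliced_basis I p"
  obtains "s = None" "p = 0" | \<sigma> u q where "s = Some (\<sigma>, u)" "p = Suc q" "(\<sigma>, u) \<in> ek_basis I q"
  using assms by (cases p) (auto simp: spliced_basis_def)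

lemma spliced_basis_simps [simp]:
  "spliced_basis I 0 = {None}" "spliced_basis I (Suc q) = Some ` ek_basis I q"
  by (simp_all add: spliced_basis_def)

lemma spliced_diff_symb_fmod: "s \<in> spliced_basis I (Suc p) \<Longrightarrow> spliced_diff_symb I s \<in> A_comp p"
proof -
  assume "s \<in> spliced_basis I (Suc p)"
  then obtain \<sigma> u where s: "s = Some (\<sigma>, u)" "(\<sigma>, u) \<in> ek_basis I p" by auto
  show ?thesis
  proof (cases p)
    case 0
    thus ?thesis using s G_keys by (auto simp: ek_basis_iff intro!: fmod_single)
  next
    case (Suc q)
    hence "\<sigma> \<noteq> []" using s by (auto simp: ek_basis_iff)
    thus ?thesis using s Suc
      by (auto simp del: ek_diff_symb.simps intro!: lin_ext_fmod[where B = "ek_basis I q"] ek_diff_symb_fmod fmod_single)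
  qed
qed

lemma spliced_diff_fmod: "f \<in> A_comp (Suc p) \<Longrightarrow> spliced_diff I f \<in> A_comp p"
  unfolding spliced_diff_def by (erule lin_ext_fmod) (rule spliced_diff_symb_fmod)

lemma spliced_diff_symb_A: "s \<in> (\<Union>p. spliced_basis I p) \<Longrightarrow> spliced_diff_symb I s \<in> A"
proof -
  assume "s \<in> (\<Union>p. spliced_basis I p)"
  then obtain p where p: "s \<in> spliced_basis I p" by blast
  show ?thesis
  proof (cases p)
    case 0
    thus ?thesis using p by simp
  next
    case (Suc q)
    thus ?thesis using p spliced_diff_symb_fmod fmod_mono[of "spliced_basis I q" "\<Union>p. spliced_basis I p" N] by blast
  qed
qed

lemma spliced_diff_A: "f \<in> A \<Longrightarrow> spliced_diff I f \<in> A"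
  unfolding spliced_diff_def by (erule lin_ext_fmod) (rule spliced_diff_symb_A)

abbreviation "Phi \<equiv> elin emb_symb"

text \<open>For empty \<sigma> the boundary telescopes to u(z) - u(y), and u(y) vanishes in C;
  otherwise this is \<open>elin_ek_diff_symb\<close>.\<close>

lemma Phi_spliced_diff_symb:
  assumes "s \<in> spliced_basis I p"
  shows "Phi (spliced_diff_symb I s) \<approx> kder N (emb_symb s)"
  using assms
proof (cases rule: spliced_basis_cases)
  case 1
  thus ?thesis by simp
next
  case (2 \<sigma> u q)
  have u: "u \<in> G" using 2 by (simp add: ek_basis_iff)
  show ?thesis
  proof (cases q)
    case 0
    hence \<sigma>: "\<sigma> = []" using 2 by (simp add: ek_basis_iff)
    have ku: "keys u \<subseteq> {1..N}" using G_keys u by blast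
    hence "mixed (Suc N) u = (single u 1 :: 'k ypoly)" by (intro mixed_above) auto
    moreover have "mixed 1 u = (cst (mon u) :: 'k ypoly)" using ku by (intro mixed_one) auto
    ultimately have "kder N (emb N {} u) = esc (cst (mon u) - single u 1 :: 'k ypoly)"
      using kder_emb[of "{}" N u, where 'k = 'k] by (simp add: ebasis_empty)
    moreover have "low_zero t (esc (single u 1 :: 'k ypoly))"
      using G_deg[OF u] by (intro low_zero_esc) (auto simp: lookup_single when_def)
    ultimately show ?thesis using 2 \<sigma> by (simp add: esc_diff)
  next
    case (Suc q')
    hence "\<sigma> \<noteq> []" using 2 by (auto simp: ek_basis_iff)
    thus ?thesis using elin_ek_diff_symb[of \<sigma> u q'] 2 Suc by (simp add: elin_lin_ext del: ek_diff_symb.simps)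
  qed
qed

lemma Phi_spliced_diff:
  assumes "f \<in> A"
  shows "Phi (spliced_diff I f) \<approx> kder N (Phi f)"
  unfolding spliced_diff_def elin_lin_ext unfolding elin_def kder_sum kder_esc_mult
proof (rule eqv_sum)
  fix s assume "s \<in> keys f"
  then obtain p where "s \<in> spliced_basis I p" using assms by (auto simp: fmod_def)
  from Phi_spliced_diff_symb[OF this]
  show "esc (cst (lookup f s)) * (\<Sum>s'\<in>keys (spliced_diff_symb I s). esc (cst (lookup (spliced_diff_symb I s) s')) * emb_symb s')
      \<approx> esc (cst (lookup f s)) * kder N (emb_symb s)"
    unfolding elin_def by (intro eqv_mult) simp_all
qed

section \<open>The image of the embedding\<close>

text \<open>The multiples of \<open>y\<^sup>a e\<^sub>S\<close> satisfying \<open>good S a\<close> span a subalgebra, and modulo terms of degree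
  at least \<open>t\<close> in the \<open>y\<^sub>i\<close> the image of the embedding consists of the elements which, together with
  their boundary, belong to that subalgebra.\<close>

definition good :: "nat set \<Rightarrow> monom \<Rightarrow> bool" where
  "good S a \<longleftrightarrow> (S = {} \<and> a = 0) \<or>
    (S \<noteq> {} \<and> S \<subseteq> {1..N} \<and> keys a \<subseteq> {1..Max S} \<and>
      (\<forall>b. mdeg a + mdeg b + 1 = t \<longrightarrow> keys b \<subseteq> {1..Max S} \<longrightarrow> a + b + zexp (Max S) \<in> G))"

definition spanned :: "'k ypoly ext \<Rightarrow> bool" where
  "spanned f \<longleftrightarrow> (\<forall>S a. mdeg a < t \<longrightarrow> lookup (ecoeff f S) a \<in> polys N \<and> (lookup (ecoeff f S) a \<noteq> 0 \<longrightarrow> good S a))"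

lemma spanned_low_zero: "low_zero t f \<Longrightarrow> spanned f"
  by (simp add: spanned_def low_zero_def)

lemma spanned_0 [simp]: "spanned 0"
  by (simp add: spanned_low_zero)

lemma spanned_1 [simp]: "spanned 1"
  by (auto simp: spanned_def ecoeff_one lookup_one when_def good_def)

lemma spanned_add: "spanned f \<Longrightarrow> spanned g \<Longrightarrow> spanned (f + g)"
  unfolding spanned_def by (simp add: lookup_add polys_add) (metis add.right_neutral)

lemma spanned_uminus: "spanned f \<Longrightarrow> spanned (- f)"
  by (simp add: spanned_def)

lemma spanned_diff: "spanned f \<Longrightarrow> spanned g \<Longrightarrow> spanned (f - g)"
  using spanned_add[of f "- g"] spanned_uminus by simp

lemma spanned_eqv: "spanned f \<Longrightarrow> f \<approx> g \<Longrightarrow> spanned g"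
  using spanned_diff[of f "f - g"] spanned_low_zero by simp

lemma spanned_sum: "(\<And>x. x \<in> B \<Longrightarrow> spanned (f x)) \<Longrightarrow> spanned (sum f B)"
  by (induction B rule: infinite_finite_induct) (auto intro: spanned_add)

lemma spanned_scale: "p \<in> polys N \<Longrightarrow> spanned f \<Longrightarrow> spanned (esc (cst p) * f)"
  unfolding spanned_def by (auto simp: lookup_cst_mult polys_mult)

lemma spanned_ealt: "spanned f \<Longrightarrow> spanned (ealt f)"
  unfolding spanned_def by (auto simp: lookup_sign_mult polys_mult)

text \<open>The factor with the larger maximum decides: a completion of a + b by c is a completion
  of a by b + c, as the indices of b stay below Max S.\<close>

lemma good_mult:
  assumes ne: "S \<noteq> {}" "T \<noteq> {}" and g: "good S a" "good T b" and gt: "Max T < Max S"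
  shows "good (S \<union> T) (a + b)"
proof -
  have S: "S \<subseteq> {1..N}" "keys a \<subseteq> {1..Max S}"
    "\<And>c. mdeg a + mdeg c + 1 = t \<Longrightarrow> keys c \<subseteq> {1..Max S} \<Longrightarrow> a + c + zexp (Max S) \<in> G"
    using g(1) ne unfolding good_def by blast+
  have T: "T \<subseteq> {1..N}" "keys b \<subseteq> {1..Max T}" using g(2) ne unfolding good_def by blast+
  have fin: "finite S" "finite T" using S(1) T(1) finite_subset by blast+
  have M: "Max (S \<union> T) = Max S" using fin ne gt by (simp add: Max_Un)
  have kb: "keys b \<subseteq> {1..Max S}" using T(2) gt by fastforce
  have "a + b + c + zexp (Max S) \<in> G" if "mdeg (a + b) + mdeg c + 1 = t" "keys c \<subseteq> {1..Max S}" for c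
    using S(3)[of "b + c"] that kb by (simp add: mdeg_add keys_add_monom add_ac)
  thus ?thesis
    using ne S T kb unfolding good_def M keys_add_monom by blast
qed

lemma spanned_mult:
  assumes f: "spanned f" and g: "spanned g"
  shows "spanned (f * g)"
  unfolding spanned_def
proof (intro allI impI conjI)
  fix U a assume a: "mdeg a < t"
  show "lookup (ecoeff (f * g) U) a \<in> polys N"
  proof (cases "finite U")
    case True
    have "lookup (ecoeff f S * ecoeff g (U - S)) a \<in> polys N" for S
      unfolding lookup_mult_sum
    proof (intro polys_sum)
      fix b c
      show "(lookup (ecoeff f S) b * lookup (ecoeff g (U - S)) c when b + c = a) \<in> polys N"
      proof (cases "b + c = a")
        case True
        hence "mdeg b < t" "mdeg c < t" using a by (auto simp: mdeg_add)
        hence "lookup (ecoeff f S) b \<in> polys N" "lookup (ecoeff g (U - S)) c \<in> polys N"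
          using f g unfolding spanned_def by blast+
        thus ?thesis using True by (simp add: polys_mult)
      qed simp
    qed
    thus ?thesis unfolding ecoeff_mult[OF True] lookup_sum esign_def mult.assoc lookup_sign_mult
      by (intro polys_sum polys_mult) simp_all
  qed (simp add: ecoeff_infinite)
  assume ne: "lookup (ecoeff (f * g) U) a \<noteq> 0"
  from lookup_ecoeff_mult_nonzero[OF ne] obtain S b c where S: "finite U" "S \<subseteq> U" "a = b + c"
    "lookup (ecoeff f S) b \<noteq> 0" "lookup (ecoeff g (U - S)) c \<noteq> 0"
    by blast
  have "mdeg b < t" "mdeg c < t" using a S(3) by (auto simp: mdeg_add)
  hence bc: "good S b" "good (U - S) c" using f g S(4,5) unfolding spanned_def by blast+
  \<comment> \<open>An empty part comes with exponent 0; two nonempty disjoint parts have different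
    maxima.\<close>
  consider "S = {}" | "U - S = {}" | "S \<noteq> {}" "U - S \<noteq> {}" by blast
  thus "good U a"
  proof cases
    case 1
    thus ?thesis using bc S by (simp add: good_def)
  next
    case 2
    hence "c = 0" "U = S" using bc(2) S(2) by (auto simp: good_def)
    thus ?thesis using bc(1) S(3) by simp
  next
    case 3
    have U: "S \<union> (U - S) = U" "(U - S) \<union> S = U" using S(2) by auto
    have fin: "finite S" "finite (U - S)" using S finite_subset by auto
    have "Max S \<noteq> Max (U - S)" using Max_in[OF fin(1) 3(1)] Max_in[OF fin(2) 3(2)] by auto
    then consider "Max (U - S) < Max S" | "Max S < Max (U - S)" by linarith
    thus ?thesis
    proof cases
      case 1
      from good_mult[OF 3 bc 1] show ?thesis unfolding U S(3) .
    next
      case 2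
      from good_mult[OF 3(2,1) bc(2,1) 2] show ?thesis unfolding U S(3) by (simp only: add.commute)
    qed
  qed
qed

text \<open>One at a time, the last variable of \<open>b\<close>, of index at least m, is exchanged
  for a variable of \<open>d\<close>, of index at most m.\<close>

lemma G_replace:
  assumes "m \<in> keys c" "keys c \<subseteq> {..m}" "keys b \<subseteq> {m..}" "keys d \<subseteq> {1..m}" "mdeg b = mdeg d" "c + b \<in> G"
  shows "c + d \<in> G"
  using assms
proof (induction "mdeg b" arbitrary: b c d)
  case 0
  thus ?case by simp
next
  case (Suc n)
  let ?M = "mmax b"
  have "b \<noteq> 0" using Suc(2) by (intro notI) simp
  moreover have "d \<noteq> 0" using Suc(2,7) by (intro notI) simp
  ultimately obtain i where i: "i \<in> keys d" and M: "?M \<in> keys b" using mmax_in_keys by blast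
  have im: "1 \<le> i" "i \<le> m" "m \<le> ?M" using i M Suc(5,6) by auto
  note b = zexp_add_diff[OF M, symmetric] and d = zexp_add_diff[OF i, symmetric]
  have deg: "mdeg b = 1 + mdeg (b - zexp ?M)" "mdeg d = 1 + mdeg (d - zexp i)"
    using arg_cong[OF b, of mdeg] arg_cong[OF d, of mdeg] by (simp_all add: mdeg_add)
  have "mmax (c + b) = ?M"
  proof (rule mmax_eqI)
    fix j assume "j \<in> keys (c + b)"
    thus "j \<le> ?M" using Suc(4) im mmax_ge[of j b] by (auto simp: keys_add_monom)
  qed (use M in \<open>simp add: keys_add_monom\<close>)
  have base: "(c + zexp i) + (b - zexp ?M) \<in> G"
  proof (cases "i < ?M")
    case True
    have "zexp i + (c + b) - zexp ?M \<in> G"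
      using G_exchange[OF Suc(8) im(1)] True unfolding \<open>mmax (c + b) = ?M\<close> .
    also have "zexp i + (c + b) = zexp ?M + ((c + zexp i) + (b - zexp ?M))"
      by (subst (1) b) (simp only: add_ac)
    also have "\<dots> - zexp ?M = (c + zexp i) + (b - zexp ?M)" by (rule add_diff_cancel_left')
    finally show ?thesis .
  next
    case False
    hence "i = ?M" using im by simp
    hence "(c + zexp i) + (b - zexp ?M) = c + (zexp ?M + (b - zexp ?M))" by (simp only: add.assoc)
    thus ?thesis using Suc(8) unfolding b[symmetric] by simp
  qed
  have "(c + zexp i) + (d - zexp i) \<in> G"
  proof (rule Suc(1)[of "b - zexp ?M"])
    show "keys (c + zexp i) \<subseteq> {..m}" using Suc(4) im by (auto simp: keys_add_monom)
    show "keys (b - zexp ?M) \<subseteq> {m..}" using Suc(5) keys_diff_monom by blast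
    show "keys (d - zexp i) \<subseteq> {1..m}" using Suc(6) keys_diff_monom by blast
    show "m \<in> keys (c + zexp i)" using Suc(3) by (simp add: keys_add_monom)
    show "n = mdeg (b - zexp ?M)" "mdeg (b - zexp ?M) = mdeg (d - zexp i)"
      using Suc(2,7) deg by linarith+
  qed (rule base)
  thus ?case by (subst d) (simp only: add_ac)
qed

text \<open>A term y^a z^b with e_m comes from a cut u = a z_m b, with b in indices from m on. A
  completion of a z_m in indices up to m arises by replacing b, hence lies in
  \<open>G\<close>.\<close>

lemma spanned_emb:
  assumes u: "u \<in> G" and S: "S \<subseteq> {1..N}"
  shows "spanned (emb N S u)"
  unfolding emb_def
proof (rule spanned_sum)
  fix m assume m: "m \<in> beyond N S"
  let ?f = "esc ((- 1) ^ card S * divdiff m u) * ebasis (insert m S) :: 'k ypoly ext"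
  have coeff: "lookup (ecoeff ?f U) a =
      (if U = insert m S \<and> finite S then (- 1) ^ card S * lookup (divdiff m u) a else 0)" for U a
    by (simp add: ecoeff_ebasis lookup_sign_mult)
  have expand: "lookup (divdiff m u) a = (\<Sum>j<lookup u m. mon (single m (lookup u m - 1 - j) + mrestrict {m<..} u)
      when mrestrict {..<m} u + single m j = a :: 'k zpoly)" for a
    by (simp add: divdiff_def lookup_sum lookup_single)
  show "spanned ?f" unfolding spanned_def
  proof (intro allI impI conjI)
    fix U a assume a: "mdeg a < t"
    have "(\<Sum>j<lookup u m. mon (single m (lookup u m - 1 - j) + mrestrict {m<..} u)
      when mrestrict {..<m} u + single m j = a :: 'k zpoly) \<in> polys N"
      using divdiff_splittings(5)[of _ u m] G_keys[OF u]
      by (intro polys_sum) (auto simp: when_def simp del: One_nat_def intro!: subset_trans[of _ "keys u" "{1..N}"])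
    thus "lookup (ecoeff ?f U) a \<in> polys N" unfolding coeff expand by (simp add: polys_mult)
    assume "lookup (ecoeff ?f U) a \<noteq> 0"
    hence U: "U = insert m S" "finite S" and "lookup (divdiff m u) a \<noteq> (0 :: 'k zpoly)"
      unfolding coeff by (auto split: if_splits)
    then obtain j where j: "j < lookup u m" "mrestrict {..<m} u + single m j = a"
      unfolding expand by (elim sum.not_neutral_contains_not_neutral) (auto simp: when_def split: if_splits)
    define b where "b = single m (lookup u m - 1 - j) + mrestrict {m<..} u"
    note s = divdiff_splittings[OF j(1), folded b_def, unfolded j(2)]
    have M: "Max U = m" unfolding U(1) using U(2) m by (intro Max_eqI) (auto simp: beyond_def)
    have "U \<noteq> {}" "U \<subseteq> {1..N}" using U S m by (auto simp: beyond_def)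
    moreover have "keys a \<subseteq> {1..m}" using s(2,4) G_keys[OF u] by fastforce
    moreover have "a + c + zexp m \<in> G" if c: "mdeg a + mdeg c + 1 = t" "keys c \<subseteq> {1..m}" for c
    proof -
      have "mdeg u = mdeg a + 1 + mdeg b" using arg_cong[OF s(1), of mdeg] by (simp add: mdeg_add)
      hence "mdeg b = mdeg c" using c(1) G_deg[OF u] by simp
      moreover have "a + zexp m + b \<in> G" using s(1) u by simp
      ultimately have "a + zexp m + c \<in> G"
        using s(2,3) c(2) by - (rule G_replace[of m _ b c], auto simp: keys_add_monom)
      thus ?thesis by (simp add: add_ac)
    qed
    ultimately show "good U a" unfolding good_def M by blast
  qed
qed

end

lemma ecoeff_emb:
  assumes S: "finite S"
  shows "ecoeff (emb N S u) U =
    (if \<exists>m\<in>beyond N S. U = insert m S then (- 1) ^ card S * divdiff (Max U) u else (0 :: 'k::field ypoly))"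
proof -
  have coeff: "ecoeff (emb N S u) U =
      (\<Sum>m\<in>beyond N S. if U = insert m S then (- 1) ^ card S * divdiff m u else (0 :: 'k ypoly))"
    unfolding emb_def ecoeff_sum ecoeff_esc_mult ecoeff_ebasis using S by (intro sum.cong) simp_all
  have M: "Max (insert m S) = m" if "m \<in> beyond N S" for m
    using S that by (intro Max_eqI) (auto simp: beyond_def)
  show ?thesis
  proof (cases "\<exists>m\<in>beyond N S. U = insert m S")
    case True
    then obtain m where m: "m \<in> beyond N S" "U = insert m S" by blast
    have "U = insert m' S \<longleftrightarrow> m' = m" if "m' \<in> beyond N S" for m'
    proof
      assume "U = insert m' S"
      hence "Max (insert m' S) = Max (insert m S)" using m(2) by (simp only:)
      thus "m' = m" unfolding M[OF that] M[OF m(1)] .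
    qed (use m(2) in \<open>simp only:\<close>)
    hence "ecoeff (emb N S u) U = (\<Sum>m'\<in>beyond N S. if m' = m then (- 1) ^ card S * divdiff m' u else (0 :: 'k ypoly))"
      unfolding coeff by (intro sum.cong) auto
    also have "\<dots> = (- 1) ^ card S * divdiff m u" using m(1) by simp
    finally have "ecoeff (emb N S u) U = (- 1) ^ card S * (divdiff m u :: 'k ypoly)" .
    moreover have "Max U = m" unfolding m(2) by (rule M[OF m(1)])
    ultimately show ?thesis unfolding if_P[OF True] by (simp only:)
  next
    case False
    have "ecoeff (emb N S u) U = (\<Sum>m'\<in>beyond N S. 0 :: 'k ypoly)"
      unfolding coeff using False by (intro sum.cong) auto
    thus ?thesis unfolding if_not_P[OF False] by simp
  qed
qed

section \<open>Injectivity, by the coefficients in y-degree t - 1\<close>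

context equigenerated_stable
begin

lemma spanned_Phi:
  assumes "f \<in> A"
  shows "spanned (Phi f)"
  unfolding elin_def
proof (intro spanned_sum spanned_scale)
  fix s assume s: "s \<in> keys f"
  show "lookup f s \<in> polys N" using assms unfolding fmod_def by blast
  obtain p where "s \<in> spliced_basis I p" using s assms unfolding fmod_def by blast
  thus "spanned (emb_symb s)"
  proof (cases rule: spliced_basis_cases)
    case (2 \<sigma> u q)
    thus ?thesis using spanned_emb ek_basis_sets(1,2) by simp
  qed simp
qed

lemma spanned_kder_Phi: "f \<in> A \<Longrightarrow> spanned (kder N (Phi f))"
  by (rule spanned_eqv[OF spanned_Phi[OF spliced_diff_A] Phi_spliced_diff])

text \<open>Concerns the position at which a symbol is recognized in its image: \<tau> enlarged by
  max(w), with exponent w / z_max(w), of y-degree t - 1.\<close>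

lemma ek_basis_top:
  assumes "(\<tau>, w) \<in> ek_basis I q"
  shows "mmax w \<in> beyond N (set \<tau>)" "Max (insert (mmax w) (set \<tau>)) = mmax w"
    "insert (mmax w) (set \<tau>) - {mmax w} = set \<tau>" "card (insert (mmax w) (set \<tau>)) = Suc q"
    "insert (mmax w) (set \<tau>) \<subseteq> {1..N}"
    "w - zexp (mmax w) + zexp (mmax w) = w" "mdeg (w - zexp (mmax w)) + 1 = t"
proof -
  have w: "w \<in> G" "\<And>i. i \<in> set \<tau> \<Longrightarrow> i < mmax w" using assms by (auto simp: ek_basis_iff)
  show *: "mmax w \<in> beyond N (set \<tau>)" using w(2) G_mmax(2)[OF w(1)] by (simp add: beyond_def)
  show "Max (insert (mmax w) (set \<tau>)) = mmax w"
    using w(2) by (intro Max_eqI) (auto intro: less_imp_le)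
  have "mmax w \<notin> set \<tau>" using w(2) by blast
  thus "insert (mmax w) (set \<tau>) - {mmax w} = set \<tau>" "card (insert (mmax w) (set \<tau>)) = Suc q"
    using ek_basis_sets(3)[OF assms] by auto
  show "insert (mmax w) (set \<tau>) \<subseteq> {1..N}" using * ek_basis_sets(1)[OF assms] by (auto simp: beyond_def)
  show eq: "w - zexp (mmax w) + zexp (mmax w) = w"
    using zexp_add_diff[OF G_mmax(1)[OF w(1)]] by (simp add: add.commute)
  show "mdeg (w - zexp (mmax w)) + 1 = t"
    using arg_cong[OF eq, of mdeg] G_deg[OF w(1)] by (simp add: mdeg_add)
qed

text \<open>The maximum of the set determines m and hence \<sigma>; then
  \<open>lookup_divdiff_top\<close> determines u. So no two symbols share such a position.\<close>

lemma top_coeff: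
  assumes s: "s \<in> spliced_basis I p" and \<tau>: "(\<tau>, w) \<in> ek_basis I q"
  shows "lookup (ecoeff (emb_symb s) (insert (mmax w) (set \<tau>))) (w - zexp (mmax w)) =
    (if s = Some (\<tau>, w) then (- 1) ^ q else 0)"
  using s
proof (cases rule: spliced_basis_cases)
  case 1
  thus ?thesis by (simp add: ecoeff_one)
next
  case (2 \<sigma> u q')
  let ?M = "mmax w" let ?U = "insert ?M (set \<tau>)"
  note top = ek_basis_top[OF \<tau>]
  show ?thesis
  proof (cases "\<exists>m\<in>beyond N (set \<sigma>). ?U = insert m (set \<sigma>)")
    case True
    then obtain m where m: "m \<in> beyond N (set \<sigma>)" "?U = insert m (set \<sigma>)" by blast
    have "Max (insert m (set \<sigma>)) = m" using m(1) by (intro Max_eqI) (auto simp: beyond_def)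
    hence mM: "m = ?M" using top(2) m(2) by simp
    have "m \<notin> set \<sigma>" using m(1) by (auto simp: beyond_def)
    hence "set \<sigma> = insert m (set \<sigma>) - {m}" by auto
    also have "\<dots> = set \<tau>" using m(2) top(3) unfolding mM by simp
    finally have "\<sigma> = \<tau>"
      using 2(3) \<tau> by (intro strict_sorted_equal) (auto simp: ek_basis_iff)
    have u: "u \<in> G" using 2(3) by (simp add: ek_basis_iff)
    have "lookup (divdiff ?M u) (w - zexp ?M) = (if ?M = mmax u \<and> u = w - zexp ?M + zexp ?M then 1 else (0 :: 'k zpoly))"
      using top(7) G_deg[OF u] by (intro lookup_divdiff_top) simp
    hence "lookup (divdiff ?M u) (w - zexp ?M) = (if u = w then 1 else (0 :: 'k zpoly))"
      unfolding top(6) by auto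
    thus ?thesis
      unfolding 2(1) emb_symb.simps ecoeff_emb[OF finite_set] if_P[OF True] lookup_sign_mult top(2)
      using \<open>\<sigma> = \<tau>\<close> ek_basis_sets(3)[OF \<tau>] by simp
  next
    case False
    hence "(\<sigma>, u) \<noteq> (\<tau>, w)" using top(1) by blast
    thus ?thesis
      unfolding 2(1) emb_symb.simps ecoeff_emb[OF finite_set] if_not_P[OF False] by simp
  qed
qed

lemma const_coeff: "s \<in> spliced_basis I p \<Longrightarrow> lookup (ecoeff (emb_symb s) {}) 0 = (if s = None then 1 else 0)"
  by (erule spliced_basis_cases) (simp_all add: ecoeff_one ecoeff_emb)

lemma Phi_top:
  assumes "h \<in> A" "(\<tau>, w) \<in> ek_basis I q"
  shows "lookup (ecoeff (Phi h) (insert (mmax w) (set \<tau>))) (w - zexp (mmax w)) = (- 1) ^ q * lookup h (Some (\<tau>, w))"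
proof -
  have "lookup (ecoeff (Phi h) (insert (mmax w) (set \<tau>))) (w - zexp (mmax w)) =
      (\<Sum>s\<in>keys h. if s = Some (\<tau>, w) then lookup h s * (- 1) ^ q else 0)"
    unfolding lookup_ecoeff_elin
  proof (rule sum.cong[OF refl])
    fix s assume "s \<in> keys h"
    then obtain p where "s \<in> spliced_basis I p" using assms(1) unfolding fmod_def by blast
    from top_coeff[OF this assms(2)]
    show "lookup h s * lookup (ecoeff (emb_symb s) (insert (mmax w) (set \<tau>))) (w - zexp (mmax w)) =
      (if s = Some (\<tau>, w) then lookup h s * (- 1) ^ q else 0)" by simp
  qed
  thus ?thesis by (simp add: in_keys_iff mult.commute)
qed

lemma Phi_const:
  assumes "h \<in> A"
  shows "lookup (ecoeff (Phi h) {}) 0 = lookup h None"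
proof -
  have "lookup (ecoeff (Phi h) {}) 0 = (\<Sum>s\<in>keys h. if s = None then lookup h s else 0)"
    unfolding lookup_ecoeff_elin
  proof (rule sum.cong[OF refl])
    fix s assume "s \<in> keys h"
    then obtain p where "s \<in> spliced_basis I p" using assms(1) unfolding fmod_def by blast
    from const_coeff[OF this]
    show "lookup h s * lookup (ecoeff (emb_symb s) {}) 0 = (if s = None then lookup h s else 0)" by simp
  qed
  thus ?thesis by (simp add: in_keys_iff)
qed

lemma Phi_low_zero:
  assumes h: "h \<in> A" and z: "low_zero t (Phi h)"
  shows "h = 0"
proof (rule poly_mapping_eqI)
  fix s
  have "lookup h s = 0" if s: "s \<in> keys h"
  proof -
    obtain p where "s \<in> spliced_basis I p" using s h unfolding fmod_def by blast
    thus ?thesis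
    proof (cases rule: spliced_basis_cases)
      case 1
      have "lookup (ecoeff (Phi h) {}) 0 = 0" using z t_pos by (simp add: low_zero_def)
      thus ?thesis using Phi_const[OF h] 1 by simp
    next
      case (2 \<sigma> u q)
      have "mdeg (u - zexp (mmax u)) < t" using ek_basis_top(7)[OF 2(3)] by simp
      hence "(- 1) ^ q * lookup h (Some (\<sigma>, u)) = 0"
        using z Phi_top[OF h 2(3)] unfolding low_zero_def by simp
      thus ?thesis using 2(1) by (simp add: minus_one_power_iff split: if_splits)
    qed
  qed
  thus "lookup h s = lookup 0 s" by (auto simp: in_keys_iff)
qed

lemma A_eqI: "f \<in> A \<Longrightarrow> g \<in> A \<Longrightarrow> Phi f \<approx> Phi g \<Longrightarrow> f = g"
  using Phi_low_zero[of "f - g"] fmod_diff[of f N _ g] by (simp add: elin_diff)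

text \<open>An element of highest degree in the \<open>y\<^sub>i\<close> among the nonzero terms contributes a term
  \<open>y\<^sup>a z\<^sub>m e\<^sub>S\<close>, \<open>m > max S\<close>, to the boundary, and this term cannot cancel.\<close>

lemma low_zero_if_top_zero:
  assumes g: "spanned g" and dg: "spanned (kder N g)"
    and top: "\<And>S a. S \<noteq> {} \<Longrightarrow> mdeg a + 1 = t \<Longrightarrow> lookup (ecoeff g S) a = 0"
    and const: "lookup (ecoeff g {}) 0 = 0"
  shows "low_zero t g"
  unfolding low_zero_def
proof (intro allI impI)
  fix S a
  assume "mdeg a < t"
  thus "lookup (ecoeff g S) a = 0"
  \<comment> \<open>Downward induction on the y-degree; for nonempty \<open>S\<close> the degree t -
    1 is covered by \<open>top\<close>.\<close>
  proof (induction "t - mdeg a" arbitrary: S a rule: less_induct)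
    case less
    show ?case
    proof (rule ccontr)
      assume ne: "lookup (ecoeff g S) a \<noteq> 0"
      hence good_S: "good S a" using g less(2) unfolding spanned_def by blast
      have S: "S \<noteq> {}"
      proof
        assume "S = {}"
        hence "a = 0" using good_S unfolding good_def by blast
        thus False using ne const \<open>S = {}\<close> by simp
      qed
      have deg: "mdeg a + 1 < t" using top[OF S, of a] ne less(2) by linarith
      have S': "S \<subseteq> {1..N}" "keys a \<subseteq> {1..Max S}" using good_S S unfolding good_def by blast+
      have fin: "finite S" using S'(1) finite_subset by blast
      define m where "m = Max S"
      define T where "T = S - {m}"
      define b where "b = a + zexp m"
      have m: "m \<in> S" "m \<notin> T" "insert m T = S" "m \<in> {1..N}"
        using Max_in[OF fin S] S'(1) by (auto simp: m_def T_def)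
      have T_less: "i < m" if "i \<in> T" for i
        using that Max_ge[OF fin, of i] by (auto simp: T_def m_def order.order_iff_strict)
      have finT: "finite T" using fin by (simp add: T_def)
      have mdeg_b: "mdeg b = mdeg a + 1" by (simp add: b_def mdeg_add)
      have yterm: "lookup (yvar i * p) b = (if i \<in> keys b then lookup p (b - zexp i) else 0)" for i and p :: "'k ypoly"
      proof -
        have "lookup (yvar i * p) b = (\<Sum>c\<in>keys p. lookup p c when c + zexp i = b)"
          unfolding yvar_def lookup_mult_sum by (simp add: add.commute)
        also have "\<dots> = (\<Sum>c\<in>keys p. if i \<in> keys b \<and> c = b - zexp i then lookup p c else 0)"
        proof (rule sum.cong[OF refl])
          fix c
          have "c + zexp i = b \<longleftrightarrow> i \<in> keys b \<and> c = b - zexp i"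
          proof
            assume e: "c + zexp i = b"
            show "i \<in> keys b \<and> c = b - zexp i" unfolding e[symmetric] by (simp add: keys_add_monom)
          next
            assume e: "i \<in> keys b \<and> c = b - zexp i"
            hence "b - zexp i + zexp i = b" using zexp_add_diff by (metis add.commute)
            thus "c + zexp i = b" using e by simp
          qed
          thus "(lookup p c when c + zexp i = b) = (if i \<in> keys b \<and> c = b - zexp i then lookup p c else 0)"
            unfolding when_def by (rule if_cong) simp_all
        qed
        finally show ?thesis by (cases "i \<in> keys b") (simp_all add: in_keys_iff)
      qed
      \<comment> \<open>The z_i in z_i - y_i would act on a coefficient of the higher degree mdeg a
        + 1, which is 0 by induction.\<close>
      have x_zero: "lookup (ecoeff g U) b = 0" for U
        using less(1)[of b U] mdeg_b deg by simp
      \<comment> \<open>For i other than m the exponent still contains m, which exceeds the maximum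
        of the set \<open>insert i T\<close>.\<close>
      have y_zero: "lookup (ecoeff g (insert i T)) (b - zexp i) = 0" if i: "i \<in> keys b" "i \<noteq> m" for i
      proof (rule ccontr)
        assume ne': "lookup (ecoeff g (insert i T)) (b - zexp i) \<noteq> 0"
        have e: "b - zexp i + zexp i = b"
          using zexp_add_diff[OF i(1)] by (simp add: add.commute)
        have "mdeg (b - zexp i) = mdeg a" using mdeg_b arg_cong[OF e, of mdeg] by (simp add: mdeg_add)
        hence "good (insert i T) (b - zexp i)" using ne' g less(2) unfolding spanned_def by simp
        hence "keys (b - zexp i) \<subseteq> {1..Max (insert i T)}" unfolding good_def by blast
        moreover have "m \<in> keys (b - zexp i)" using i(2) by (simp add: b_def in_keys_iff lookup_add lookup_minus lookup_zexp)
        ultimately have "m \<le> Max (insert i T)" by auto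
        moreover have "i \<in> keys a" using i by (auto simp: b_def keys_add_monom)
        hence "i < m" using S'(2) i(2) by (fastforce simp: m_def)
        hence "Max (insert i T) < m" using finT T_less by simp
        ultimately show False by simp
      qed
      have summand: "lookup (pos_sign T i * (cst (zvar i) - yvar i) * ecoeff g (insert i T)) b =
          (if i = m then - ((- 1) ^ card {j \<in> T. j < m} * lookup (ecoeff g S) a) else 0)" for i
      proof -
        have "lookup (pos_sign T i * (cst (zvar i) - yvar i) * ecoeff g (insert i T)) b =
            - ((- 1) ^ card {j \<in> T. j < i} * lookup (yvar i * ecoeff g (insert i T)) b)"
          unfolding pos_sign_def mult.assoc lookup_sign_mult left_diff_distrib lookup_minus lookup_cst_mult x_zero
          by simp
        also have "lookup (yvar i * ecoeff g (insert i T)) b = (if i = m then lookup (ecoeff g S) a else 0)"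
        proof (cases "i = m")
          case True
          have "m \<in> keys b" "b - zexp m = a" by (simp_all add: b_def keys_add_monom)
          thus ?thesis using True m(3) by (simp add: yterm)
        next
          case False
          thus ?thesis using y_zero[of i] by (simp add: yterm)
        qed
        finally show ?thesis by simp
      qed
      have "lookup (ecoeff (kder N g) T) b = - ((- 1) ^ card {j \<in> T. j < m} * lookup (ecoeff g S) a)"
        unfolding kder_def ecoeff_eder[OF finT] lookup_sum summand using m(2,4) by simp
      hence "lookup (ecoeff (kder N g) T) b \<noteq> 0"
        using ne by (simp add: minus_one_power_iff)
      \<comment> \<open>The surviving term sits at \<open>T\<close> with an exponent divisible by
        y_m, although m exceeds all of \<open>T\<close>.\<close>
      hence "good T b" using dg mdeg_b deg unfolding spanned_def by simp
      moreover have "b \<noteq> 0" using mdeg_b by auto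
      ultimately have "T \<noteq> {}" "keys b \<subseteq> {1..Max T}" unfolding good_def by blast+
      moreover have "m \<in> keys b" by (simp add: b_def keys_add_monom)
      ultimately have "m \<le> Max T" by auto
      thus False using T_less Max_in[OF finT \<open>T \<noteq> {}\<close>] by fastforce
    qed
  qed
qed


section \<open>Surjectivity, by reading off the preimage in y-degree t - 1\<close>

definition homog :: "nat \<Rightarrow> 'k ypoly ext \<Rightarrow> bool" where
  "homog p f \<longleftrightarrow> (\<forall>S. card S \<noteq> p \<longrightarrow> ecoeff f S = 0)"

lemma homog_mult:
  assumes "homog p f" "homog q g"
  shows "homog (p + q) (f * g)"
  unfolding homog_def
proof (intro allI impI)
  fix U :: "nat set" assume U: "card U \<noteq> p + q"
  show "ecoeff (f * g) U = 0"
  proof (cases "finite U")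
    case True
    have "esign S (U - S) * ecoeff f S * ecoeff g (U - S) = 0" if S: "S \<in> Pow U" for S
    proof -
      have "card U = card S + card (U - S)" using S True by (simp add: card_Diff_subset rev_finite_subset card_mono)
      hence "card S \<noteq> p \<or> card (U - S) \<noteq> q" using U by linarith
      thus ?thesis using assms unfolding homog_def by fastforce
    qed
    thus ?thesis unfolding ecoeff_mult[OF True] by (rule sum.neutral[OF ballI])
  qed (simp add: ecoeff_infinite)
qed

lemma homog_Phi:
  assumes "f \<in> A_comp p"
  shows "homog p (Phi f)"
  unfolding homog_def
proof (intro allI impI)
  fix S :: "nat set" assume S: "card S \<noteq> p"
  have "ecoeff (emb_symb s) S = 0" if "s \<in> keys f" for s
  proof -
    have "s \<in> spliced_basis I p" using that assms unfolding fmod_def by blast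
    thus ?thesis
    proof (cases rule: spliced_basis_cases)
      case 1
      thus ?thesis using S by (auto simp: ecoeff_one)
    next
      case (2 \<sigma> u q)
      have "\<not> (\<exists>m\<in>beyond N (set \<sigma>). S = insert m (set \<sigma>))"
      proof
        assume "\<exists>m\<in>beyond N (set \<sigma>). S = insert m (set \<sigma>)"
        then obtain m where m: "m \<in> beyond N (set \<sigma>)" "S = insert m (set \<sigma>)" by blast
        have "m \<notin> set \<sigma>" using m(1) by (auto simp: beyond_def)
        hence "card S = p" using m(2) 2(2) ek_basis_sets(3)[OF 2(3)] by simp
        thus False using S by simp
      qed
      from if_not_P[OF this] show ?thesis unfolding 2(1) emb_symb.simps ecoeff_emb[OF finite_set] .
    qed
  qed
  thus "ecoeff (Phi f) S = 0" unfolding elin_def ecoeff_sum ecoeff_esc_mult by (intro sum.neutral ballI) simp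
qed

text \<open>In y-degree t - 1 the completion is empty and the condition says that a z_max(S) is a
  generator; every allowed position of that degree thus belongs to an admissible symbol.\<close>

lemma good_top:
  assumes g: "good S a" and S: "S \<noteq> {}" and a: "mdeg a + 1 = t"
  defines "\<sigma> \<equiv> sorted_list_of_set (S - {Max S})" and "u \<equiv> a + zexp (Max S)"
  shows "(\<sigma>, u) \<in> ek_basis I (length \<sigma>)" "insert (mmax u) (set \<sigma>) = S" "u - zexp (mmax u) = a"
proof -
  have S': "S \<subseteq> {1..N}" "keys a \<subseteq> {1..Max S}"
    "\<And>b. mdeg a + mdeg b + 1 = t \<Longrightarrow> keys b \<subseteq> {1..Max S} \<Longrightarrow> a + b + zexp (Max S) \<in> G"
    using g S unfolding good_def by blast+
  have fin: "finite S" using S'(1) finite_subset by blast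
  have M: "mmax u = Max S" using S'(2) by (intro mmax_eqI) (auto simp: u_def keys_add_monom)
  have u: "u \<in> G" using S'(3)[of 0] a by (simp add: u_def)
  have set\<sigma>: "set \<sigma> = S - {Max S}" using fin by (simp add: \<sigma>_def)
  show "insert (mmax u) (set \<sigma>) = S" using Max_in[OF fin S] by (auto simp: M set\<sigma>)
  show "u - zexp (mmax u) = a" unfolding M by (simp add: u_def)
  have "1 \<le> i \<and> i < mmax u" if "i \<in> set \<sigma>" for i
    using that S'(1) Max_ge[OF fin, of i] unfolding set\<sigma> M by (auto simp: order.order_iff_strict)
  thus "(\<sigma>, u) \<in> ek_basis I (length \<sigma>)" using u by (simp add: ek_basis_iff \<sigma>_def)
qed

text \<open>The coefficients of the prospective preimage; the power of -1 undoes the sign in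
  \<open>emb\<close>.\<close>

definition top_part :: "'k ypoly ext \<Rightarrow> symb option \<Rightarrow> 'k zpoly" where
  "top_part f s = (case s of None \<Rightarrow> lookup (ecoeff f {}) 0 | Some (\<sigma>, u) \<Rightarrow>
    if (\<sigma>, u) \<in> ek_basis I (length \<sigma>)
    then (- 1) ^ length \<sigma> * lookup (ecoeff f (insert (mmax u) (set \<sigma>))) (u - zexp (mmax u)) else 0)"

lemma top_part_nonzero:
  assumes "top_part f (Some (\<sigma>, u)) \<noteq> 0"
  shows "(\<sigma>, u) \<in> ek_basis I (length \<sigma>)"
    "lookup (ecoeff f (insert (mmax u) (set \<sigma>))) (u - zexp (mmax u)) \<noteq> 0"
proof -
  show "(\<sigma>, u) \<in> ek_basis I (length \<sigma>)"
    using assms unfolding top_part_def option.case prod.case by (rule contrapos_np) simp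
  show "lookup (ecoeff f (insert (mmax u) (set \<sigma>))) (u - zexp (mmax u)) \<noteq> 0"
    using assms unfolding top_part_def option.case prod.case by (rule contrapos_nn) simp
qed

text \<open>A symbol is recovered from its position, and there are finitely many positions with S
  inside {1..N} and a in the support of the coefficient at S.\<close>

lemma finite_top_part: "finite {s. top_part f s \<noteq> 0}"
proof (rule finite_subset)
  let ?F = "\<lambda>(S, a). Some (sorted_list_of_set (S - {Max S}), a + zexp (Max S))"
  let ?X = "Sigma (Pow {1..N}) (\<lambda>S. keys (ecoeff f S))"
  show "{s. top_part f s \<noteq> 0} \<subseteq> insert None (?F ` ?X)"
  proof
    fix s assume s: "s \<in> {s. top_part f s \<noteq> 0}"
    show "s \<in> insert None (?F ` ?X)"
    proof (cases s)
      case (Some \<sigma>u)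
      obtain \<sigma> u where su: "s = Some (\<sigma>, u)" using Some by (cases \<sigma>u) auto
      let ?S = "insert (mmax u) (set \<sigma>)" and ?a = "u - zexp (mmax u)"
      have ne: "top_part f (Some (\<sigma>, u)) \<noteq> 0" using s su by simp
      note b = top_part_nonzero(1)[OF ne]
      note top = ek_basis_top[OF b]
      have "lookup (ecoeff f ?S) ?a \<noteq> 0" by (rule top_part_nonzero(2)[OF ne])
      hence X: "(?S, ?a) \<in> ?X" using top(5) by (simp add: in_keys_iff)
      have "sorted_list_of_set (set \<sigma>) = \<sigma>"
        using b by (simp add: ek_basis_iff sorted_list_of_set.idem_if_sorted_distinct strict_sorted_iff)
      hence "s = ?F (?S, ?a)" unfolding prod.case top(2,3,6) su by simp
      hence "s \<in> ?F ` ?X" using X by (rule image_eqI)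
      thus ?thesis by (rule insertI2)
    qed simp
  qed
qed simp

text \<open>The image of the element read off from \<open>f\<close> agrees with \<open>f\<close> at
  the top positions and in the constant, so the difference is 0 in C. The clause on
  \<open>homog\<close> serves to make the product graded.\<close>

lemma Phi_surj:
  assumes f: "spanned f" and df: "spanned (kder N f)"
  obtains h where "h \<in> A" "Phi h \<approx> f" "\<forall>p. homog p f \<longrightarrow> h \<in> A_comp p"
proof -
  define h where "h = Abs_poly_mapping (top_part f)"
  have lookup_h: "lookup h s = top_part f s" for s
    unfolding h_def using finite_top_part[of f] by simp
  have low: "lookup (ecoeff f S) a \<in> polys N" if "mdeg a < t" for S a
    using f that unfolding spanned_def by blast
  have polys: "lookup h s \<in> polys N" for s
  proof (cases s)
    case None
    thus ?thesis using low[of 0 "{}"] t_pos by (simp add: lookup_h top_part_def)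
  next
    case (Some \<sigma>u)
    obtain \<sigma> u where su: "s = Some (\<sigma>, u)" using Some by (cases \<sigma>u) auto
    show ?thesis
    proof (cases "(\<sigma>, u) \<in> ek_basis I (length \<sigma>)")
      case True
      have "mdeg (u - zexp (mmax u)) < t" using ek_basis_top(7)[OF True] by simp
      thus ?thesis using low True by (simp add: su lookup_h top_part_def polys_mult)
    qed (simp add: su lookup_h top_part_def)
  qed
  have keys_h: "s \<in> (\<Union>p. spliced_basis I p) \<and> (\<forall>p. homog p f \<longrightarrow> s \<in> spliced_basis I p)" if s: "s \<in> keys h" for s
  proof (cases s)
    case None
    have "s \<in> spliced_basis I 0" using None by simp
    moreover have "p = 0" if p: "homog p f" for p
    proof (rule ccontr)
      assume "p \<noteq> 0"
      hence "ecoeff f {} = 0" using p by (simp add: homog_def)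
      thus False using s None by (simp add: in_keys_iff lookup_h top_part_def)
    qed
    ultimately show ?thesis by blast
  next
    case (Some \<sigma>u)
    obtain \<sigma> u where su: "s = Some (\<sigma>, u)" using Some by (cases \<sigma>u) auto
    have ne: "top_part f (Some (\<sigma>, u)) \<noteq> 0" using s su by (simp add: in_keys_iff lookup_h)
    note b = top_part_nonzero(1)[OF ne]
    have "s \<in> spliced_basis I (Suc (length \<sigma>))" using b su by simp
    moreover have "p = Suc (length \<sigma>)" if p: "homog p f" for p
    proof (rule ccontr)
      assume "p \<noteq> Suc (length \<sigma>)"
      hence "ecoeff f (insert (mmax u) (set \<sigma>)) = 0"
        using p ek_basis_top(4)[OF b] unfolding homog_def by simp
      thus False using top_part_nonzero(2)[OF ne] by simp
    qed
    ultimately show ?thesis by blast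
  qed
  have h: "h \<in> A" using keys_h polys unfolding fmod_def by blast
  have "low_zero t (f - Phi h)"
  proof (rule low_zero_if_top_zero)
    show g: "spanned (f - Phi h)" using spanned_diff[OF f spanned_Phi[OF h]] .
    show "spanned (kder N (f - Phi h))" unfolding kder_diff using spanned_diff[OF df spanned_kder_Phi[OF h]] .
    show "lookup (ecoeff (f - Phi h) {}) 0 = 0"
      using Phi_const[OF h] by (simp add: lookup_minus lookup_h top_part_def)
    fix S :: "nat set" and a :: monom
    assume S: "S \<noteq> {}" and a: "mdeg a + 1 = t"
    show "lookup (ecoeff (f - Phi h) S) a = 0"
    proof (rule ccontr)
      assume "lookup (ecoeff (f - Phi h) S) a \<noteq> 0"
      hence good: "good S a" using g a unfolding spanned_def by auto
      define \<sigma> where "\<sigma> = sorted_list_of_set (S - {Max S})"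
      define u where "u = a + zexp (Max S)"
      note top = good_top[OF good S a, folded \<sigma>_def u_def]
      have "lookup (ecoeff (Phi h) S) a = (- 1) ^ length \<sigma> * lookup h (Some (\<sigma>, u))"
        using Phi_top[OF h top(1)] unfolding top(2,3) .
      also have "lookup h (Some (\<sigma>, u)) = (- 1) ^ length \<sigma> * lookup (ecoeff f S) a"
        unfolding lookup_h top_part_def option.case prod.case if_P[OF top(1)] top(2,3) ..
      finally have "lookup (ecoeff (Phi h) S) a = lookup (ecoeff f S) a"
        by (simp flip: mult.assoc power_mult_distrib)
      thus False using \<open>lookup (ecoeff (f - Phi h) S) a \<noteq> 0\<close> by (simp add: lookup_minus)
    qed
  qed
  hence "Phi h \<approx> f" by (rule eqv_sym)
  moreover have "h \<in> A_comp p" if "homog p f" for p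
    using keys_h polys that unfolding fmod_def by blast
  hence "\<forall>p. homog p f \<longrightarrow> h \<in> A_comp p" by blast
  ultimately show thesis using that[OF h] by blast
qed

section \<open>The multiplication\<close>

text \<open>For arguments in \<open>A\<close> a solution exists by \<open>Phi_surj\<close> and is
  unique by \<open>A_eqI\<close>.\<close>

definition mult_A :: "(symb option \<Rightarrow>\<^sub>0 'k zpoly) \<Rightarrow> (symb option \<Rightarrow>\<^sub>0 'k zpoly) \<Rightarrow> (symb option \<Rightarrow>\<^sub>0 'k zpoly)" where
  "mult_A f g = (THE h. h \<in> A \<and> Phi h \<approx> Phi f * Phi g)"

lemma mult_A_eqI:
  assumes "h \<in> A" "Phi h \<approx> Phi f * Phi g"
  shows "mult_A f g = h"
  unfolding mult_A_def
proof (rule the_equality)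
  fix h' assume h': "h' \<in> A \<and> Phi h' \<approx> Phi f * Phi g"
  hence "Phi h' \<approx> Phi h" by (intro eqv_trans[OF conjunct2 eqv_sym[OF assms(2)]])
  with h' show "h' = h" using assms(1) by (intro A_eqI) simp_all
qed (use assms in blast)

lemma mult_A_props:
  assumes f: "f \<in> A" and g: "g \<in> A"
  shows "mult_A f g \<in> A" "Phi (mult_A f g) \<approx> Phi f * Phi g"
    "homog p (Phi f * Phi g) \<Longrightarrow> mult_A f g \<in> A_comp p"
proof -
  have 1: "spanned (Phi f * Phi g)" by (rule spanned_mult[OF spanned_Phi[OF f] spanned_Phi[OF g]])
  \<comment> \<open>By the Leibniz rule in C the boundary is a sum of products of spanned
    elements.\<close>
  have 2: "spanned (kder N (Phi f * Phi g))"
    unfolding kder_mult 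
    by (rule spanned_add[OF spanned_mult[OF spanned_kder_Phi[OF f] spanned_Phi[OF g]] spanned_mult[OF spanned_ealt[OF spanned_Phi[OF f]] spanned_kder_Phi[OF g]]])
  obtain h where h: "h \<in> A" "Phi h \<approx> Phi f * Phi g" "\<forall>p. homog p (Phi f * Phi g) \<longrightarrow> h \<in> A_comp p"
    by (rule Phi_surj[OF 1 2])
  have "mult_A f g = h" by (rule mult_A_eqI[OF h(1,2)])
  thus "mult_A f g \<in> A" "Phi (mult_A f g) \<approx> Phi f * Phi g"
    "homog p (Phi f * Phi g) \<Longrightarrow> mult_A f g \<in> A_comp p"
    using h by simp_all
qed

lemma mult_A_assoc:
  assumes "f \<in> A" "g \<in> A" "h \<in> A"
  shows "mult_A (mult_A f g) h = mult_A f (mult_A g h)"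
proof (rule mult_A_eqI)
  note fg = mult_A_props(1,2)[OF assms(1,2)] and gh = mult_A_props(1,2)[OF assms(2,3)]
  note f_gh = mult_A_props(1,2)[OF assms(1) gh(1)]
  show "mult_A f (mult_A g h) \<in> A" by (rule f_gh(1))
  have 1: "Phi f * Phi (mult_A g h) \<approx> Phi f * (Phi g * Phi h)" using gh(2) by (intro eqv_mult) simp_all
  have 2: "Phi (mult_A f g) * Phi h \<approx> Phi f * Phi g * Phi h" using fg(2) by (intro eqv_mult) simp_all
  show "Phi (mult_A f (mult_A g h)) \<approx> Phi (mult_A f g) * Phi h"
    by (rule eqv_trans[OF eqv_trans[OF f_gh(2) 1] eqv_sym[OF 2[unfolded mult.assoc]]])
qed

lemma mult_A_add_left:
  assumes "f \<in> A" "f' \<in> A" "g \<in> A"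
  shows "mult_A (f + f') g = mult_A f g + mult_A f' g"
proof (rule mult_A_eqI)
  note m = mult_A_props(1,2)[OF assms(1,3)] mult_A_props(1,2)[OF assms(2,3)]
  show "mult_A f g + mult_A f' g \<in> A" using m by (intro fmod_add)
  show "Phi (mult_A f g + mult_A f' g) \<approx> Phi (f + f') * Phi g"
    unfolding elin_add distrib_right using m by (intro eqv_add)
qed

lemma mult_A_add_right:
  assumes "f \<in> A" "g \<in> A" "g' \<in> A"
  shows "mult_A f (g + g') = mult_A f g + mult_A f g'"
proof (rule mult_A_eqI)
  note m = mult_A_props(1,2)[OF assms(1,2)] mult_A_props(1,2)[OF assms(1,3)]
  show "mult_A f g + mult_A f g' \<in> A" using m by (intro fmod_add)
  show "Phi (mult_A f g + mult_A f g') \<approx> Phi f * Phi (g + g')"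
    unfolding elin_add distrib_left using m by (intro eqv_add)
qed

lemma mult_A_scale:
  assumes "p \<in> polys N" "f \<in> A" "g \<in> A"
  shows "mult_A (scale p f) g = scale p (mult_A f g)" "mult_A f (scale p g) = scale p (mult_A f g)"
proof -
  note m = mult_A_props(1,2)[OF assms(2,3)]
  have A: "scale p (mult_A f g) \<in> A" using assms(1) m(1) by (rule fmod_scale)
  have *: "Phi (scale p (mult_A f g)) \<approx> esc (cst p) * (Phi f * Phi g)"
    unfolding elin_scale using m(2) by (intro eqv_mult) simp_all
  show "mult_A (scale p f) g = scale p (mult_A f g)"
    using A * by (intro mult_A_eqI) (simp_all only: elin_scale mult.assoc)
  have "Phi f * Phi (scale p g) = esc (cst p) * (Phi f * Phi g)"
    unfolding elin_scale by (simp only: mult.assoc[symmetric] esc_commute)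
  thus "mult_A f (scale p g) = scale p (mult_A f g)"
    using A * by (intro mult_A_eqI) (simp_all only:)
qed

definition one_A :: "symb option \<Rightarrow>\<^sub>0 'k zpoly" where
  "one_A = single None 1"

lemma Phi_one_A: "Phi one_A = 1"
  by (simp add: one_A_def)

lemma one_A_fmod: "one_A \<in> A_comp 0"
  by (simp add: one_A_def fmod_single)

lemma fmod_spliced_A: "A_comp p \<subseteq> A"
  by (rule fmod_mono) blast

lemma mult_A_one:
  assumes "f \<in> A"
  shows "mult_A one_A f = f" "mult_A f one_A = f"
  using assms by (intro mult_A_eqI; simp add: Phi_one_A)+

lemma mult_A_graded:
  assumes "f \<in> A_comp p" "g \<in> fmod N (spliced_basis I q)"
  shows "mult_A f g \<in> A_comp (p + q)"
  using mult_A_props(3)[OF subsetD[OF fmod_spliced_A assms(1)] subsetD[OF fmod_spliced_A assms(2)]]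
    homog_mult[OF homog_Phi[OF assms(1)] homog_Phi[OF assms(2)]] .

text \<open>The Koszul differential squares to 0 and the embedding is injective, which spares a case
  analysis of admissible symbols.\<close>

lemma spliced_diff_twice:
  assumes "f \<in> A"
  shows "spliced_diff I (spliced_diff I f) = 0"
proof (rule Phi_low_zero)
  have 1: "spliced_diff I f \<in> A" using spliced_diff_A assms .
  show "spliced_diff I (spliced_diff I f) \<in> A" using spliced_diff_A 1 .
  have "Phi (spliced_diff I (spliced_diff I f)) \<approx> kder N (kder N (Phi f))"
    using eqv_trans[OF Phi_spliced_diff[OF 1] eqv_kder[OF Phi_spliced_diff[OF assms]]] .
  thus "low_zero t (Phi (spliced_diff I (spliced_diff I f)))" by (simp add: kder_kder)
qed

lemma ealt_homog:
  assumes "homog p f"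
  shows "ealt f = esc (cst ((- 1) ^ p)) * f"
proof (rule ext_eqI)
  fix S :: "nat set"
  have "cst ((- 1) ^ p) = ((- 1) ^ p :: 'k ypoly)" using cst_sign[of p 1] by simp
  thus "ecoeff (ealt f) S = ecoeff (esc (cst ((- 1) ^ p)) * f) S"
    using assms by (cases "card S = p") (simp_all add: homog_def)
qed

lemma Leibniz:
  assumes f: "f \<in> A_comp p" and g: "g \<in> A"
  shows "spliced_diff I (mult_A f g) =
    mult_A (spliced_diff I f) g + scale ((- 1) ^ p) (mult_A f (spliced_diff I g))"
proof (rule A_eqI)
  have fA: "f \<in> A" using f fmod_spliced_A by blast
  note df = spliced_diff_A[OF fA] and dg = spliced_diff_A[OF g]
  note fg = mult_A_props(1,2)[OF fA g] and dfg = mult_A_props(1,2)[OF df g] and fdg = mult_A_props(1,2)[OF fA dg]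
  show "spliced_diff I (mult_A f g) \<in> A" using spliced_diff_A fg(1) .
  show "mult_A (spliced_diff I f) g + scale ((- 1) ^ p) (mult_A f (spliced_diff I g)) \<in> A"
    using dfg(1) fdg(1) by (intro fmod_add fmod_scale) simp_all
  have "Phi (spliced_diff I (mult_A f g)) \<approx> kder N (Phi f * Phi g)"
    using eqv_trans[OF Phi_spliced_diff[OF fg(1)] eqv_kder[OF fg(2)]] .
  also have "kder N (Phi f * Phi g) = kder N (Phi f) * Phi g + esc (cst ((- 1) ^ p)) * (Phi f * kder N (Phi g))"
    unfolding kder_mult ealt_homog[OF homog_Phi[OF f]] mult.assoc ..
  finally have 1: "Phi (spliced_diff I (mult_A f g)) \<approx> \<dots>" .
  have "Phi (mult_A (spliced_diff I f) g) \<approx> kder N (Phi f) * Phi g"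
    by (rule eqv_trans[OF dfg(2) eqv_mult[OF Phi_spliced_diff[OF fA]]]) simp
  moreover have "Phi (mult_A f (spliced_diff I g)) \<approx> Phi f * kder N (Phi g)"
    by (rule eqv_trans[OF fdg(2) eqv_mult[OF _ Phi_spliced_diff[OF g]]]) simp
  hence "Phi (scale ((- 1) ^ p) (mult_A f (spliced_diff I g))) \<approx> esc (cst ((- 1) ^ p)) * (Phi f * kder N (Phi g))"
    unfolding elin_scale by (intro eqv_mult) simp_all
  ultimately have "Phi (mult_A (spliced_diff I f) g + scale ((- 1) ^ p) (mult_A f (spliced_diff I g))) \<approx>
      kder N (Phi f) * Phi g + esc (cst ((- 1) ^ p)) * (Phi f * kder N (Phi g))"
    unfolding elin_add by (rule eqv_add)
  thus "Phi (spliced_diff I (mult_A f g)) \<approx>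
      Phi (mult_A (spliced_diff I f) g + scale ((- 1) ^ p) (mult_A f (spliced_diff I g)))"
    by (intro eqv_trans[OF 1 eqv_sym])
qed

end

section \<open>Back to the Eliahou-Kervaire complex: splicing, exactness, resolution\<close>

lemma lin_ext_cong: "(\<And>s. s \<in> keys f \<Longrightarrow> \<phi> s = \<psi> s) \<Longrightarrow> lin_ext \<phi> f = lin_ext \<psi> f"
  unfolding lin_ext_def by (intro sum.cong) auto

text \<open>Viewed as a map to the free module on one basis vector, the augmentation inherits its
  linearity from \<open>lin_ext\<close>.\<close>

lemma ek_aug_lin_ext: "ek_aug f = lookup (lin_ext (\<lambda>s. single () (mon (snd s))) f) ()"
  by (simp add: ek_aug_def lookup_lin_ext)

lemma ek_aug_add: "ek_aug (f + g) = ek_aug f + ek_aug g"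
  by (simp add: ek_aug_lin_ext lin_ext_add lookup_add)

lemma ek_aug_scale: "ek_aug (scale p f) = p * ek_aug f"
  by (simp add: ek_aug_lin_ext lin_ext_scale)

lemma ek_aug_sum: "ek_aug (sum f B) = (\<Sum>x\<in>B. ek_aug (f x))"
  by (simp add: ek_aug_lin_ext lin_ext_sum lookup_sum)

lemma ek_aug_single: "ek_aug (single s p) = p * mon (snd s)"
  by (simp add: ek_aug_lin_ext)

definition splice :: "(symb \<Rightarrow>\<^sub>0 'k::field zpoly) \<Rightarrow> (symb option \<Rightarrow>\<^sub>0 'k zpoly)" where
  "splice = lin_ext (\<lambda>s. single (Some s) 1)"

lemma splice_eq_0:
  assumes "splice f = 0"
  shows "f = 0"
proof (rule poly_mapping_eqI)
  fix s
  have "lookup (splice f) (Some s) = (\<Sum>s'\<in>keys f. if s' = s then lookup f s' else 0)"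
    unfolding splice_def lookup_lin_ext by (intro sum.cong) (simp_all add: lookup_single when_def)
  thus "lookup f s = lookup 0 s" using assms by (auto simp: in_keys_iff split: if_splits)
qed

context equigenerated_stable
begin

lemma splice_A: "f \<in> EK q \<Longrightarrow> splice f \<in> A"
  unfolding splice_def
proof (erule lin_ext_fmod)
  fix s assume "s \<in> ek_basis I q"
  hence "Some s \<in> spliced_basis I (Suc q)" by simp
  thus "single (Some s) 1 \<in> A" by (intro fmod_single UN_I[of "Suc q"]) simp_all
qed

lemma spliced_diff_splice:
  assumes "f \<in> EK (Suc q)"
  shows "spliced_diff I (splice f) = splice (ek_diff I f)"
  unfolding splice_def spliced_diff_def ek_diff_def lin_ext_lin_ext
proof (rule lin_ext_cong)
  fix s assume "s \<in> keys f"
  hence "s \<in> ek_basis I (Suc q)" using assms unfolding fmod_def by blast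
  moreover obtain \<sigma> u where "s = (\<sigma>, u)" by (cases s)
  ultimately show "lin_ext (spliced_diff_symb I) (single (Some s) 1) = lin_ext (\<lambda>s. single (Some s) 1) (ek_diff_symb I s)"
    by (auto simp: ek_basis_iff simp del: ek_diff_symb.simps)
qed

lemma spliced_diff_splice_0:
  assumes "f \<in> EK 0"
  shows "spliced_diff I (splice f) = single None (ek_aug f)"
proof -
  have "spliced_diff I (splice f) = lin_ext (\<lambda>s. single None (mon (snd s))) f"
    unfolding splice_def spliced_diff_def lin_ext_lin_ext
  proof (rule lin_ext_cong)
    fix s assume "s \<in> keys f"
    hence "s \<in> ek_basis I 0" using assms unfolding fmod_def by blast
    moreover obtain \<sigma> u where "s = (\<sigma>, u)" by (cases s)
    ultimately show "lin_ext (spliced_diff_symb I) (single (Some s) 1) = single None (mon (snd s))"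
      by (simp add: ek_basis_iff)
  qed
  also have "\<dots> = (\<Sum>s\<in>keys f. single None (lookup f s * mon (snd s)))"
    by (simp add: lin_ext_def)
  also have "\<dots> = single None (ek_aug f)"
    unfolding ek_aug_def
    by (rule poly_mapping_eqI) (simp add: lookup_sum lookup_single when_def)
  finally show ?thesis .
qed

lemma ek_diff_twice:
  assumes "f \<in> EK (Suc (Suc q))"
  shows "ek_diff I (ek_diff I f) = 0"
proof (rule splice_eq_0)
  have "splice (ek_diff I (ek_diff I f)) = spliced_diff I (spliced_diff I (splice f))"
    using spliced_diff_splice[OF assms] spliced_diff_splice[OF ek_diff_fmod[OF assms]] by simp
  thus "splice (ek_diff I (ek_diff I f)) = 0" using spliced_diff_twice[OF splice_A[OF assms]] by simp
qed

lemma ek_aug_ek_diff: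
  assumes "f \<in> EK (Suc 0)"
  shows "ek_aug (ek_diff I f) = 0"
proof -
  have "single None (ek_aug (ek_diff I f)) = spliced_diff I (spliced_diff I (splice f))"
    using spliced_diff_splice[OF assms] spliced_diff_splice_0[OF ek_diff_fmod[OF assms]] by simp
  hence "single None (ek_aug (ek_diff I f)) = (0 :: symb option \<Rightarrow>\<^sub>0 'k zpoly)"
    using spliced_diff_twice[OF splice_A[OF assms]] by simp
  hence "lookup (single None (ek_aug (ek_diff I f))) (None :: symb option) = 0" by simp
  thus ?thesis by simp
qed

text \<open>Modulo boundaries every cycle is reduced, and a reduced cycle is 0.\<close>

lemma ek_diff_exact:
  "{x \<in> EK (Suc q). ek_diff I x = 0} = ek_diff I ` EK (Suc (Suc q))"
proof (intro equalityI subsetI)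
  fix x assume "x \<in> {x \<in> EK (Suc q). ek_diff I x = 0}"
  hence x: "x \<in> EK (Suc q)" "ek_diff I x = 0" by auto
  obtain g h where gh: "g \<in> EK (Suc (Suc q))" "h \<in> EK (Suc q)" "reduced h"
    "x = ek_diff I g + h"
    using boundary_plus_reduced[OF x(1)] by blast
  have "ek_diff I x = ek_diff I (ek_diff I g) + ek_diff I h"
    unfolding gh(4) ek_diff_def by (rule lin_ext_add)
  hence "ek_diff I h = 0" using x(2) ek_diff_twice[OF gh(1)] by simp
  hence "h = 0" by (rule reduced_ek_diff_0[OF gh(2,3)])
  thus "x \<in> ek_diff I ` EK (Suc (Suc q))" using gh(1,4) by simp
next
  fix x assume "x \<in> ek_diff I ` EK (Suc (Suc q))"
  then obtain g where "g \<in> EK (Suc (Suc q))" "x = ek_diff I g" by blast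
  thus "x \<in> {x \<in> EK (Suc q). ek_diff I x = 0}"
    using ek_diff_fmod ek_diff_twice by simp
qed

lemma ek_aug_exact: "{x \<in> EK 0. ek_aug x = 0} = ek_diff I ` EK (Suc 0)"
proof (intro equalityI subsetI)
  fix x :: "symb \<Rightarrow>\<^sub>0 'k zpoly" assume "x \<in> {x \<in> EK 0. ek_aug x = 0}"
  hence x: "x \<in> EK 0" "ek_aug x = 0" by auto
  obtain g h where gh: "g \<in> EK (Suc 0)" "h \<in> EK 0" "reduced h"
    "x = ek_diff I g + h"
    using boundary_plus_reduced[OF x(1)] by blast
  have "ek_aug h = 0" using x(2) ek_aug_ek_diff[OF gh(1)] unfolding gh(4) ek_aug_add by simp
  hence "h = 0" by (rule reduced_ek_aug_0[OF gh(2,3)])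
  thus "x \<in> ek_diff I ` EK (Suc 0)" using gh(1,4) by simp
next
  fix x assume "x \<in> ek_diff I ` EK (Suc 0)"
  then obtain g where "g \<in> EK (Suc 0)" "x = ek_diff I g" by blast
  thus "x \<in> {x \<in> EK 0. ek_aug x = 0}"
    using ek_diff_fmod ek_aug_ek_diff by simp
qed

lemma ek_aug_in_I:
  assumes f: "f \<in> EK 0"
  shows "ek_aug f \<in> I"
  unfolding I_iff
proof
  have s: "lookup f s \<in> polys N" "s \<in> keys f \<Longrightarrow> snd s \<in> G" for s
  proof -
    show "lookup f s \<in> polys N" using f unfolding fmod_def by blast
    show "snd s \<in> G" if "s \<in> keys f"
      using f that unfolding fmod_def by (auto simp: ek_basis_def min_gens_I)
  qed
  show "ek_aug f \<in> polys N"
    unfolding ek_aug_def using s G_keys by (intro polys_sum polys_mult) simp_all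
  show "\<forall>w\<in>keys (ek_aug f). \<exists>u\<in>G. \<exists>y. w = u + y"
  proof
    fix w assume "w \<in> keys (ek_aug f)"
    hence "w \<in> (\<Union>s\<in>keys f. keys (lookup f s * mon (snd s)))"
      unfolding ek_aug_def by (rule subsetD[OF keys_sum])
    then obtain s where sf: "s \<in> keys f" "w \<in> keys (lookup f s * mon (snd s))" by blast
    obtain a where "w = a + snd s" using subsetD[OF keys_mult sf(2)] by auto
    thus "\<exists>u\<in>G. \<exists>y. w = u + y" using s(2)[OF sf(1)] by (intro bexI[of _ "snd s"] exI[of _ a]) (simp_all add: add.commute)
  qed
qed

lemma ek_aug_image: "ek_aug ` EK 0 = I"
proof (intro equalityI subsetI)
  fix p assume p: "p \<in> I"
  obtain u where u: "\<And>w. w \<in> keys p \<Longrightarrow> u w \<in> G \<and> (\<exists>y. w = u w + y)"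
    using p unfolding I_iff by metis
  \<comment> \<open>Each term of \<open>p\<close> is lifted separately, through some generator
    \<open>u w\<close> dividing it.\<close>
  define f where "f = (\<Sum>w\<in>keys p. single ([], u w) (single (w - u w) (lookup p w)) :: symb \<Rightarrow>\<^sub>0 'k zpoly)"
  have w: "w = u w + (w - u w)" if "w \<in> keys p" for w
    using u[OF that] by (metis add_diff_cancel_left')
  have "f \<in> EK 0" unfolding f_def
  proof (intro fmod_sum fmod_single polys_single)
    fix w assume wp: "w \<in> keys p"
    show "([], u w) \<in> ek_basis I 0" using u[OF wp] by (simp add: ek_basis_iff)
    have "keys w \<subseteq> {1..N}" using p wp unfolding I_iff polys_def by blast
    thus "keys (w - u w) \<subseteq> {1..N}" using keys_diff_monom by blast
  qed
  moreover have "ek_aug f = p"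
  proof -
    have "ek_aug f = (\<Sum>w\<in>keys p. single w (lookup p w))"
      unfolding f_def ek_aug_sum ek_aug_single snd_conv
    proof (rule sum.cong[OF refl])
      fix w assume "w \<in> keys p"
      from w[OF this] show "single (w - u w) (lookup p w) * mon (u w) = single w (lookup p w)"
        unfolding mon_def mult_single by (simp add: add.commute)
    qed
    thus ?thesis using poly_mapping_sum_single[of p] by simp
  qed
  ultimately show "p \<in> ek_aug ` EK 0" by blast
qed (use ek_aug_in_I in blast)

lemma free_resolution_ek: "free_resolution N (ek_basis I) (\<lambda>_. ek_diff I) ek_aug I"
proof -
  have "ek_aug f \<in> polys N" if "f \<in> EK 0" for f :: "symb \<Rightarrow>\<^sub>0 'k zpoly"
    using ek_aug_in_I[OF that] by (simp add: I_iff)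
  hence "ek_aug \<in> linear_maps (poly_ring N) (free_module N (ek_basis I 0)) (poly_ring N :: ('k zpoly, 'k zpoly) module)"
    unfolding linear_maps_def by (simp add: ek_aug_add ek_aug_scale)
  thus ?thesis
    unfolding free_resolution_def Let_def free_module_simps
    using ek_diff_linear ek_aug_image ek_aug_exact ek_diff_exact by simp
qed

section \<open>The differential graded algebra on the spliced resolution\<close>

lemma disjoint_spliced_basis: "disjoint_family (spliced_basis I)"
  unfolding disjoint_family_on_def
proof (intro ballI impI)
  fix p q :: nat assume "p \<noteq> q"
  thus "spliced_basis I p \<inter> spliced_basis I q = {}"
    by (cases p; cases q) (auto simp: ek_basis_def)
qed

lemma dg_algebra_mult_A: "dg_algebra N (spliced_basis I) (spliced_diff I) (single None 1) mult_A"
proof -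
  define R where "R = (poly_ring N :: ('k zpoly, 'k zpoly) module)"
  define M where "M = (free_module N (\<Union>p. spliced_basis I p))\<lparr>mult := mult_A, one := single None 1\<rparr>"
  have M: "carrier M = A" "x \<oplus>\<^bsub>M\<^esub> y = x + y" "x \<otimes>\<^bsub>M\<^esub> y = mult_A x y" "\<zero>\<^bsub>M\<^esub> = 0" "\<one>\<^bsub>M\<^esub> = one_A"
    "p \<odot>\<^bsub>M\<^esub> y = scale p y" for x y p
    by (simp_all add: M_def free_module_def fmod_def one_A_def)
  have one: "one_A \<in> A" using one_A_fmod fmod_spliced_A by blast
  have grp: "abelian_group M"
  proof (rule abelian_groupI)
    fix x assume "x \<in> carrier M"
    thus "\<exists>y\<in>carrier M. y \<oplus>\<^bsub>M\<^esub> x = \<zero>\<^bsub>M\<^esub>"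
      unfolding M by (intro bexI[of _ "- x"]) (simp_all add: fmod_uminus)
  qed (simp_all add: M fmod_add add_ac)
  have ring: "ring M"
  proof (rule ringI[OF grp])
    show "Group.monoid M"
      by (rule monoidI) (simp_all add: M one mult_A_props(1) mult_A_assoc mult_A_one)
  qed (simp_all add: M mult_A_add_left mult_A_add_right)
  have modl: "module R M"
    by (rule moduleI)
      (simp_all add: R_def cring_poly_ring grp M fmod_scale scale_add_left scale_add_right scale_scale)
  have lin: "spliced_diff I \<in> linear_maps R M M"
    unfolding linear_maps_def R_def M
    using spliced_diff_A by (auto simp: M spliced_diff_def lin_ext_add lin_ext_scale)
  have d0: "spliced_diff I x = 0" if "x \<in> A_comp 0" for x
    unfolding spliced_diff_def lin_ext_def
  proof (rule sum.neutral, rule ballI)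
    fix s assume "s \<in> keys x"
    hence "s = None" using that unfolding fmod_def by auto
    thus "scale (lookup x s) (spliced_diff_symb I s) = 0" by simp
  qed
  show ?thesis
    unfolding dg_algebra_def Let_def
    unfolding R_def[symmetric] M_def[symmetric] M free_module_simps
  proof (intro conjI ballI allI)
    show "spliced_diff I ` A_comp (Suc p) \<subseteq> A_comp p" for p
      using spliced_diff_fmod by blast
    show "spliced_diff I (mult_A x y) =
        mult_A (spliced_diff I x) y + scale ((- 1) ^ p) (mult_A x (spliced_diff I y))"
      if "x \<in> A_comp p" "y \<in> A" for p x y
      using that by (rule Leibniz)
  qed (use disjoint_spliced_basis ring modl lin d0 in
    \<open>simp_all add: R_def mult_A_scale one_A_fmod[unfolded spliced_basis_simps] mult_A_graded spliced_diff_twice\<close>)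
qed

end

theorem lemma3p1:
  fixes n t :: nat
  assumes "1 \<le> t" and "t \<le> n"
  shows "let J = (J_ideal n t :: 'k::field zpoly set); N = 2 * n in
    stable_monomial_ideal N J \<and>
    free_resolution N (ek_basis J) (\<lambda>_. ek_diff J) ek_aug J \<and>
    minimal_complex N (ek_basis J) (\<lambda>_. ek_diff J) \<and>
    (\<forall>u\<in>min_gens J. mdeg u = t) \<and>
    linear_complex (ek_basis J) (\<lambda>_. ek_diff J) \<and>
    (\<exists>mul. dg_algebra N (spliced_basis J) (spliced_diff J) (Poly_Mapping.single None 1) mul)"
proof -
  interpret J: equigenerated_stable "2 * n" t "J_monoms (n - t + 1) t" "J_ideal n t :: 'k zpoly set"
    by (rule J_ideal_equigenerated_stable[OF assms])
  have "\<forall>u\<in>min_gens (J_ideal n t :: 'k zpoly set). mdeg u = t"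
    unfolding J.min_gens_I using J.G_deg by blast
  thus ?thesis
    unfolding Let_def
    using J.stable J.free_resolution_ek J.minimal_complex_ek J.linear_complex_ek J.dg_algebra_mult_A by blast
qed

end
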